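(* Let $X$ be a non-empty topological space. Then $X$ is homeomorphic to the edge-end space of some graph if and only if there is a winning strategy $\sigma$ for Alice in $\mathrm{RayGame}(X)$ such that: (a) the height of the tree $\mathrm{succ}(\mathrm{dom}(\sigma))$ is bounded by $\omega\cdot\omega$; (b) every non-maximal ray in $\mathrm{succ}(\mathrm{dom}(\sigma))$ contains only finitely many nodes with more than one (immediate) successor.
   Context: Edge-ends. For a graph $G$, a ray of $G$ is a one-way infinite path; two rays are edge-equivalent if no finite set of edges separates them (i.e. for every finite set $F$ of edges, they have tails in the same component of $G-F$). The classes are the edge-ends of $G$, and the edge-end space $\Omega_E(G)$ is the set of edge-ends with the topology having as basic open sets, for an edge-end $\varepsilon$ and a finite set $F$ of edges, the set of edge-ends $\eta$ such that no $R\in\varepsilon$ and $R'\in\eta$ are separated by $F$. Trees. A tree is a partially ordered set $(T,\le)$ with a minimum (its root) such that $\{s\in T:s\le t\}$ is well-ordered for every $t\in T$. The height of a node $t$ is the order type of $\{s:s<t\}$; the height of $T$ is bounded by $\omega\cdot\omega$ if every node has height $<\omega\cdot\omega$. A ray of $T$ is a non-empty downward closed chain with no maximal element; it is non-maximal if it is properly contained in another ray. The game. A partition of a set is a pairwise disjoint collection of non-empty sets whose union is that set; an open partition is one whose members are open. For a non-empty space $X$, $\mathrm{RayGame}(X)$ is a transfinite game between Alice and Bob. In inning $0$, Alice chooses an open partition $\mathcal P_0$ of $X$ and Bob picks $U_0\in\mathcal P_0$. In a successor inning $\alpha=\beta+1$, Alice chooses an open partition $\mathcal P_{\beta+1}$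 of $U_\beta$ and Bob picks $U_{\beta+1}\in\mathcal P_{\beta+1}$. In a (nonzero) limit inning $\alpha$: if there exist a pairwise disjoint collection $\mathcal P_\alpha$ of non-empty open sets and a point $x_\alpha\in X$ such that (1) $\bigcap_{\beta<\alpha}U_\beta=(\bigcup\mathcal P_\alpha)\sqcup\{x_\alpha\}$ (disjoint union) and (2) $\{U_\beta\setminus\bigcup\mathcal F:\beta<\alpha,\ \mathcal F\subset\mathcal P_\alpha\text{ finite}\}$ is a local basis at $x_\alpha$, then Alice chooses one such pair $(\mathcal P_\alpha,x_\alpha)$; if $\mathcal P_\alpha\ne\emptyset$, Bob picks $U_\alpha\in\mathcal P_\alpha$ and the game continues, while if $\mathcal P_\alpha=\emptyset$ the run ends and Alice wins. If no such pair exists, the run ends and Bob wins. Strategies. A strategy $\sigma$ for Alice is a recursively defined map assigning to each sequence $(U_\beta:\beta<\alpha)$ of Bob's moves made against $\sigma$ so far (including the empty sequence) a legal move of Alice in inning $\alpha$ whenever she has one; $\mathrm{dom}(\sigma)$ is the set of all such sequences. It is winning if every finished run in which Alice follows $\sigma$ is won by Alice. $\mathrm{succ}(\mathrm{dom}(\sigma))$ is the tree consisting of the empty sequence and all sequences in $\mathrm{dom}(\sigma)$ whose length is a successor ordinal, ordered by inclusion (extension of sequences). *)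

theory Defs
  imports "HOL-Analysis.Analysis" "HOL-Library.Disjoint_Sets"
begin

section \<open>Edge-end spaces of graphs\<close>

definition is_graph :: "'v set \<Rightarrow> 'v set set \<Rightarrow> bool" where
  "is_graph V E \<longleftrightarrow> (\<forall>e\<in>E. e \<subseteq> V \<and> card e = 2)"

text \<open>A ray is given by the enumeration of its vertices from its initial vertex on.\<close>

definition graph_rays :: "'v set set \<Rightarrow> (nat \<Rightarrow> 'v) set" where
  "graph_rays E = {r. inj r \<and> (\<forall>n. {r n, r (Suc n)} \<in> E)}"

definition graph_components :: "'v set \<Rightarrow> 'v set set \<Rightarrow> 'v set set" where
  "graph_components V E = {{w. (v, w) \<in> {(x, y). {x, y} \<in> E}\<^sup>*} | v. v \<in> V}"

definition separated_by ::
  "'v set \<Rightarrow> 'v set set \<Rightarrow> 'v set set \<Rightarrow> (nat \<Rightarrow> 'v) \<Rightarrow> (nat \<Rightarrow> 'v) \<Rightarrow> bool" where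
  "separated_by V E F r r' \<longleftrightarrow>
     \<not> (\<exists>C\<in>graph_components V (E - F). \<exists>m n. r ` {m..} \<subseteq> C \<and> r' ` {n..} \<subseteq> C)"

definition edge_equivalence :: "'v set \<Rightarrow> 'v set set \<Rightarrow> ((nat \<Rightarrow> 'v) \<times> (nat \<Rightarrow> 'v)) set" where
  "edge_equivalence V E = {(r, r'). r \<in> graph_rays E \<and> r' \<in> graph_rays E \<and>
     (\<forall>F. finite F \<and> F \<subseteq> E \<longrightarrow> \<not> separated_by V E F r r')}"

definition edge_ends :: "'v set \<Rightarrow> 'v set set \<Rightarrow> (nat \<Rightarrow> 'v) set set" where
  "edge_ends V E = graph_rays E // edge_equivalence V E"

definition edge_end_nbhd ::
  "'v set \<Rightarrow> 'v set set \<Rightarrow> 'v set set \<Rightarrow> (nat \<Rightarrow> 'v) set \<Rightarrow> (nat \<Rightarrow> 'v) set set" where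
  "edge_end_nbhd V E F \<epsilon> =
     {\<eta> \<in> edge_ends V E. \<not> (\<exists>R\<in>\<epsilon>. \<exists>R'\<in>\<eta>. separated_by V E F R R')}"

definition edge_end_space :: "'v set \<Rightarrow> 'v set set \<Rightarrow> (nat \<Rightarrow> 'v) set topology" where
  "edge_end_space V E = topology_generated_by
     {edge_end_nbhd V E F \<epsilon> | F \<epsilon>. finite F \<and> F \<subseteq> E \<and> \<epsilon> \<in> edge_ends V E}"


section \<open>Order trees\<close>

text \<open>A tree is a set \<open>T\<close> with an order \<open>le\<close>, of which only the restriction to \<open>T\<close> matters.\<close>

definition strict_preds :: "'n set \<Rightarrow> ('n \<Rightarrow> 'n \<Rightarrow> bool) \<Rightarrow> 'n \<Rightarrow> 'n set" where
  "strict_preds T le t = {s \<in> T. le s t \<and> s \<noteq> t}"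

definition order_on :: "'n set \<Rightarrow> ('n \<Rightarrow> 'n \<Rightarrow> bool) \<Rightarrow> 'n rel" where
  "order_on S le = {(s, s'). s \<in> S \<and> s' \<in> S \<and> le s s'}"

definition is_tree :: "'n set \<Rightarrow> ('n \<Rightarrow> 'n \<Rightarrow> bool) \<Rightarrow> bool" where
  "is_tree T le \<longleftrightarrow> partial_order_on T (order_on T le) \<and>
     (\<exists>r\<in>T. \<forall>t\<in>T. le r t) \<and>
     (\<forall>t\<in>T. well_order_on {s \<in> T. le s t} (order_on {s \<in> T. le s t} le))"

text \<open>The well-order of type \<open>\<omega> \<cdot> \<omega>\<close>: \<open>\<omega>\<close> copies of \<open>\<omega>\<close>, one after the other.\<close>

definition omega_omega :: "(nat \<times> nat) rel" where
  "omega_omega = {((a, b), (c, d)). a < c \<or> (a = c \<and> b \<le> d)}"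

text \<open>The relation \<^const>\<open>ordLess\<close> compares well-orders by order type.\<close>

definition height_bounded_by :: "'n set \<Rightarrow> ('n \<Rightarrow> 'n \<Rightarrow> bool) \<Rightarrow> 'o rel \<Rightarrow> bool" where
  "height_bounded_by T le r \<longleftrightarrow> (\<forall>t\<in>T. (order_on (strict_preds T le t) le, r) \<in> ordLess)"

definition tree_ray :: "'n set \<Rightarrow> ('n \<Rightarrow> 'n \<Rightarrow> bool) \<Rightarrow> 'n set \<Rightarrow> bool" where
  "tree_ray T le R \<longleftrightarrow> R \<subseteq> T \<and> R \<noteq> {} \<and>
     (\<forall>t\<in>R. \<forall>s\<in>T. le s t \<longrightarrow> s \<in> R) \<and>
     (\<forall>s\<in>R. \<forall>t\<in>R. le s t \<or> le t s) \<and>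
     \<not> (\<exists>m\<in>R. \<forall>t\<in>R. le m t \<longrightarrow> t = m)"

definition nonmaximal_tree_ray :: "'n set \<Rightarrow> ('n \<Rightarrow> 'n \<Rightarrow> bool) \<Rightarrow> 'n set \<Rightarrow> bool" where
  "nonmaximal_tree_ray T le R \<longleftrightarrow> tree_ray T le R \<and> (\<exists>R'. tree_ray T le R' \<and> R \<subset> R')"

definition immediate_succs :: "'n set \<Rightarrow> ('n \<Rightarrow> 'n \<Rightarrow> bool) \<Rightarrow> 'n \<Rightarrow> 'n set" where
  "immediate_succs T le t = {s \<in> T. t \<in> strict_preds T le s \<and>
     \<not> (\<exists>u\<in>T. t \<in> strict_preds T le u \<and> u \<in> strict_preds T le s)}"

definition branching_nodes :: "'n set \<Rightarrow> ('n \<Rightarrow> 'n \<Rightarrow> bool) \<Rightarrow> 'n set" where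
  "branching_nodes T le =
     {t \<in> T. \<exists>s\<in>immediate_succs T le t. \<exists>s'\<in>immediate_succs T le t. s \<noteq> s'}"


section \<open>Innings\<close>

text \<open>
  The innings of the game on a space with points of type \<open>'a\<close> are numbered by the ordinals below
  the successor cardinal of the infinite cardinal \<open>\<kappa> = |'a \<times> nat|\<close>.
  This covers all runs of the game: for limit innings \<open>\<alpha> < \<beta>\<close> that are both
  survived, the points \<open>x\<^sub>\<alpha>\<close> and \<open>x\<^sub>\<beta>\<close> differ, since
  \<open>x\<^sub>\<beta> \<in> U\<^sub>\<alpha>\<close> but \<open>x\<^sub>\<alpha> \<notin> U\<^sub>\<alpha>\<close>. So a run has at most
  \<open>\<kappa>\<close> limit innings, and its length is below \<open>\<kappa>\<^sup>+\<close>.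
\<close>

typedef 'a inning = "Field (cardSuc (card_of (UNIV :: ('a \<times> nat) set)))"
proof -
  have "Field (cardSuc (card_of (UNIV :: ('a \<times> nat) set))) \<noteq> {}"
    by (metis Field_cardSuc_not_empty card_of_Card_order)
  thus ?thesis by blast
qed

instantiation inning :: (type) wellorder
begin

definition less_eq_inning :: "'a inning \<Rightarrow> 'a inning \<Rightarrow> bool" where
  "\<alpha> \<le> \<beta> \<longleftrightarrow>
     (Rep_inning \<alpha>, Rep_inning \<beta>) \<in> cardSuc (card_of (UNIV :: ('a \<times> nat) set))"

definition less_inning :: "'a inning \<Rightarrow> 'a inning \<Rightarrow> bool" where
  "(\<alpha> :: 'a inning) < \<beta> \<longleftrightarrow> \<alpha> \<le> \<beta> \<and> \<alpha> \<noteq> \<beta>"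

instance
proof -
  let ?r = "cardSuc (card_of (UNIV :: ('a \<times> nat) set))"
  have wo: "Well_order ?r"
    using cardSuc_Card_order card_of_Card_order card_order_on_well_order_on by blast
  hence refl: "refl_on (Field ?r) ?r" and tr: "trans ?r" and an: "antisym ?r"
    and tot: "total_on (Field ?r) ?r" and wf: "wf (?r - Id)"
    by (auto simp: well_order_on_def linear_order_on_def partial_order_on_def preorder_on_def)
  have antisym: "\<alpha> = \<beta>" if "\<alpha> \<le> \<beta>" "\<beta> \<le> \<alpha>" for \<alpha> \<beta> :: "'a inning"
    using that an unfolding less_eq_inning_def antisym_def by (metis Rep_inning_inject)
  have wf': "wf {(\<alpha>, \<beta>::'a inning). \<alpha> < \<beta>}"
    by (rule wf_subset[OF wf_inv_image[OF wf, of Rep_inning]])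
      (auto simp: inv_image_def less_inning_def less_eq_inning_def Rep_inning_inject)
  show "OFCLASS('a inning, wellorder_class)"
  proof
    fix \<alpha> \<beta> \<gamma> :: "'a inning"
    show "\<alpha> < \<beta> \<longleftrightarrow> \<alpha> \<le> \<beta> \<and> \<not> \<beta> \<le> \<alpha>"
      using antisym unfolding less_inning_def by (metis)
    show "\<alpha> \<le> \<alpha>"
      using refl Rep_inning unfolding less_eq_inning_def refl_on_def by blast
    show "\<alpha> \<le> \<gamma>" if "\<alpha> \<le> \<beta>" "\<beta> \<le> \<gamma>"
      using that tr unfolding less_eq_inning_def trans_def by blast
    show "\<alpha> = \<beta>" if "\<alpha> \<le> \<beta>" "\<beta> \<le> \<alpha>"
      using antisym that .
    show "\<alpha> \<le> \<beta> \<or> \<beta> \<le> \<alpha>"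
      using tot \<open>\<alpha> \<le> \<alpha>\<close> Rep_inning[of \<alpha>] Rep_inning[of \<beta>]
      unfolding less_eq_inning_def total_on_def by (metis Rep_inning_inject)
  next
    fix P :: "'a inning \<Rightarrow> bool" and \<alpha>
    assume "\<And>\<alpha>. (\<And>\<beta>. \<beta> < \<alpha> \<Longrightarrow> P \<beta>) \<Longrightarrow> P \<alpha>"
    thus "P \<alpha>" using wf_induct[OF wf', of P \<alpha>] by auto
  qed
qed

end

definition succ_inning_of :: "'a inning \<Rightarrow> 'a inning \<Rightarrow> bool" where
  "succ_inning_of \<alpha> \<beta> \<longleftrightarrow> \<beta> < \<alpha> \<and> \<not> (\<exists>\<gamma>. \<beta> < \<gamma> \<and> \<gamma> < \<alpha>)"

definition limit_inning :: "'a inning \<Rightarrow> bool" where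
  "limit_inning \<alpha> \<longleftrightarrow> (\<exists>\<beta>. \<beta> < \<alpha>) \<and> \<not> (\<exists>\<beta>. succ_inning_of \<alpha> \<beta>)"


section \<open>The game\<close>

text \<open>
  A sequence \<open>(U\<^sub>\<beta> : \<beta> < \<alpha>)\<close> of moves of Bob is a partial map with domain
  \<open>{..<\<alpha>}\<close>; extension of sequences is then \<^const>\<open>map_le\<close>.
\<close>

type_synonym 'a bob_seq = "'a inning \<rightharpoonup> 'a set"

definition seq_length :: "'a bob_seq \<Rightarrow> 'a inning" where
  "seq_length s = (LEAST \<alpha>. s \<alpha> = None)"

text \<open>
  Alice plays an open partition in inning zero and in successor innings, and a pair
  \<open>(\<P>\<^sub>\<alpha>, x\<^sub>\<alpha>)\<close> in limit innings.
\<close>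

datatype 'a alice_move =
    Partition (parts: "'a set set")
  | Partition_Point (parts: "'a set set") (point: 'a)

definition open_partition_on :: "'a topology \<Rightarrow> 'a set \<Rightarrow> 'a set set \<Rightarrow> bool" where
  "open_partition_on X U P \<longleftrightarrow> partition_on U P \<and> (\<forall>V\<in>P. openin X V)"

definition local_basis_at :: "'a topology \<Rightarrow> 'a \<Rightarrow> 'a set set \<Rightarrow> bool" where
  "local_basis_at X x B \<longleftrightarrow> (\<forall>V\<in>B. openin X V \<and> x \<in> V) \<and>
     (\<forall>W. openin X W \<and> x \<in> W \<longrightarrow> (\<exists>V\<in>B. V \<subseteq> W))"

definition legal_limit_move :: "'a topology \<Rightarrow> 'a bob_seq \<Rightarrow> 'a set set \<Rightarrow> 'a \<Rightarrow> bool" where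
  "legal_limit_move X s P x \<longleftrightarrow>
     disjoint P \<and> {} \<notin> P \<and> (\<forall>V\<in>P. openin X V) \<and> x \<in> topspace X \<and>
     \<Inter>(ran s) = \<Union>P \<union> {x} \<and> x \<notin> \<Union>P \<and>
     local_basis_at X x {U - \<Union>F | U F. U \<in> ran s \<and> finite F \<and> F \<subseteq> P}"

text \<open>The legal moves of Alice after the moves \<open>s\<close> of Bob, i.e. in inning \<open>seq_length s\<close>.\<close>

definition legal_move :: "'a topology \<Rightarrow> 'a bob_seq \<Rightarrow> 'a alice_move \<Rightarrow> bool" where
  "legal_move X s m \<longleftrightarrow> (case m of
     Partition P \<Rightarrow>
       (s = Map.empty \<and> open_partition_on X (topspace X) P) \<or>
       (\<exists>\<beta>. succ_inning_of (seq_length s) \<beta> \<and> open_partition_on X (the (s \<beta>)) P)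
   | Partition_Point P x \<Rightarrow>
       limit_inning (seq_length s) \<and> legal_limit_move X s P x)"

text \<open>
  The positions after Bob's moves against \<open>\<sigma>\<close>. Values of \<open>\<sigma>\<close> outside this set are irrelevant.
\<close>

definition strategy_dom :: "'a topology \<Rightarrow> ('a bob_seq \<Rightarrow> 'a alice_move) \<Rightarrow> 'a bob_seq set" where
  "strategy_dom X \<sigma> = {s. \<exists>\<alpha>. dom s = {..<\<alpha>} \<and>
     (\<forall>\<beta><\<alpha>. legal_move X (s |` {..<\<beta>}) (\<sigma> (s |` {..<\<beta>})) \<and>
            the (s \<beta>) \<in> parts (\<sigma> (s |` {..<\<beta>})))}"

definition alice_strategy :: "'a topology \<Rightarrow> ('a bob_seq \<Rightarrow> 'a alice_move) \<Rightarrow> bool" where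
  "alice_strategy X \<sigma> \<longleftrightarrow>
     (\<forall>s\<in>strategy_dom X \<sigma>. (\<exists>m. legal_move X s m) \<longrightarrow> legal_move X s (\<sigma> s))"

definition bob_wins_at :: "'a topology \<Rightarrow> 'a bob_seq \<Rightarrow> bool" where
  "bob_wins_at X s \<longleftrightarrow> limit_inning (seq_length s) \<and> \<not> (\<exists>m. legal_move X s m)"

definition alice_wins_at ::
  "'a topology \<Rightarrow> ('a bob_seq \<Rightarrow> 'a alice_move) \<Rightarrow> 'a bob_seq \<Rightarrow> bool" where
  "alice_wins_at X \<sigma> s \<longleftrightarrow>
     limit_inning (seq_length s) \<and> legal_move X s (\<sigma> s) \<and> parts (\<sigma> s) = {}"

definition winning_strategy :: "'a topology \<Rightarrow> ('a bob_seq \<Rightarrow> 'a alice_move) \<Rightarrow> bool" where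
  "winning_strategy X \<sigma> \<longleftrightarrow> alice_strategy X \<sigma> \<and>
     (\<forall>s\<in>strategy_dom X \<sigma>. bob_wins_at X s \<or> alice_wins_at X \<sigma> s \<longrightarrow> alice_wins_at X \<sigma> s)"

definition succ_dom :: "'a topology \<Rightarrow> ('a bob_seq \<Rightarrow> 'a alice_move) \<Rightarrow> 'a bob_seq set" where
  "succ_dom X \<sigma> = insert Map.empty
     {s \<in> strategy_dom X \<sigma>. \<exists>\<beta>. succ_inning_of (seq_length s) \<beta>}"

lemma seq_length_eq:
  assumes "dom s = {..<\<alpha>}"
  shows "seq_length s = \<alpha>"
  unfolding seq_length_def
proof (rule Least_equality)
  show "s \<alpha> = None" using assms by blast
  show "\<alpha> \<le> \<gamma>" if "s \<gamma> = None" for \<gamma>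
    using that assms by (metis domIff lessThan_iff not_less)
qed

lemma seq_extensions_comparable:
  fixes s s' t :: "'a bob_seq"
  assumes "dom s = {..<\<alpha>}" "dom s' = {..<\<beta>}" "s \<subseteq>\<^sub>m t" "s' \<subseteq>\<^sub>m t"
  shows "s \<subseteq>\<^sub>m s' \<longleftrightarrow> \<alpha> \<le> \<beta>"
proof
  assume "s \<subseteq>\<^sub>m s'"
  hence "{..<\<alpha>} \<subseteq> {..<\<beta>}" using assms by (metis map_le_implies_dom_le)
  thus "\<alpha> \<le> \<beta>" by (simp add: lessThan_subset_iff)
next
  assume "\<alpha> \<le> \<beta>"
  hence "dom s \<subseteq> dom s'" using assms by auto
  thus "s \<subseteq>\<^sub>m s'" using assms(3,4) by (simp add: map_le_def subset_iff)
qed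

lemma succ_dom_is_tree: "is_tree (succ_dom X \<sigma>) (\<subseteq>\<^sub>m)"
proof -
  let ?T = "succ_dom X \<sigma>"
  have dom_seq: "\<exists>\<alpha>. dom s = {..<\<alpha>}" if "s \<in> ?T" for s
  proof (cases "s = Map.empty")
    case True
    have "{..<(LEAST \<alpha> :: 'a inning. True)} = {}"
      by (auto dest: not_less_Least)
    with True show ?thesis by (metis dom_empty)
  next
    case False
    with that show ?thesis by (auto simp: succ_dom_def strategy_dom_def)
  qed
  have len: "dom s = {..<seq_length s}" if "s \<in> ?T" for s
    using dom_seq[OF that] seq_length_eq by metis
  have po: "refl_on S (order_on S (\<subseteq>\<^sub>m))" "trans (order_on S (\<subseteq>\<^sub>m))"
    "antisym (order_on S (\<subseteq>\<^sub>m))" "order_on S (\<subseteq>\<^sub>m) \<subseteq> S \<times> S" for S :: "'a bob_seq set"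
    by (auto simp: refl_on_def trans_def antisym_def order_on_def
        intro: map_le_refl map_le_trans map_le_antisym)
  have wo: "well_order_on {s \<in> ?T. s \<subseteq>\<^sub>m t} (order_on {s \<in> ?T. s \<subseteq>\<^sub>m t} (\<subseteq>\<^sub>m))" (is "well_order_on ?S ?r")
    for t
  proof -
    have cmp: "s \<subseteq>\<^sub>m s' \<longleftrightarrow> seq_length s \<le> seq_length s'" if "s \<in> ?S" "s' \<in> ?S" for s s'
      using that seq_extensions_comparable[OF len len] by blast
    have "total_on ?S ?r"
      unfolding total_on_def order_on_def using cmp by auto
    moreover have "wf (?r - Id)"
    proof (rule wf_subset[OF wf_inv_image[OF wf, of seq_length]])
      show "?r - Id \<subseteq> inv_image {(\<alpha>, \<beta>). \<alpha> < \<beta>} seq_length"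
      proof
        fix p assume "p \<in> ?r - Id"
        then obtain s s' where p: "p = (s, s')" "s \<in> ?S" "s' \<in> ?S" "s \<subseteq>\<^sub>m s'" "s \<noteq> s'"
          by (auto simp: order_on_def)
        have "\<not> s' \<subseteq>\<^sub>m s" using p map_le_antisym by blast
        thus "p \<in> inv_image {(\<alpha>, \<beta>). \<alpha> < \<beta>} seq_length"
          using p cmp[of s' s] by auto
      qed
    qed
    ultimately show ?thesis
      using po[of ?S] by (simp add: well_order_on_def linear_order_on_def partial_order_on_def preorder_on_def)
  qed
  have "Map.empty \<in> ?T" "\<forall>t\<in>?T. Map.empty \<subseteq>\<^sub>m t"
    by (auto simp: succ_dom_def)
  hence "\<exists>r\<in>?T. \<forall>t\<in>?T. r \<subseteq>\<^sub>m t" by blast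
  with wo po[of ?T] show ?thesis
    unfolding is_tree_def partial_order_on_def preorder_on_def by blast
qed

end

(*
Both conditions are equivalent to X carrying an omega-sequence of families of disjoint open sets,
each refining the previous one, in which every set is either the union of its subpieces or the
union of its subpieces and one point x that has the sets "piece minus finitely many subpieces" as
a local basis, and in which every infinite descending branch shrinks to a point.

From a graph: fix a vertex r in a connected set C with a finite cut. The sets with a finite cut
that avoid r are absorbed by disjoint ones: for each n, maximal families of disjoint sets with
cuts of size at most n exist by Zorn's lemma, and by uncrossing (sub- and posimodularity of the
cut size) they cover every such set by finitely many members. So C without the edge-equivalence
class of r splits into connected pieces that converge to this class. Taking r closest to a fixed
root of the component makes nested pieces have no common vertex, hence a single common end.

To a graph: take the tree of pieces and blow up each node with a limit point to an infinite
complete graph.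

To a strategy: Alice plays the subpieces at once if they partition the piece; otherwise she
waits with trivial partitions until the next limit inning and plays the subpieces and x there.
From a strategy: by (a) and (b) the moves before a limit inning that is not the last one are
eventually trivial, so that inning can be moved to the start of its constant stretch.
*)

theory Submission
  imports Defs
begin

section \<open>Cut sizes: submodularity and splitting into connected sets\<close>

section \<open>Finite edge cuts\<close>

text \<open>The delicate point on the graph side is the bound on cut sizes: along a chain of growing
  sets a bounded cut size survives in the union, while finiteness alone does not, so Zorn's lemma is
  used for one n at a time. Uncrossing a set B with a member D replaces B by
  \<open>B \<union> D\<close> or \<open>B - D\<close>; that one of them has no larger cut than B is
  guaranteed by admitting only members not covered by finitely many sets of smaller cut. Members
  grow with n, so the final disjoint sets are the differences of successive stages. On the game
  side, \<omega>\<cdot>\<omega> is the order type of pairs (level of the current piece, number of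
  innings it has been kept): a piece is kept until the next limit inning at the latest. In the other
  direction each node has to jump over its constant stretch to the partition played after it;
  otherwise an infinite branch of nodes could stop at a limit inning that the run survives, and its
  intersection would not be a single point.\<close>

definition edge_cut :: "'v set set \<Rightarrow> 'v set \<Rightarrow> 'v set set" where
  "edge_cut E S = {e \<in> E. e \<inter> S \<noteq> {} \<and> \<not> e \<subseteq> S}"

text \<open>Connectedness is expressed by bipartitions instead of paths: every \<open>B\<close> that
  splits \<open>S\<close> is crossed by an edge inside \<open>S\<close>. This form passes directly
  to unions of chains, and testing it with the side of a cut yields a cut edge inside
  \<open>S\<close>.\<close>

definition connected_in :: "'v set set \<Rightarrow> 'v set \<Rightarrow> bool" where
  "connected_in E S \<longleftrightarrow>
     (\<forall>B. S \<inter> B \<noteq> {} \<and> S - B \<noteq> {} \<longrightarrow> (\<exists>e\<in>E. e \<subseteq> S \<and> e \<inter> B \<noteq> {} \<and> \<not> e \<subseteq> B))"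

lemma connected_inD:
  "connected_in E S \<Longrightarrow> x \<in> S \<Longrightarrow> x \<in> B \<Longrightarrow> y \<in> S \<Longrightarrow> y \<notin> B \<Longrightarrow>
     \<exists>e\<in>E. e \<subseteq> S \<and> e \<inter> B \<noteq> {} \<and> \<not> e \<subseteq> B"
  unfolding connected_in_def by blast

lemma edge_cut_subset: "edge_cut E S \<subseteq> E"
  by (auto simp: edge_cut_def)

lemma edge_cut_empty [simp]: "edge_cut E {} = {}"
  by (auto simp: edge_cut_def)

lemma finite_edge_cut_Un:
  "finite (edge_cut E A) \<Longrightarrow> finite (edge_cut E B) \<Longrightarrow> finite (edge_cut E (A \<union> B))"
  by (rule finite_subset[of _ "edge_cut E A \<union> edge_cut E B"]) (auto simp: edge_cut_def)

lemma finite_edge_cut_Int: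
  "finite (edge_cut E A) \<Longrightarrow> finite (edge_cut E B) \<Longrightarrow> finite (edge_cut E (A \<inter> B))"
  by (rule finite_subset[of _ "edge_cut E A \<union> edge_cut E B"]) (auto simp: edge_cut_def)

lemma finite_edge_cut_Diff:
  "finite (edge_cut E A) \<Longrightarrow> finite (edge_cut E B) \<Longrightarrow> finite (edge_cut E (A - B))"
  by (rule finite_subset[of _ "edge_cut E A \<union> edge_cut E B"]) (auto simp: edge_cut_def)

lemma finite_edge_cut_Union:
  "finite \<A> \<Longrightarrow> (\<And>A. A \<in> \<A> \<Longrightarrow> finite (edge_cut E A)) \<Longrightarrow> finite (edge_cut E (\<Union>\<A>))"
  by (induction \<A> rule: finite_induct) (auto intro: finite_edge_cut_Un)

text \<open>Every edge counts on the left at most as often as on the right: an edge in both cuts on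
  the left meets \<open>A \<inter> B\<close> and leaves \<open>A \<union> B\<close>, so it is cut by
  \<open>A\<close> and by \<open>B\<close>.\<close>

lemma card_edge_cut_submodular:
  assumes "finite (edge_cut E A)" "finite (edge_cut E B)"
  shows "card (edge_cut E (A \<union> B)) + card (edge_cut E (A \<inter> B))
    \<le> card (edge_cut E A) + card (edge_cut E B)"
proof -
  have "card (edge_cut E (A \<union> B)) + card (edge_cut E (A \<inter> B))
      = card (edge_cut E (A \<union> B) \<union> edge_cut E (A \<inter> B)) + card (edge_cut E (A \<union> B) \<inter> edge_cut E (A \<inter> B))"
    using assms by (intro card_Un_Int finite_edge_cut_Un finite_edge_cut_Int)
  also have "\<dots> \<le> card (edge_cut E A \<union> edge_cut E B) + card (edge_cut E A \<inter> edge_cut E B)"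
    using assms by (intro add_mono card_mono) (auto simp: edge_cut_def)
  also have "\<dots> = card (edge_cut E A) + card (edge_cut E B)"
    using assms by (intro card_Un_Int[symmetric])
  finally show ?thesis .
qed

text \<open>This is submodularity for \<open>A\<close> and the complement of \<open>B\<close>, since
  complementary sets have the same cut.\<close>

lemma card_edge_cut_posimodular:
  assumes "finite (edge_cut E A)" "finite (edge_cut E B)"
  shows "card (edge_cut E (A - B)) + card (edge_cut E (B - A))
    \<le> card (edge_cut E A) + card (edge_cut E B)"
proof -
  have "card (edge_cut E (A - B)) + card (edge_cut E (B - A))
      = card (edge_cut E (A - B) \<union> edge_cut E (B - A)) + card (edge_cut E (A - B) \<inter> edge_cut E (B - A))"
    using assms by (intro card_Un_Int finite_edge_cut_Diff)
  also have "\<dots> \<le> card (edge_cut E A \<union> edge_cut E B) + card (edge_cut E A \<inter> edge_cut E B)"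
    using assms by (intro add_mono card_mono) (auto simp: edge_cut_def)
  also have "\<dots> = card (edge_cut E A) + card (edge_cut E B)"
    using assms by (intro card_Un_Int[symmetric])
  finally show ?thesis .
qed

text \<open>This lets a bound on cut sizes pass to the union of a chain: only finite sets of cut
  edges have to be inspected.\<close>

lemma finite_card_le_if_finite_subsets:
  assumes "\<And>Z. finite Z \<Longrightarrow> Z \<subseteq> S \<Longrightarrow> card Z \<le> n"
  shows "finite S \<and> card S \<le> n"
  using assms infinite_arbitrarily_large[of S "Suc n"] by fastforce

locale connected_graph =
  fixes E :: "'v set set" and K :: "'v set"
  assumes card_edge: "e \<in> E \<Longrightarrow> card e = 2"
    and connected_K: "connected_in E K"
begin

abbreviation cut_size :: "'v set \<Rightarrow> nat" where
  "cut_size S \<equiv> card (edge_cut E S)"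

lemma edge_cut_nonempty: "S \<subseteq> K \<Longrightarrow> S \<noteq> {} \<Longrightarrow> S \<noteq> K \<Longrightarrow> edge_cut E S \<noteq> {}"
proof -
  assume S: "S \<subseteq> K" "S \<noteq> {}" "S \<noteq> K"
  then obtain x y where "x \<in> S" "y \<in> K" "y \<notin> S" by auto
  thus ?thesis using S(1) connected_inD[OF connected_K, of x S y] unfolding edge_cut_def by auto
qed

text \<open>With no edge between the two parts of \<open>S\<close>, their cuts are disjoint subsets
  of the cut of \<open>S\<close>. Both are nonempty because \<open>K\<close> is connected, so each
  is a proper subset.\<close>

lemma disconnected_cut_sizes:
  assumes S: "S \<subseteq> K" "S \<noteq> K" "finite (edge_cut E S)" and nc: "\<not> connected_in E S"
  shows "\<exists>A B. A \<union> B = S \<and> A \<inter> B = {} \<and> A \<noteq> {} \<and> B \<noteq> {} \<and>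
    edge_cut E A \<subset> edge_cut E S \<and> edge_cut E B \<subset> edge_cut E S"
proof -
  obtain B where B: "S \<inter> B \<noteq> {}" "S - B \<noteq> {}"
    and no: "\<And>e. e \<in> E \<Longrightarrow> e \<subseteq> S \<Longrightarrow> e \<inter> B \<noteq> {} \<Longrightarrow> e \<subseteq> B"
    using nc unfolding connected_in_def by meson
  have sub: "edge_cut E (S \<inter> B) \<subseteq> edge_cut E S" "edge_cut E (S - B) \<subseteq> edge_cut E S"
    unfolding edge_cut_def using no by blast+
  \<comment> \<open>An edge in both cuts would have one end in each part, hence lie inside
    \<open>S\<close> and be split by \<open>B\<close>, which \<open>no\<close> forbids.\<close>
  have disj: "edge_cut E (S \<inter> B) \<inter> edge_cut E (S - B) = {}"
  proof (rule ccontr)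
    assume "\<not> ?thesis"
    then obtain e where e: "e \<in> E" "e \<inter> (S \<inter> B) \<noteq> {}" "e \<inter> (S - B) \<noteq> {}"
      unfolding edge_cut_def by blast
    then obtain x y where xy: "x \<in> e" "x \<in> S \<inter> B" "y \<in> e" "y \<in> S - B" by blast
    have "e = {x, y}"
      using card_edge[OF e(1)] xy by (auto simp: card_2_iff)
    thus False using no[OF e(1)] xy by blast
  qed
  have ne: "edge_cut E (S \<inter> B) \<noteq> {}" "edge_cut E (S - B) \<noteq> {}"
    using S B by (intro edge_cut_nonempty; blast)+
  show ?thesis
    by (rule exI[of _ "S \<inter> B"], rule exI[of _ "S - B"]) (use sub disj ne B in blast)
qed

text \<open>Splitting a disconnected set strictly lowers the cut size of both parts, so the
  splitting stops after finitely many steps.\<close>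

lemma finite_connected_decomposition:
  assumes "S \<subseteq> K" "S \<noteq> K" "finite (edge_cut E S)"
  shows "\<exists>\<Q>. finite \<Q> \<and> disjoint \<Q> \<and> \<Union>\<Q> = S \<and>
    (\<forall>Q\<in>\<Q>. Q \<noteq> {} \<and> connected_in E Q \<and> finite (edge_cut E Q))"
  using assms
proof (induction "cut_size S" arbitrary: S rule: less_induct)
  case less
  show ?case
  proof (cases "connected_in E S")
    case True
    then show ?thesis
      by (intro exI[of _ "{S} - {{}}"]) (use less.prems in \<open>auto simp: pairwise_def disjnt_def\<close>)
  next
    case False
    then obtain A B where AB: "A \<union> B = S" "A \<inter> B = {}" "A \<noteq> {}" "B \<noteq> {}"
      "edge_cut E A \<subset> edge_cut E S" "edge_cut E B \<subset> edge_cut E S"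
      using disconnected_cut_sizes less.prems by meson
    have lt: "cut_size A < cut_size S" "cut_size B < cut_size S"
      using AB less.prems by (auto intro: psubset_card_mono)
    have p: "A \<subseteq> K" "A \<noteq> K" "B \<subseteq> K" "B \<noteq> K" "finite (edge_cut E A)" "finite (edge_cut E B)"
      using AB less.prems finite_subset by blast+
    obtain \<Q>1 where 1: "finite \<Q>1" "disjoint \<Q>1" "\<Union>\<Q>1 = A"
      "\<forall>Q\<in>\<Q>1. Q \<noteq> {} \<and> connected_in E Q \<and> finite (edge_cut E Q)"
      using less.hyps[OF lt(1) p(1,2,5)] by blast
    obtain \<Q>2 where 2: "finite \<Q>2" "disjoint \<Q>2" "\<Union>\<Q>2 = B"
      "\<forall>Q\<in>\<Q>2. Q \<noteq> {} \<and> connected_in E Q \<and> finite (edge_cut E Q)"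
      using less.hyps[OF lt(2) p(3,4,6)] by blast
    have "disjoint (\<Q>1 \<union> \<Q>2)"
      using 1 2 AB by (intro disjoint_union) auto
    moreover have "\<Union>(\<Q>1 \<union> \<Q>2) = S" using 1 2 AB by auto
    ultimately show ?thesis using 1 2 by (intro exI[of _ "\<Q>1 \<union> \<Q>2"]) blast
  qed
qed

end

section \<open>Uncrossing: disjoint families that absorb all sets with a finite cut avoiding a
  root\<close>

locale rooted_connected_graph = connected_graph E K for E :: "'v set set" and K +
  fixes r :: 'v
  assumes root: "r \<in> K"
begin

definition side :: "'v set \<Rightarrow> bool" where
  "side S \<longleftrightarrow> S \<subseteq> K \<and> r \<notin> S \<and> finite (edge_cut E S)"

text \<open>
  Equivalently, some ultrafilter of sides contains \<open>D\<close> but no side with a smaller cut; in this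
  form the property passes to unions of chains.
\<close>

definition cored :: "'v set \<Rightarrow> bool" where
  "cored D \<longleftrightarrow> \<not> (\<exists>\<E>. finite \<E> \<and> (\<forall>A\<in>\<E>. side A \<and> cut_size A < cut_size D) \<and> D \<subseteq> \<Union>\<E>)"

text \<open>A family of disjoint sides is encoded as the partial equivalence relation with these classes.\<close>

definition side_rel :: "nat \<Rightarrow> 'v rel \<Rightarrow> bool" where
  "side_rel N R \<longleftrightarrow> sym R \<and> trans R \<and> (\<forall>x. R `` {x} \<noteq> {} \<longrightarrow>
     side (R `` {x}) \<and> connected_in E (R `` {x}) \<and> cut_size (R `` {x}) \<le> N \<and> cored (R `` {x}))"

definition fin_covered :: "'v rel \<Rightarrow> 'v set \<Rightarrow> bool" where
  "fin_covered R B \<longleftrightarrow> (\<exists>X. finite X \<and> B \<subseteq> R `` X)"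

lemma fin_covered_Union:
  assumes "finite \<E>" "\<And>A. A \<in> \<E> \<Longrightarrow> fin_covered R A" "B \<subseteq> \<Union>\<E>"
  shows "fin_covered R B"
proof -
  obtain X where X: "\<And>A. A \<in> \<E> \<Longrightarrow> finite (X A) \<and> A \<subseteq> R `` X A"
    using assms(2) unfolding fin_covered_def by (metis (no_types))
  have "B \<subseteq> R `` (\<Union>A\<in>\<E>. X A)" using X assms(3) by fast
  thus ?thesis using X assms(1) unfolding fin_covered_def by blast
qed

lemma fin_covered_Un: "fin_covered R A \<Longrightarrow> fin_covered R B \<Longrightarrow> fin_covered R (A \<union> B)"
  using fin_covered_Union[of "{A, B}" R] by auto

lemma fin_covered_subset: "fin_covered R A \<Longrightarrow> B \<subseteq> A \<Longrightarrow> fin_covered R B"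
  unfolding fin_covered_def by blast

lemma side_rel_mono: "side_rel M R \<Longrightarrow> M \<le> N \<Longrightarrow> side_rel N R"
  unfolding side_rel_def using le_trans by blast

lemma side_rel_class_eq: "side_rel N R \<Longrightarrow> y \<in> R `` {x} \<Longrightarrow> R `` {y} = R `` {x}"
  unfolding side_rel_def sym_def trans_def by blast

text \<open>The class of a point in the union is the increasing union of its classes along the
  chain. Every finite set of its vertices or of its cut edges is already seen at one stage, so the
  bound \<open>N\<close> on the cut size survives. As the cut of the limit is then finite, it lies
  in the cut of a single stage, and a cover of the limit by sides of smaller cut would cover that
  stage too.\<close>

lemma side_rel_Union_chain:
  assumes ne: "\<C> \<noteq> {}" and chain: "subset.chain {R. side_rel N R} \<C>"
  shows "side_rel N (\<Union>\<C>)"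
proof -
  have lr: "side_rel N R" if "R \<in> \<C>" for R
    using chain that unfolding subset.chain_def by blast
  have cmp: "R \<subseteq> R' \<or> R' \<subseteq> R" if "R \<in> \<C>" "R' \<in> \<C>" for R R'
    using chain that unfolding subset.chain_def by blast
  have "sym (\<Union>\<C>)"
    using lr unfolding side_rel_def sym_def by blast
  moreover have "trans (\<Union>\<C>)"
  proof (rule transI)
    fix x y z assume "(x, y) \<in> \<Union>\<C>" "(y, z) \<in> \<Union>\<C>"
    then obtain R R' where R: "R \<in> \<C>" "R' \<in> \<C>" "(x, y) \<in> R" "(y, z) \<in> R'" by blast
    have tr: "trans R" "trans R'" using lr R unfolding side_rel_def by blast+
    show "(x, z) \<in> \<Union>\<C>"
      using cmp[OF R(1,2)] R tr unfolding trans_def by blast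
  qed
  moreover have "side D \<and> connected_in E D \<and> cut_size D \<le> N \<and> cored D"
    if D_def: "D = (\<Union>\<C>) `` {x}" and Dne: "D \<noteq> {}" for x D
  proof -
    have good: "side (R `` {x}) \<and> connected_in E (R `` {x}) \<and> cut_size (R `` {x}) \<le> N \<and> cored (R `` {x})"
      if "R \<in> \<C>" "R `` {x} \<noteq> {}" for R
      using lr[OF that(1)] that(2) unfolding side_rel_def by blast
    have D: "D = (\<Union>R\<in>\<C>. R `` {x})" unfolding D_def by blast
    have dir: "\<exists>R\<in>\<C>. Y \<subseteq> R `` {x}" if "finite Y" "Y \<subseteq> D" for Y
      using that
    proof (induction Y rule: finite_induct)
      case empty
      then show ?case using ne by auto
    next
      case (insert y Y)
      then obtain R R' where "R \<in> \<C>" "Y \<subseteq> R `` {x}" "R' \<in> \<C>" "y \<in> R' `` {x}"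
        unfolding D by auto
      then show ?case using cmp[of R R'] by blast
    qed
    have big: "\<exists>R\<in>\<C>. R `` {x} \<noteq> {} \<and> Z \<subseteq> edge_cut E (R `` {x})"
      if Z: "finite Z" "Z \<subseteq> edge_cut E D" for Z
    proof -
      have "\<forall>e\<in>Z. \<exists>y. y \<in> e \<inter> D" using Z unfolding edge_cut_def by blast
      then obtain f where f: "\<forall>e\<in>Z. f e \<in> e \<inter> D" by metis
      obtain y where y: "y \<in> D" using Dne by blast
      obtain R where R: "R \<in> \<C>" "insert y (f ` Z) \<subseteq> R `` {x}"
        using dir[of "insert y (f ` Z)"] Z f y by blast
      have "R `` {x} \<subseteq> D" using R D by blast
      hence "Z \<subseteq> edge_cut E (R `` {x})"
        using Z f R unfolding edge_cut_def by blast
      thus ?thesis using R by blast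
    qed
    have fin: "finite (edge_cut E D) \<and> cut_size D \<le> N"
    proof (rule finite_card_le_if_finite_subsets)
      fix Z assume Z: "finite Z" "Z \<subseteq> edge_cut E D"
      obtain R where R: "R \<in> \<C>" "R `` {x} \<noteq> {}" "Z \<subseteq> edge_cut E (R `` {x})"
        using big[OF Z] by blast
      have "card Z \<le> cut_size (R `` {x})"
        using good[OF R(1,2)] R(3) by (intro card_mono) (auto simp: side_def)
      thus "card Z \<le> N" using good[OF R(1,2)] by simp
    qed
    have "D \<subseteq> K" "r \<notin> D" using good unfolding D side_def by blast+
    moreover have "connected_in E D"
      unfolding connected_in_def
    proof (intro allI impI)
      fix B assume "D \<inter> B \<noteq> {} \<and> D - B \<noteq> {}"
      then obtain y z where yz: "y \<in> D \<inter> B" "z \<in> D - B" by blast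
      then obtain R where R: "R \<in> \<C>" "{y, z} \<subseteq> R `` {x}" using dir[of "{y, z}"] by auto
      hence "connected_in E (R `` {x})" using good by blast
      moreover have "R `` {x} \<subseteq> D" using R D by blast
      ultimately show "\<exists>e\<in>E. e \<subseteq> D \<and> e \<inter> B \<noteq> {} \<and> \<not> e \<subseteq> B"
        using connected_inD[of E "R `` {x}" y B z] R yz by blast
    qed
    moreover have "cored D"
      unfolding cored_def
    proof
      assume "\<exists>\<E>. finite \<E> \<and> (\<forall>A\<in>\<E>. side A \<and> cut_size A < cut_size D) \<and> D \<subseteq> \<Union>\<E>"
      then obtain \<E> where \<E>: "finite \<E>" "\<forall>A\<in>\<E>. side A \<and> cut_size A < cut_size D" "D \<subseteq> \<Union>\<E>" by blast
      \<comment> \<open>The whole cut of \<open>D\<close> is finite, so \<open>big\<close> applies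
        to all of it. The stage found has a cut at least as large as that of \<open>D\<close>, which
        makes the sides in \<open>\<E>\<close> smaller than this stage as well.\<close>
      obtain R where R: "R \<in> \<C>" "R `` {x} \<noteq> {}" "edge_cut E D \<subseteq> edge_cut E (R `` {x})"
        using big[of "edge_cut E D"] fin by blast
      have "cut_size D \<le> cut_size (R `` {x})"
        using good[OF R(1,2)] R(3) by (intro card_mono) (auto simp: side_def)
      moreover have "R `` {x} \<subseteq> \<Union>\<E>" using R D \<E>(3) by blast
      ultimately show False
        using good[OF R(1,2)] \<E>(1,2) unfolding cored_def by (meson less_le_trans)
    qed
    ultimately show ?thesis using fin by (simp add: side_def)
  qed
  ultimately show ?thesis unfolding side_rel_def by blast
qed

lemma maximal_side_rel:
  assumes "side_rel N R0"
  shows "\<exists>R. R0 \<subseteq> R \<and> side_rel N R \<and> (\<forall>R'. side_rel N R' \<and> R \<subseteq> R' \<longrightarrow> R' = R)"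
proof -
  have "\<exists>M\<in>{R. side_rel N R \<and> R0 \<subseteq> R}. \<forall>X\<in>{R. side_rel N R \<and> R0 \<subseteq> R}. M \<subseteq> X \<longrightarrow> X = M"
  proof (rule subset_Zorn_nonempty)
    fix \<C> assume \<C>: "\<C> \<noteq> {}" "subset.chain {R. side_rel N R \<and> R0 \<subseteq> R} \<C>"
    have "subset.chain {R. side_rel N R} \<C>"
      using \<C>(2) unfolding subset.chain_def by blast
    hence "side_rel N (\<Union>\<C>)" using side_rel_Union_chain \<C>(1) by blast
    moreover have "\<C> \<subseteq> {R. side_rel N R \<and> R0 \<subseteq> R}"
      using \<C>(2) by (simp add: subset.chain_def)
    ultimately show "\<Union>\<C> \<in> {R. side_rel N R \<and> R0 \<subseteq> R}" using \<C>(1) by auto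
  qed (use assms in blast)
  then obtain M where "M \<in> {R. side_rel N R \<and> R0 \<subseteq> R}"
    and "\<forall>X\<in>{R. side_rel N R \<and> R0 \<subseteq> R}. M \<subseteq> X \<longrightarrow> X = M" by (rule bexE)
  thus ?thesis by (intro exI[of _ M]) auto
qed

text \<open>An extremal counterexample is taken: least cut size \<open>m\<close> among the uncovered
  sides, then fewest crossed classes. Uncrossing shows that it crosses no class; minimality of
  \<open>m\<close> makes it connected and cored. It could then be added to the family as a new
  class, against maximality.\<close>

lemma side_fin_covered:
  assumes R: "side_rel N R" and max: "\<And>R'. side_rel N R' \<Longrightarrow> R \<subseteq> R' \<Longrightarrow> R' = R"
    and S: "side S" "cut_size S \<le> N"
  shows "fin_covered R S"
proof (rule ccontr)
  assume unc: "\<not> fin_covered R S"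
  define unco where "unco B \<longleftrightarrow> side B \<and> \<not> fin_covered R B" for B
  obtain B0 where B0: "unco B0" "\<And>B. unco B \<Longrightarrow> cut_size B0 \<le> cut_size B"
    using ex_has_least_nat[of unco S cut_size] unc S unfolding unco_def by blast
  define m where "m = cut_size B0"
  have m: "m \<le> N" using B0(2)[of S] S unc unfolding unco_def m_def by simp
  have small: "fin_covered R A" if "side A" "cut_size A < m" for A
    using B0(2)[of A] that unfolding unco_def m_def by fastforce
  define cross where "cross B = {D. \<exists>x. D = R `` {x} \<and> D \<inter> B \<noteq> {} \<and> \<not> D \<subseteq> B}" for B
  have cls: "side (R `` {x}) \<and> connected_in E (R `` {x}) \<and> cut_size (R `` {x}) \<le> N \<and> cored (R `` {x})"
    if "R `` {x} \<noteq> {}" for x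
    using R that unfolding side_rel_def by blast
  have class_disj: "R `` {x} = R `` {y}" if "z \<in> R `` {x}" "z \<in> R `` {y}" for x y z
    using side_rel_class_eq[OF R] that by metis
  \<comment> \<open>A crossed class is connected, so it contains an edge of the cut of
    \<open>B\<close>. Distinct classes are disjoint and so yield distinct edges.\<close>
  have fin_cross: "finite (cross B)" if "unco B" for B
  proof -
    have "\<forall>D\<in>cross B. \<exists>e. e \<in> edge_cut E B \<and> e \<subseteq> D"
    proof
      fix D assume "D \<in> cross B"
      then obtain x where D: "D = R `` {x}" "D \<inter> B \<noteq> {}" "\<not> D \<subseteq> B" unfolding cross_def by blast
      hence "connected_in E D" using cls by blast
      thus "\<exists>e. e \<in> edge_cut E B \<and> e \<subseteq> D"
        using D unfolding connected_in_def edge_cut_def by blast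
    qed
    then obtain f where f: "\<And>D. D \<in> cross B \<Longrightarrow> f D \<in> edge_cut E B \<and> f D \<subseteq> D" by metis
    have "inj_on f (cross B)"
    proof (rule inj_onI)
      fix D D' assume DD: "D \<in> cross B" "D' \<in> cross B" "f D = f D'"
      have "f D \<noteq> {}" using f[OF DD(1)] unfolding edge_cut_def by blast
      then obtain z where "z \<in> D" "z \<in> D'" using f[OF DD(1)] f[OF DD(2)] DD(3) by blast
      thus "D = D'" using DD class_disj unfolding cross_def by blast
    qed
    moreover have "f ` cross B \<subseteq> edge_cut E B" using f by blast
    ultimately show ?thesis
      using that finite_subset finite_imageD unfolding unco_def side_def by metis
  qed
  obtain B where B: "unco B \<and> cut_size B = m"
    and Bmin: "\<And>B'. unco B' \<and> cut_size B' = m \<Longrightarrow> card (cross B) \<le> card (cross B')"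
    using ex_has_least_nat[of "\<lambda>B. unco B \<and> cut_size B = m" B0 "\<lambda>B. card (cross B)"] B0(1) m_def by blast
  have sB: "side B" "finite (edge_cut E B)" using B unfolding unco_def side_def by auto
  have no_cross: "cross B = {}"
  proof (rule ccontr)
    assume "cross B \<noteq> {}"
    then obtain x where D: "R `` {x} \<inter> B \<noteq> {}" "\<not> R `` {x} \<subseteq> B" "R `` {x} \<in> cross B" unfolding cross_def by blast
    let ?D = "R `` {x}"
    have cD: "side ?D" "finite (edge_cut E ?D)" "cored ?D"
      using cls D(1) unfolding side_def by auto
    have covD: "fin_covered R ?D" unfolding fin_covered_def by blast
    have sides: "side (B \<union> ?D)" "side (B - ?D)" "side (B \<inter> ?D)" "side (?D - B)"
      using sB cD finite_edge_cut_Un finite_edge_cut_Diff finite_edge_cut_Int unfolding side_def by blast+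
    \<comment> \<open>If both cuts exceeded \<open>m\<close>, sub- and posimodularity would make the
      cuts of \<open>B \<inter> ?D\<close> and \<open>?D - B\<close> smaller than that of
      \<open>?D\<close>; these two sides cover \<open>?D\<close>, which is cored.\<close>
    have "cut_size (B \<union> ?D) \<le> m \<or> cut_size (B - ?D) \<le> m"
    proof (rule ccontr)
      assume "\<not> ?thesis"
      hence "cut_size (B \<inter> ?D) < cut_size ?D" "cut_size (?D - B) < cut_size ?D"
        using card_edge_cut_submodular[OF sB(2) cD(2)] card_edge_cut_posimodular[OF sB(2) cD(2)] B by auto
      hence "finite {B \<inter> ?D, ?D - B} \<and> (\<forall>A\<in>{B \<inter> ?D, ?D - B}. side A \<and> cut_size A < cut_size ?D)
          \<and> ?D \<subseteq> \<Union>{B \<inter> ?D, ?D - B}"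
        using sides by auto
      thus False using cD(3) unfolding cored_def by blast
    qed
    then obtain B' where B': "B' = B \<union> ?D \<or> B' = B - ?D" "cut_size B' \<le> m" by blast
    have "\<not> fin_covered R B'"
    proof
      assume "fin_covered R B'"
      hence "fin_covered R (B' \<union> ?D)" using covD fin_covered_Un by blast
      moreover have "B \<subseteq> B' \<union> ?D" using B'(1) by blast
      ultimately show False using B fin_covered_subset unfolding unco_def by blast
    qed
    hence u: "unco B'" using B'(1) sides unfolding unco_def by blast
    hence "cut_size B' = m" using B0(2)[of B'] B'(2) m_def by simp
    hence le: "card (cross B) \<le> card (cross B')" using Bmin u by blast
    \<comment> \<open>Every other class is disjoint from \<open>?D\<close>, so it crosses
      \<open>B'\<close> only if it crosses \<open>B\<close>; and \<open>?D\<close> itself is now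
      contained in \<open>B'\<close> or disjoint from it.\<close>
    have "cross B' \<subseteq> cross B - {?D}"
    proof
      fix D' assume "D' \<in> cross B'"
      then obtain y where y: "D' = R `` {y}" "D' \<inter> B' \<noteq> {}" "\<not> D' \<subseteq> B'" unfolding cross_def by blast
      have ne: "D' \<noteq> ?D" using y B'(1) by blast
      hence "D' \<inter> ?D = {}" using class_disj y(1) by blast
      thus "D' \<in> cross B - {?D}" using y B'(1) ne unfolding cross_def by blast
    qed
    hence "card (cross B') < card (cross B)"
      using D(3) fin_cross B by (intro psubset_card_mono) auto
    thus False using le by simp
  qed
  have Bne: "B \<noteq> {}" using B unfolding unco_def fin_covered_def by blast
  have BK: "B \<noteq> K" using sB root unfolding side_def by blast
  have conn: "connected_in E B"
  proof (rule ccontr)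
    assume "\<not> ?thesis"
    then obtain A C where AC: "A \<union> C = B" "edge_cut E A \<subset> edge_cut E B" "edge_cut E C \<subset> edge_cut E B"
      using disconnected_cut_sizes[of B] sB BK unfolding side_def by blast
    hence "cut_size A < m" "cut_size C < m" using B sB by (auto intro: psubset_card_mono)
    moreover have "side A" "side C"
      using AC sB finite_subset unfolding side_def by blast+
    ultimately have "fin_covered R (A \<union> C)" using small fin_covered_Un by blast
    thus False using B AC(1) unfolding unco_def by blast
  qed
  have core: "cored B"
    unfolding cored_def
  proof
    assume "\<exists>\<E>. finite \<E> \<and> (\<forall>A\<in>\<E>. side A \<and> cut_size A < cut_size B) \<and> B \<subseteq> \<Union>\<E>"
    hence "fin_covered R B" using fin_covered_Union[of _ R B] small B by blast
    thus False using B unfolding unco_def by blast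
  qed
  have sep: "R `` {x} \<subseteq> B \<or> R `` {x} \<inter> B = {}" for x
    using no_cross unfolding cross_def by blast
  \<comment> \<open>Adding \<open>B \<times> B\<close> merges all classes inside \<open>B\<close>
    into the single class \<open>B\<close>. By \<open>sep\<close> the remaining classes are disjoint
    from \<open>B\<close> and stay as they are.\<close>
  let ?R = "R \<union> B \<times> B"
  have symR: "sym R" and transR: "trans R" using R unfolding side_rel_def by blast+
  have closed: "y \<in> B \<longleftrightarrow> x \<in> B" if "(x, y) \<in> R" for x y
    using sep[of x] sep[of y] that symR transR unfolding sym_def trans_def by blast
  have "side_rel N ?R"
    unfolding side_rel_def
  proof (intro conjI allI impI)
    show "sym ?R" using symR unfolding sym_def by blast
    show "trans ?R"
    proof (rule transI)
      fix x y z assume xy: "(x, y) \<in> ?R" "(y, z) \<in> ?R"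
      hence "y \<in> B \<longleftrightarrow> x \<in> B" "z \<in> B \<longleftrightarrow> y \<in> B" using closed by blast+
      thus "(x, z) \<in> ?R" using xy transD[OF transR, of x y z] by blast
    qed
    fix x assume ne: "?R `` {x} \<noteq> {}"
    have "?R `` {x} = (if x \<in> B then B else R `` {x})"
      using closed by auto
    hence "side (?R `` {x}) \<and> connected_in E (?R `` {x}) \<and> cut_size (?R `` {x}) \<le> N \<and> cored (?R `` {x})"
      using cls[of x] ne sB(1) conn core B m by auto
    thus "side (?R `` {x})" "connected_in E (?R `` {x})" "cut_size (?R `` {x}) \<le> N" "cored (?R `` {x})"
      by auto
  qed
  hence "?R = R" by (rule max) blast
  hence "B \<subseteq> R `` {x}" if "x \<in> B" for x using that by blast
  hence "fin_covered R B" using Bne unfolding fin_covered_def by blast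
  thus False using B unfolding unco_def by blast
qed

text \<open>Each maximal family is obtained by enlarging the previous one, so that the classes of a
  point only grow with \<open>N\<close>.\<close>

lemma side_rel_sequence:
  "\<exists>R. mono R \<and> (\<forall>N. side_rel N (R N) \<and>
     (\<forall>S. side S \<and> cut_size S \<le> N \<longrightarrow> fin_covered (R N) S))"
proof -
  let ?P = "\<lambda>N R. side_rel N R \<and> (\<forall>R'. side_rel N R' \<and> R \<subseteq> R' \<longrightarrow> R' = R)"
  obtain R where R: "\<And>N. ?P N (R N)" "\<And>N. R N \<subseteq> R (Suc N)"
  proof (rule exE[OF dependent_nat_choice[of ?P "\<lambda>_ R R'. R \<subseteq> R'"]])
    have "side_rel 0 {}" unfolding side_rel_def by (simp add: sym_def)
    thus "\<exists>R. ?P 0 R" using maximal_side_rel by blast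
    fix R N assume "?P N R"
    hence "side_rel (Suc N) R" using side_rel_mono by (metis le_SucI order_refl)
    thus "\<exists>R'. ?P (Suc N) R' \<and> R \<subseteq> R'" using maximal_side_rel by blast
  qed (rule that, blast+)
  have "mono R" using R(2) by (simp add: mono_iff_le_Suc)
  moreover have "\<forall>S. side S \<and> cut_size S \<le> N \<longrightarrow> fin_covered (R N) S" for N
    using side_fin_covered[of N "R N"] R(1)[of N] by blast
  ultimately show ?thesis using R(1) by blast
qed

text \<open>The classes of the different stages overlap, since a class of one stage is part of a
  class of the next. Seen from a fixed point, a class of the union \<open>Q\<close> is an increasing
  sequence of sides. The differences of its successive terms are disjoint sides, and the differences
  up to stage k add up to the term of stage k, so that a finite cover by classes becomes a finite
  cover by differences.\<close>

lemma paracompact_sides: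
  "\<exists>\<P>. disjoint \<P> \<and> (\<forall>P\<in>\<P>. side P) \<and> (\<forall>S. side S \<longrightarrow> (\<exists>\<F>\<subseteq>\<P>. finite \<F> \<and> S \<subseteq> \<Union>\<F>))"
proof -
  obtain R :: "nat \<Rightarrow> 'v rel" where mono: "mono R" and R: "\<And>N. side_rel N (R N)"
    and cov: "\<And>N S. side S \<Longrightarrow> cut_size S \<le> N \<Longrightarrow> fin_covered (R N) S"
    using side_rel_sequence by blast
  have cls: "side (R k `` {x})" for k x
    using R[of k] by (cases "R k `` {x} = {}") (auto simp: side_rel_def side_def)
  have step: "R i `` {x} \<subseteq> R j `` {x}" if "i \<le> j" for i j x
    using monoD[OF mono that] by blast
  define Q where "Q = (\<Union>k. R k)"
  have symQ: "sym Q" using R unfolding Q_def side_rel_def sym_def by blast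
  have transQ: "trans Q"
  proof (rule transI)
    fix x y z assume "(x, y) \<in> Q" "(y, z) \<in> Q"
    then obtain i j where "(x, y) \<in> R i" "(y, z) \<in> R j" unfolding Q_def by blast
    moreover have "R i \<subseteq> R (max i j)" "R j \<subseteq> R (max i j)" using monoD[OF mono] by simp_all
    moreover have "trans (R (max i j))" using R unfolding side_rel_def by blast
    ultimately show "(x, z) \<in> Q" unfolding Q_def trans_def by blast
  qed
  \<comment> \<open>All points of one class of \<open>Q\<close> must produce the same rings, hence
    one representative for the whole class.\<close>
  define rep where "rep y = (SOME x. (x, y) \<in> Q)" for y
  have rep: "(rep y, y) \<in> Q" if "(x, y) \<in> Q" for x y
    unfolding rep_def using that by (rule someI)
  have rep_eq: "rep y = rep z" if "(y, z) \<in> Q" for y z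
  proof -
    have "(\<lambda>x. (x, y) \<in> Q) = (\<lambda>x. (x, z) \<in> Q)"
      using that symQ transQ unfolding sym_def trans_def by blast
    thus ?thesis unfolding rep_def by simp
  qed
  define ring where "ring x k = R k `` {x} - (\<Union>j<k. R j `` {x})" for x k
  have side_ring: "side (ring x k)" for x k
  proof -
    have "finite (edge_cut E (\<Union>((\<lambda>j. R j `` {x}) ` {..<k})))"
      using cls by (intro finite_edge_cut_Union) (auto simp: side_def)
    thus ?thesis using cls[of k x] finite_edge_cut_Diff unfolding ring_def side_def by blast
  qed
  have rings: "R k `` {x} = (\<Union>j\<le>k. ring x j)" for x k
  proof
    show "(\<Union>j\<le>k. ring x j) \<subseteq> R k `` {x}" using step unfolding ring_def by fastforce
    show "R k `` {x} \<subseteq> (\<Union>j\<le>k. ring x j)"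
    proof
      fix y assume y: "y \<in> R k `` {x}"
      define j where "j = (LEAST j. y \<in> R j `` {x})"
      have "y \<in> R j `` {x}" "j \<le> k" "\<And>i. i < j \<Longrightarrow> y \<notin> R i `` {x}"
        unfolding j_def using y by (auto intro: LeastI Least_le dest: not_less_Least)
      thus "y \<in> (\<Union>j\<le>k. ring x j)" unfolding ring_def by blast
    qed
  qed
  define \<P> where "\<P> = {ring (rep y) k | y k. \<exists>x. (x, y) \<in> Q}"
  have "disjoint \<P>"
  proof (rule disjointI)
    fix A B assume "A \<in> \<P>" "B \<in> \<P>" and ne: "A \<noteq> B"
    then obtain y k z l where A: "A = ring (rep y) k" and B: "B = ring (rep z) l"
      and yx: "\<exists>x. (x, y) \<in> Q" and zx: "\<exists>x. (x, z) \<in> Q" unfolding \<P>_def by blast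
    show "A \<inter> B = {}"
    proof (rule ccontr)
      assume "A \<inter> B \<noteq> {}"
      then obtain w where w: "w \<in> A" "w \<in> B" by blast
      have Qw: "(rep y, w) \<in> Q" "(rep z, w) \<in> Q" using w unfolding A B ring_def Q_def by blast+
      have yz: "rep (rep y) = rep (rep z)" using rep_eq[OF Qw(1)] rep_eq[OF Qw(2)] by simp
      have rr: "rep (rep u) = rep u" if "\<exists>x. (x, u) \<in> Q" for u
        using that rep rep_eq by blast
      have xx: "rep y = rep z" using yz rr[OF yx] rr[OF zx] by simp
      have "k = l" using w xx unfolding A B ring_def by (cases k l rule: linorder_cases) auto
      thus False using ne xx unfolding A B by simp
    qed
  qed
  moreover have "\<exists>\<F>\<subseteq>\<P>. finite \<F> \<and> S \<subseteq> \<Union>\<F>" if S: "side S" for S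
  proof -
    obtain X where X: "finite X" "S \<subseteq> R (cut_size S) `` X"
      using cov[OF S order_refl] unfolding fin_covered_def by blast
    let ?N = "cut_size S"
    have "\<exists>\<F>\<subseteq>\<P>. finite \<F> \<and> R ?N `` {x} \<subseteq> \<Union>\<F>" for x
    proof (cases "R ?N `` {x} = {}")
      case False
      then obtain y where "(x, y) \<in> R ?N" by blast
      hence "(y, x) \<in> Q" using symQ unfolding Q_def sym_def by blast
      hence Qx: "\<exists>x'. (x', x) \<in> Q" and "(rep x, x) \<in> Q" using rep by blast+
      then obtain j where j: "(rep x, x) \<in> R j" unfolding Q_def by blast
      \<comment> \<open>The points \<open>x\<close> and \<open>rep x\<close> may become related only
        after stage \<open>?N\<close>; at stage \<open>?M\<close> their classes agree, and this
        class still contains the class of \<open>x\<close> at stage \<open>?N\<close>.\<close>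
      let ?M = "max j ?N"
      have "(rep x, x) \<in> R ?M" using j monoD[OF mono, of j ?M] by auto
      hence "R ?M `` {x} = R ?M `` {rep x}" using side_rel_class_eq[OF R] by blast
      hence "R ?N `` {x} \<subseteq> \<Union>(ring (rep x) ` {..?M})"
        using step[of ?N ?M x] rings[of ?M "rep x"] by simp
      moreover have "ring (rep x) ` {..?M} \<subseteq> \<P>" 
        unfolding \<P>_def by (rule image_subsetI, rule CollectI, rule exI[of _ x], rule exI, rule conjI[OF refl Qx])
      ultimately show ?thesis
        by (intro exI[of _ "ring (rep x) ` {..?M}"] conjI finite_imageI finite_atMost)
    qed (intro exI[of _ "{}"], simp)
    then obtain F where F: "F x \<subseteq> \<P>" "finite (F x)" "R ?N `` {x} \<subseteq> \<Union>(F x)" for x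
      by metis
    have "S \<subseteq> \<Union>(\<Union>x\<in>X. F x)"
    proof
      fix z assume "z \<in> S"
      then obtain x where "x \<in> X" "z \<in> R ?N `` {x}" using X(2) by blast
      thus "z \<in> \<Union>(\<Union>x\<in>X. F x)" using F(3)[of x] by blast
    qed
    moreover have "finite (\<Union>x\<in>X. F x)" "(\<Union>x\<in>X. F x) \<subseteq> \<P>" using X(1) F(1,2) by blast+
    ultimately show ?thesis by blast
  qed
  moreover have "\<forall>P\<in>\<P>. side P" using side_ring unfolding \<P>_def by blast
  ultimately show ?thesis by (intro exI[of _ \<P>]) simp
qed

end

context connected_graph
begin

text \<open>The absorbing sides are cut down to \<open>C\<close> and replaced by their finitely many
  connected parts, which keeps covers finite. The family need not exhaust \<open>C - {r}\<close>: a
  vertex that no finite cut separates from \<open>r\<close> lies in no member.\<close>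

theorem finite_cut_partition_off_vertex:
  assumes C: "C \<subseteq> K" "finite (edge_cut E C)" and r: "r \<in> C"
  shows "\<exists>\<D>. disjoint \<D> \<and>
    (\<forall>D\<in>\<D>. D \<noteq> {} \<and> D \<subseteq> C - {r} \<and> connected_in E D \<and> finite (edge_cut E D)) \<and>
    (\<forall>B. B \<subseteq> C - {r} \<and> finite (edge_cut E B) \<longrightarrow> (\<exists>\<F>\<subseteq>\<D>. finite \<F> \<and> B \<subseteq> \<Union>\<F>))"
proof -
  interpret rooted_connected_graph E K r
    using C r by unfold_locales blast
  obtain \<P> where \<P>: "disjoint \<P>" "\<And>P. P \<in> \<P> \<Longrightarrow> side P"
    "\<And>S. side S \<Longrightarrow> \<exists>\<F>\<subseteq>\<P>. finite \<F> \<and> S \<subseteq> \<Union>\<F>"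
    using paracompact_sides by blast
  have "\<exists>\<Q>. finite \<Q> \<and> disjoint \<Q> \<and> \<Union>\<Q> = P \<inter> C \<and>
    (\<forall>Q\<in>\<Q>. Q \<noteq> {} \<and> connected_in E Q \<and> finite (edge_cut E Q))" if "P \<in> \<P>" for P
    using \<P>(2)[OF that] C root finite_edge_cut_Int
    by (intro finite_connected_decomposition) (auto simp: side_def)
  then obtain Q where Q: "\<And>P. P \<in> \<P> \<Longrightarrow> finite (Q P) \<and> disjoint (Q P) \<and> \<Union>(Q P) = P \<inter> C \<and>
    (\<forall>D\<in>Q P. D \<noteq> {} \<and> connected_in E D \<and> finite (edge_cut E D))" by metis
  let ?\<D> = "\<Union>(Q ` \<P>)"
  have sub: "D \<subseteq> P \<inter> C" if "P \<in> \<P>" "D \<in> Q P" for P D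
    using Q[OF that(1)] that(2) by blast
  have "disjoint ?\<D>"
  proof (rule disjointI)
    fix A B assume AB: "A \<in> ?\<D>" "B \<in> ?\<D>" "A \<noteq> B"
    then obtain P P' where P: "P \<in> \<P>" "A \<in> Q P" "P' \<in> \<P>" "B \<in> Q P'" by blast
    show "A \<inter> B = {}"
    proof (cases "P = P'")
      case True
      then show ?thesis using Q[OF P(1)] P AB disjointD by metis
    next
      case False
      then show ?thesis using sub P disjointD[OF \<P>(1) P(1,3)] by blast
    qed
  qed
  moreover have "\<forall>D\<in>?\<D>. D \<noteq> {} \<and> D \<subseteq> C - {r} \<and> connected_in E D \<and> finite (edge_cut E D)"
    using Q sub \<P>(2) unfolding side_def by blast
  moreover have "\<exists>\<F>\<subseteq>?\<D>. finite \<F> \<and> B \<subseteq> \<Union>\<F>" if B: "B \<subseteq> C - {r}" "finite (edge_cut E B)" for B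
  proof -
    have "side B" using B C unfolding side_def by blast
    then obtain \<F> where \<F>: "\<F> \<subseteq> \<P>" "finite \<F>" "B \<subseteq> \<Union>\<F>" using \<P>(3) by meson
    have "B \<subseteq> \<Union>(\<Union>(Q ` \<F>))"
    proof
      fix x assume x: "x \<in> B"
      then obtain P where "P \<in> \<F>" "x \<in> P" using \<F> by blast
      thus "x \<in> \<Union>(\<Union>(Q ` \<F>))" using x B Q[of P] \<F>(1) by blast
    qed
    moreover have "finite (\<Union>(Q ` \<F>))" using Q \<F> by blast
    moreover have "\<Union>(Q ` \<F>) \<subseteq> ?\<D>" using \<F>(1) by auto
    ultimately show ?thesis by metis
  qed
  ultimately show ?thesis by (intro exI[of _ ?\<D>]) meson
qed

end

section \<open>The common characterisation: nested families of open pieces\<close>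

section \<open>Trees of open pieces\<close>

definition subpieces :: "(nat \<Rightarrow> 'a set set) \<Rightarrow> nat \<Rightarrow> 'a set \<Rightarrow> 'a set set" where
  "subpieces \<U> k U = {W \<in> \<U> (Suc k). W \<subseteq> U}"

text \<open>The point is the one to which the subpieces converge. The family may be empty; then
  \<open>U\<close> is an open singleton.\<close>

definition limit_piece :: "'a topology \<Rightarrow> 'a set \<Rightarrow> 'a set set \<Rightarrow> 'a \<Rightarrow> bool" where
  "limit_piece X U \<P> x \<longleftrightarrow> U = insert x (\<Union>\<P>) \<and> x \<notin> \<Union>\<P> \<and>
     local_basis_at X x {U - \<Union>\<F> | \<F>. finite \<F> \<and> \<F> \<subseteq> \<P>}"

text \<open>The order of the tree is inclusion between consecutive levels. The same set may occur at
  several levels; if it occurs at all levels from some point on, the last clause makes it a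
  singleton.\<close>

definition piece_tree :: "'a topology \<Rightarrow> (nat \<Rightarrow> 'a set set) \<Rightarrow> bool" where
  "piece_tree X \<U> \<longleftrightarrow> \<U> 0 = {topspace X} \<and>
     (\<forall>k. disjoint (\<U> k) \<and> (\<forall>U\<in>\<U> k. U \<noteq> {} \<and> openin X U)) \<and>
     (\<forall>k. \<forall>W\<in>\<U> (Suc k). \<exists>U\<in>\<U> k. W \<subseteq> U) \<and>
     (\<forall>k. \<forall>U\<in>\<U> k. \<Union>(subpieces \<U> k U) = U \<or> (\<exists>x. limit_piece X U (subpieces \<U> k U) x)) \<and>
     (\<forall>f. (\<forall>k. f k \<in> \<U> k \<and> f (Suc k) \<subseteq> f k) \<longrightarrow>
        (\<exists>x. \<Inter>(range f) = {x} \<and> local_basis_at X x (range f)))"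

lemma piece_treeD:
  assumes "piece_tree X \<U>"
  shows "\<U> 0 = {topspace X}"
    and "disjoint (\<U> k)"
    and "U \<in> \<U> k \<Longrightarrow> U \<noteq> {} \<and> openin X U"
    and "W \<in> \<U> (Suc k) \<Longrightarrow> \<exists>U\<in>\<U> k. W \<subseteq> U"
    and "U \<in> \<U> k \<Longrightarrow> \<Union>(subpieces \<U> k U) = U \<or> (\<exists>x. limit_piece X U (subpieces \<U> k U) x)"
    and "(\<And>k. f k \<in> \<U> k) \<Longrightarrow> (\<And>k. f (Suc k) \<subseteq> f k) \<Longrightarrow>
      \<exists>x. \<Inter>(range f) = {x} \<and> local_basis_at X x (range f)"
  using assms by (simp_all add: piece_tree_def)

lemma local_basis_at_homeomorphic_image:
  assumes f: "homeomorphic_map Y X f" and B: "local_basis_at Y y B" and y: "y \<in> topspace Y"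
  shows "local_basis_at X (f y) ((`) f ` B)"
  unfolding local_basis_at_def
proof (intro conjI ballI allI impI)
  fix V assume "V \<in> (`) f ` B"
  then obtain V' where V': "V' \<in> B" "V = f ` V'" by blast
  hence "openin Y V'" "y \<in> V'" using B unfolding local_basis_at_def by auto
  thus "openin X V" "f y \<in> V"
    using V' homeomorphic_map_openness[OF f openin_subset] by auto
next
  fix W assume W: "openin X W \<and> f y \<in> W"
  have "openin Y {v \<in> topspace Y. f v \<in> W}"
    using W f homeomorphic_imp_continuous_map openin_continuous_map_preimage by blast
  then obtain V where "V \<in> B" "V \<subseteq> {v \<in> topspace Y. f v \<in> W}"
    using B W y unfolding local_basis_at_def by blast
  thus "\<exists>V\<in>(`) f ` B. V \<subseteq> W" by auto
qed

lemma piece_tree_homeomorphic_image: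
  assumes f: "homeomorphic_map Y X f" and T: "piece_tree Y \<U>"
  shows "piece_tree X (\<lambda>k. (`) f ` \<U> k)"
proof -
  have inj: "inj_on f (topspace Y)" using f homeomorphic_imp_injective_map by blast
  note T0 = piece_treeD(1)[OF T] and T1 = piece_treeD(2,3)[OF T] and T2 = piece_treeD(4)[OF T]
    and T3 = piece_treeD(5)[OF T] and T4 = piece_treeD(6)[OF T]
  have sub: "U \<subseteq> topspace Y" if "U \<in> \<U> k" for U k using T1 that openin_subset by blast
  have le: "f ` U \<subseteq> f ` W \<longleftrightarrow> U \<subseteq> W" if "U \<subseteq> topspace Y" "W \<subseteq> topspace Y" for U W
    using inj that by (meson image_mono inj_on_image_subset_iff)
  have sp: "subpieces (\<lambda>k. (`) f ` \<U> k) k (f ` U) = (`) f ` subpieces \<U> k U" if "U \<in> \<U> k" for k U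
  proof -
    have "f ` W \<subseteq> f ` U \<longleftrightarrow> W \<subseteq> U" if "W \<in> \<U> (Suc k)" for W
      by (rule le[OF sub[OF that] sub[OF \<open>U \<in> \<U> k\<close>]])
    thus ?thesis unfolding subpieces_def by blast
  qed
  have "\<Union>(subpieces (\<lambda>k. (`) f ` \<U> k) k U) = U \<or> (\<exists>x. limit_piece X U (subpieces (\<lambda>k. (`) f ` \<U> k) k U) x)"
    if U': "U \<in> (`) f ` \<U> k" for k U
  proof -
    obtain U0 where U: "U0 \<in> \<U> k" "U = f ` U0" using U' by blast
    let ?P = "subpieces \<U> k U0"
    have Psub: "W \<subseteq> topspace Y" if "W \<in> ?P" for W using that sub unfolding subpieces_def by blast
    consider "\<Union>?P = U0" | x where "limit_piece Y U0 ?P x" using T3[OF U(1)] by blast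
    thus ?thesis
    proof cases
      case 1
      hence "\<Union>(subpieces (\<lambda>k. (`) f ` \<U> k) k U) = U" using sp U by (metis image_Union)
      thus ?thesis ..
    next
      case 2
      have x: "x \<in> topspace Y" using 2 sub[OF U(1)] unfolding limit_piece_def by blast
      have "limit_piece X U ((`) f ` ?P) (f x)"
        unfolding limit_piece_def
      proof (intro conjI)
        show "U = insert (f x) (\<Union>((`) f ` ?P))"
        proof -
          have "U0 = insert x (\<Union>?P)" using 2 unfolding limit_piece_def by (elim conjE)
          hence "f ` U0 = f ` insert x (\<Union>?P)" by (rule arg_cong)
          thus ?thesis using U(2) by (simp only: image_insert image_Union)
        qed
        show "f x \<notin> \<Union>((`) f ` ?P)"
        proof
          assume "f x \<in> \<Union>((`) f ` ?P)"
          then obtain W y where "W \<in> ?P" "y \<in> W" "f x = f y" by blast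
          hence "x = y" using inj x Psub by (auto dest: inj_onD)
          thus False using 2 \<open>W \<in> ?P\<close> \<open>y \<in> W\<close> unfolding limit_piece_def by blast
        qed
        have im: "f ` (U0 - \<Union>\<F>) = U - \<Union>((`) f ` \<F>)" if "\<F> \<subseteq> ?P" for \<F>
        proof -
          have "\<Union>\<F> \<subseteq> topspace Y" using that Psub by blast
          hence "f ` (U0 - \<Union>\<F>) = f ` U0 - f ` \<Union>\<F>"
            using inj sub[OF U(1)] inj_on_image_set_diff by (metis Diff_subset subset_trans)
          thus ?thesis using U(2) by (simp add: image_Union)
        qed
        have "(`) f ` {U0 - \<Union>\<F> | \<F>. finite \<F> \<and> \<F> \<subseteq> ?P}
            = {U - \<Union>\<F> | \<F>. finite \<F> \<and> \<F> \<subseteq> (`) f ` ?P}" (is "?A = ?B")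
        proof
          show "?A \<subseteq> ?B"
          proof
            fix V assume "V \<in> ?A"
            then obtain \<F> where "finite \<F>" "\<F> \<subseteq> ?P" "V = f ` (U0 - \<Union>\<F>)" by blast
            hence "V = U - \<Union>((`) f ` \<F>)" "finite ((`) f ` \<F>)" "(`) f ` \<F> \<subseteq> (`) f ` ?P"
              using im by auto
            thus "V \<in> ?B" by blast
          qed
          show "?B \<subseteq> ?A"
          proof
            fix V assume "V \<in> ?B"
            then obtain \<F>' where F': "finite \<F>'" "\<F>' \<subseteq> (`) f ` ?P" "V = U - \<Union>\<F>'" by blast
            obtain \<F> where "finite \<F>" "\<F> \<subseteq> ?P" "\<F>' = (`) f ` \<F>"
              using finite_subset_image[OF F'(1,2)] by metis
            hence "V = f ` (U0 - \<Union>\<F>)" using im F' by simp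
            thus "V \<in> ?A" using \<open>finite \<F>\<close> \<open>\<F> \<subseteq> ?P\<close> by blast
          qed
        qed
        moreover have "local_basis_at Y x {U0 - \<Union>\<F> | \<F>. finite \<F> \<and> \<F> \<subseteq> ?P}"
          using 2 unfolding limit_piece_def by (elim conjE)
        note local_basis_at_homeomorphic_image[OF f this x]
        ultimately show "local_basis_at X (f x) {U - \<Union>\<F> | \<F>. finite \<F> \<and> \<F> \<subseteq> (`) f ` ?P}"
          by (rule subst[where P = "local_basis_at X (f x)"])
      qed
      thus ?thesis using sp U by auto
    qed
  qed
  moreover have "\<exists>x. \<Inter>(range h) = {x} \<and> local_basis_at X x (range h)"
    if h: "\<forall>k. h k \<in> (`) f ` \<U> k \<and> h (Suc k) \<subseteq> h k" for h
  proof -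
    have "\<forall>k. \<exists>U. U \<in> \<U> k \<and> h k = f ` U" using h by blast
    then obtain g where g: "\<And>k. g k \<in> \<U> k" "\<And>k. h k = f ` g k" by metis
    have "g (Suc k) \<subseteq> g k" for k using h g le sub by metis
    then obtain y where y: "\<Inter>(range g) = {y}" "local_basis_at Y y (range g)" using T4[of g] g(1) by blast
    have yY: "y \<in> topspace Y" using y(1) sub[OF g(1)[of 0]] by blast
    have "range h = (`) f ` range g" using g(2) by auto
    moreover have "\<Inter>((`) f ` range g) = f ` (\<Inter>(range g))"
      using image_INT[OF inj, of UNIV g] sub[OF g(1)] by auto
    ultimately show ?thesis
      using y local_basis_at_homeomorphic_image[OF f y(2) yY] by auto
  qed
  moreover have "disjoint ((`) f ` \<U> k)" for k
  proof (rule disjointI)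
    fix A B assume AB: "A \<in> (`) f ` \<U> k" "B \<in> (`) f ` \<U> k" "A \<noteq> B"
    then obtain A' B' where "A' \<in> \<U> k" "B' \<in> \<U> k" "A = f ` A'" "B = f ` B'" "A' \<noteq> B'" by blast
    thus "A \<inter> B = {}"
      using disjointD[OF T1(1), of A' k B'] inj_on_image_Int[OF inj sub sub, of A' k B' k] by simp
  qed
  moreover have "\<exists>U\<in>(`) f ` \<U> k. W \<subseteq> U" if W: "W \<in> (`) f ` \<U> (Suc k)" for W k
  proof -
    obtain W' where "W' \<in> \<U> (Suc k)" "W = f ` W'" using W by blast
    moreover then obtain U' where "U' \<in> \<U> k" "W' \<subseteq> U'" using T2 by blast
    ultimately show ?thesis by (intro bexI[of _ "f ` U'"]) auto
  qed
  moreover have "U \<noteq> {} \<and> openin X U" if U: "U \<in> (`) f ` \<U> k" for U k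
  proof -
    obtain U' where "U' \<in> \<U> k" "U = f ` U'" using U by blast
    thus ?thesis using T1(2)[of U' k] homeomorphic_map_openness[OF f openin_subset, of U'] by simp
  qed
  moreover have "(`) f ` \<U> 0 = {topspace X}"
    using T0 homeomorphic_imp_surjective_map[OF f] by simp
  ultimately show ?thesis unfolding piece_tree_def by simp
qed

section \<open>Edge-ends described by vertex sets with a finite cut\<close>

section \<open>From graphs to trees of pieces\<close>

definition has_tail :: "(nat \<Rightarrow> 'v) \<Rightarrow> 'v set \<Rightarrow> bool" where
  "has_tail r S \<longleftrightarrow> (\<exists>m. r ` {m..} \<subseteq> S)"

lemma has_tail_mono: "has_tail r A \<Longrightarrow> A \<subseteq> B \<Longrightarrow> has_tail r B"
  unfolding has_tail_def by blast

lemma has_tail_Int: 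
  assumes "has_tail r A" "has_tail r B" shows "has_tail r (A \<inter> B)"
proof -
  obtain m n where "r ` {m..} \<subseteq> A" "r ` {n..} \<subseteq> B" using assms unfolding has_tail_def by blast
  hence "r ` {max m n..} \<subseteq> A \<inter> B" by auto
  thus ?thesis unfolding has_tail_def by blast
qed

lemma not_has_tail_empty [simp]: "\<not> has_tail r {}"
  unfolding has_tail_def by auto

lemma has_tail_disjoint: "has_tail r A \<Longrightarrow> has_tail r B \<Longrightarrow> A \<inter> B = {} \<Longrightarrow> False"
  using has_tail_Int by fastforce

lemma edge_cut_Compl: "edge_cut E (- S) = edge_cut E S"
  unfolding edge_cut_def by auto

lemma finite_ray_edges_in:
  assumes "inj r" "finite F"
  shows "finite {n. {r n, r (Suc n)} \<in> F}"
proof -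
  have "inj (\<lambda>n. {r n, r (Suc n)})"
  proof (rule injI)
    fix m n assume "{r m, r (Suc m)} = {r n, r (Suc n)}"
    hence "(m = n \<and> Suc m = Suc n) \<or> (m = Suc n \<and> Suc m = n)"
      using assms(1) by (simp add: doubleton_eq_iff inj_eq)
    thus "m = n" by auto
  qed
  hence "finite ((\<lambda>n. {r n, r (Suc n)}) -` F)" using assms(2) by (rule finite_vimageI[rotated])
  thus ?thesis by (simp add: vimage_def)
qed

lemma ray_edges_avoid_finite:
  assumes "inj r" "finite F"
  obtains N where "\<And>n. {r n, r (Suc n)} \<in> F \<Longrightarrow> n < N"
  using finite_ray_edges_in[OF assms] that unfolding finite_nat_set_iff_bounded by auto

text \<open>An injective ray runs through each edge at most once, so after finitely many steps it no
  longer crosses the cut.\<close>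

lemma has_tail_side_of_finite_cut:
  assumes r: "r \<in> graph_rays E" and S: "finite (edge_cut E S)"
  shows "has_tail r S \<or> has_tail r (- S)"
proof -
  have "inj r" using r by (simp add: graph_rays_def)
  then obtain N where N: "\<And>n. {r n, r (Suc n)} \<in> edge_cut E S \<Longrightarrow> n < N"
    using ray_edges_avoid_finite S by metis
  have "r n \<in> S \<longleftrightarrow> r N \<in> S" if "N \<le> n" for n
    using that
  proof (induction n rule: dec_induct)
    case (step n)
    have "{r n, r (Suc n)} \<in> E" using r unfolding graph_rays_def by blast
    moreover have "{r n, r (Suc n)} \<notin> edge_cut E S" using N step(1) by (meson not_le)
    ultimately show ?case using step unfolding edge_cut_def by blast
  qed simp
  thus ?thesis unfolding has_tail_def by blast
qed

locale graph =
  fixes V :: "'v set" and E :: "'v set set"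
  assumes graph: "is_graph V E"
begin

abbreviation fin_cut :: "'v set \<Rightarrow> bool" where
  "fin_cut S \<equiv> finite (edge_cut E S)"

lemma edge_card: "e \<in> E \<Longrightarrow> card e = 2" and edge_sub: "e \<in> E \<Longrightarrow> e \<subseteq> V"
  using graph unfolding is_graph_def by blast+

lemma edge_pair: "e \<in> E \<Longrightarrow> x \<in> e \<Longrightarrow> y \<in> e \<Longrightarrow> x \<noteq> y \<Longrightarrow> e = {x, y}"
  using edge_card[of e] by (auto simp: card_2_iff)

lemma ray_in_V: "r \<in> graph_rays E \<Longrightarrow> r n \<in> V"
  using edge_sub unfolding graph_rays_def by blast

lemma component_cases:
  assumes "C \<in> graph_components V (E - F)"
  shows "edge_cut E C \<subseteq> F" "connected_in (E - F) C" "C \<noteq> {}" "C \<subseteq> V"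
proof -
  let ?R = "{(x, y). {x, y} \<in> E - F}"
  obtain v where v: "v \<in> V" "C = {w. (v, w) \<in> ?R\<^sup>*}"
    using assms unfolding graph_components_def by auto
  have symR: "sym (?R\<^sup>*)" by (intro sym_rtrancl) (auto simp: sym_def insert_commute)
  have closed: "y \<in> C" if "x \<in> C" "{x, y} \<in> E - F" for x y
    using that v by (auto intro: rtrancl_into_rtrancl)
  show "edge_cut E C \<subseteq> F"
  proof
    fix e assume e: "e \<in> edge_cut E C"
    then obtain x y where xy: "x \<in> e" "x \<in> C" "y \<in> e" "y \<notin> C" "e \<in> E" unfolding edge_cut_def by blast
    hence "e = {x, y}" using edge_pair by blast
    thus "e \<in> F" using closed xy by blast
  qed
  show "connected_in (E - F) C"
    unfolding connected_in_def
  proof (intro allI impI)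
    fix B assume "C \<inter> B \<noteq> {} \<and> C - B \<noteq> {}"
    then obtain x y where xy: "x \<in> C" "x \<in> B" "y \<in> C" "y \<notin> B" by blast
    have "(x, y) \<in> ?R\<^sup>*"
      using v xy symR by (metis (mono_tags, lifting) mem_Collect_eq rtrancl_trans symD)
    thus "\<exists>e\<in>E - F. e \<subseteq> C \<and> e \<inter> B \<noteq> {} \<and> \<not> e \<subseteq> B"
      using xy(1,2,4)
    proof (induction rule: converse_rtrancl_induct)
      case (step x z)
      have z: "z \<in> C" "{x, z} \<in> E - F" using step closed by auto
      show ?case
      proof (cases "z \<in> B")
        case True
        then show ?thesis using step z by blast
      next
        case False
        then show ?thesis using step z by (intro bexI[of _ "{x, z}"]) auto
      qed
    qed simp
  qed
  show "C \<noteq> {}" using v by blast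
  show "C \<subseteq> V"
  proof
    fix w assume "w \<in> C"
    hence "(v, w) \<in> ?R\<^sup>*" using v by blast
    thus "w \<in> V" using v(1) edge_sub by (induction rule: rtrancl_induct) auto
  qed
qed

lemma components_disjoint:
  assumes "C \<in> graph_components V (E - F)" "D \<in> graph_components V (E - F)" "x \<in> C" "x \<in> D"
  shows "C = D"
proof -
  let ?R = "{(x, y). {x, y} \<in> E - F}"
  have symR: "sym (?R\<^sup>*)" by (intro sym_rtrancl) (auto simp: sym_def insert_commute)
  obtain v w where "C = ?R\<^sup>* `` {v}" "D = ?R\<^sup>* `` {w}"
    using assms unfolding graph_components_def by auto
  thus ?thesis using assms(3,4) symR
    by (auto intro: rtrancl_trans dest: symD)
qed

lemma component_subset:
  assumes C: "C \<in> graph_components V (E - F)" and S: "edge_cut E S \<subseteq> F" "C \<inter> S \<noteq> {}"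
  shows "C \<subseteq> S"
  using component_cases(2)[OF C] S unfolding connected_in_def edge_cut_def by blast

lemma ray_component:
  assumes r: "r \<in> graph_rays E" and F: "finite F"
  shows "\<exists>C\<in>graph_components V (E - F). has_tail r C"
proof -
  have "inj r" using r by (simp add: graph_rays_def)
  then obtain N where N: "\<And>n. {r n, r (Suc n)} \<in> F \<Longrightarrow> n < N"
    using ray_edges_avoid_finite F by metis
  let ?R = "{(x, y). {x, y} \<in> E - F}"
  let ?C = "{w. (r N, w) \<in> ?R\<^sup>*}"
  have "r n \<in> ?C" if "N \<le> n" for n
    using that
  proof (induction n rule: dec_induct)
    case (step n)
    have "{r n, r (Suc n)} \<in> E - F" using r N[of n] step(1) unfolding graph_rays_def by auto
    then show ?case using step by (auto intro: rtrancl_into_rtrancl)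
  qed simp
  hence "has_tail r ?C" unfolding has_tail_def by (intro exI[of _ N]) blast
  moreover have "?C \<in> graph_components V (E - F)"
    unfolding graph_components_def using ray_in_V[OF r] by blast
  ultimately show ?thesis by blast
qed

lemma separated_by_iff:
  "separated_by V E F r r' \<longleftrightarrow> \<not> (\<exists>C\<in>graph_components V (E - F). has_tail r C \<and> has_tail r' C)"
  unfolding separated_by_def has_tail_def by blast

text \<open>Finite edge sets are traded for vertex sets with a finite cut: a component of
  \<open>E - F\<close> has its cut inside \<open>F\<close>, and once the cut of \<open>S\<close> is
  deleted, every component meeting \<open>S\<close> lies inside \<open>S\<close>. One implication
  suffices because a set and its complement have the same cut.\<close>

lemma edge_equivalence_iff:
  assumes r: "r \<in> graph_rays E" "r' \<in> graph_rays E"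
  shows "(r, r') \<in> edge_equivalence V E \<longleftrightarrow> (\<forall>S. fin_cut S \<longrightarrow> has_tail r S \<longrightarrow> has_tail r' S)"
proof
  assume eq: "(r, r') \<in> edge_equivalence V E"
  show "\<forall>S. fin_cut S \<longrightarrow> has_tail r S \<longrightarrow> has_tail r' S"
  proof (intro allI impI)
    fix S assume S: "fin_cut S" "has_tail r S"
    have "\<not> separated_by V E (edge_cut E S) r r'"
      using eq S edge_cut_subset unfolding edge_equivalence_def by blast
    then obtain C where C: "C \<in> graph_components V (E - edge_cut E S)" "has_tail r C" "has_tail r' C"
      unfolding separated_by_iff by blast
    have "C \<inter> S \<noteq> {}" using C S has_tail_disjoint by blast
    hence "C \<subseteq> S" using component_subset C by blast
    thus "has_tail r' S" using C has_tail_mono by blast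
  qed
next
  assume *: "\<forall>S. fin_cut S \<longrightarrow> has_tail r S \<longrightarrow> has_tail r' S"
  have "\<not> separated_by V E F r r'" if F: "finite F" for F
  proof -
    obtain C where C: "C \<in> graph_components V (E - F)" "has_tail r C" using ray_component r F by blast
    hence "fin_cut C" using component_cases(1) F finite_subset by blast
    thus ?thesis using * C unfolding separated_by_iff by blast
  qed
  thus "(r, r') \<in> edge_equivalence V E" using r unfolding edge_equivalence_def by blast
qed

lemma equiv_edge_equivalence: "equiv (graph_rays E) (edge_equivalence V E)"
proof (rule equivI)
  show sub: "edge_equivalence V E \<subseteq> graph_rays E \<times> graph_rays E"
    unfolding edge_equivalence_def by blast
  show "refl_on (graph_rays E) (edge_equivalence V E)"
    using edge_equivalence_iff by (auto simp: refl_on_def)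
  show "sym (edge_equivalence V E)"
  proof (rule symI)
    fix r r' assume rr: "(r, r') \<in> edge_equivalence V E"
    hence rays: "r \<in> graph_rays E" "r' \<in> graph_rays E" using sub by auto
    have "has_tail r S" if S: "fin_cut S" "has_tail r' S" for S
    proof (rule ccontr)
      assume "\<not> has_tail r S"
      hence "has_tail r (- S)" using has_tail_side_of_finite_cut rays S by blast
      hence "has_tail r' (- S)" using rr edge_equivalence_iff[OF rays] S by (simp add: edge_cut_Compl)
      thus False using S has_tail_disjoint[of r' S "- S"] by blast
    qed
    thus "(r', r) \<in> edge_equivalence V E" using edge_equivalence_iff rays by blast
  qed
  show "trans (edge_equivalence V E)"
  proof (rule transI)
    fix a b c assume ab: "(a, b) \<in> edge_equivalence V E" "(b, c) \<in> edge_equivalence V E"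
    hence "a \<in> graph_rays E" "b \<in> graph_rays E" "c \<in> graph_rays E" using sub by auto
    thus "(a, c) \<in> edge_equivalence V E" using ab edge_equivalence_iff by blast
  qed
qed

text \<open>One ray with a tail in \<open>S\<close> is asked for; if \<open>S\<close> has a finite
  cut, all rays of the end have one (\<open>ends_in_all\<close>).\<close>

definition ends_in :: "'v set \<Rightarrow> (nat \<Rightarrow> 'v) set set" where
  "ends_in S = {\<epsilon> \<in> edge_ends V E. \<exists>r\<in>\<epsilon>. has_tail r S}"

lemma end_ray: "\<epsilon> \<in> edge_ends V E \<Longrightarrow> \<exists>r. r \<in> \<epsilon>" "\<epsilon> \<in> edge_ends V E \<Longrightarrow> r \<in> \<epsilon> \<Longrightarrow> r \<in> graph_rays E"
  using in_quotient_imp_non_empty[OF equiv_edge_equivalence]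
    in_quotient_imp_subset[OF equiv_edge_equivalence] unfolding edge_ends_def by blast+

lemma end_of_ray: "r \<in> graph_rays E \<Longrightarrow> \<exists>\<epsilon>\<in>edge_ends V E. r \<in> \<epsilon>"
  unfolding edge_ends_def
  by (metis equiv_class_self equiv_edge_equivalence quotientI)

lemma ends_in_all:
  assumes "\<epsilon> \<in> ends_in S" "fin_cut S" "r \<in> \<epsilon>"
  shows "has_tail r S"
proof -
  obtain r0 where r0: "r0 \<in> \<epsilon>" "has_tail r0 S" "\<epsilon> \<in> edge_ends V E" using assms unfolding ends_in_def by blast
  hence "(r0, r) \<in> edge_equivalence V E"
    using assms(3) in_quotient_imp_in_rel[OF equiv_edge_equivalence, of \<epsilon> r0 r] unfolding edge_ends_def by blast
  thus ?thesis using edge_equivalence_iff[of r0 r] r0 assms end_ray by blast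
qed

lemma ends_in_mono: "A \<subseteq> B \<Longrightarrow> ends_in A \<subseteq> ends_in B"
  unfolding ends_in_def using has_tail_mono by blast

lemma ends_in_Int:
  "fin_cut A \<Longrightarrow> fin_cut B \<Longrightarrow> ends_in A \<inter> ends_in B = ends_in (A \<inter> B)"
proof
  assume AB: "fin_cut A" "fin_cut B"
  show "ends_in (A \<inter> B) \<subseteq> ends_in A \<inter> ends_in B" using ends_in_mono by simp
  show "ends_in A \<inter> ends_in B \<subseteq> ends_in (A \<inter> B)"
  proof
    fix \<epsilon> assume \<epsilon>: "\<epsilon> \<in> ends_in A \<inter> ends_in B"
    then obtain r where r: "r \<in> \<epsilon>" "has_tail r A" "\<epsilon> \<in> edge_ends V E" unfolding ends_in_def by blast
    hence "has_tail r (A \<inter> B)" using ends_in_all[of \<epsilon> B r] \<epsilon> AB has_tail_Int by blast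
    thus "\<epsilon> \<in> ends_in (A \<inter> B)" using r unfolding ends_in_def by blast
  qed
qed

lemma ends_in_empty [simp]: "ends_in {} = {}"
  unfolding ends_in_def by simp

lemma ends_in_disjoint:
  "fin_cut A \<Longrightarrow> fin_cut B \<Longrightarrow> A \<inter> B = {} \<Longrightarrow> ends_in A \<inter> ends_in B = {}"
  by (simp add: ends_in_Int)

lemma ends_in_Compl:
  assumes "fin_cut S" "\<epsilon> \<in> edge_ends V E" "\<epsilon> \<notin> ends_in S"
  shows "\<epsilon> \<in> ends_in (- S)"
  using assms end_ray[OF assms(2)] has_tail_side_of_finite_cut unfolding ends_in_def by blast

text \<open>An end in the union that is not in \<open>A\<close> is in the complement of
  \<open>A\<close>, which also has a finite cut, and so in the union of the other members.\<close>

lemma ends_in_Union: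
  assumes "finite \<F>" "\<And>A. A \<in> \<F> \<Longrightarrow> fin_cut A" "\<epsilon> \<in> ends_in (\<Union>\<F>)"
  shows "\<exists>A\<in>\<F>. \<epsilon> \<in> ends_in A"
  using assms
proof (induction \<F> rule: finite_induct)
  case (insert A \<F>)
  have \<epsilon>: "\<epsilon> \<in> edge_ends V E" using insert.prems unfolding ends_in_def by blast
  show ?case
  proof (cases "\<epsilon> \<in> ends_in A")
    case False
    hence "\<epsilon> \<in> ends_in (- A)" using ends_in_Compl \<epsilon> insert.prems by blast
    moreover have "fin_cut (\<Union>(insert A \<F>))"
      using insert by (intro finite_edge_cut_Union) auto
    ultimately have "\<epsilon> \<in> ends_in (\<Union>(insert A \<F>) \<inter> - A)"
      using insert.prems ends_in_Int[of "\<Union>(insert A \<F>)" "- A"] by (auto simp: edge_cut_Compl)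
    hence "\<epsilon> \<in> ends_in (\<Union>\<F>)" using ends_in_mono[of "\<Union>(insert A \<F>) \<inter> - A" "\<Union>\<F>"] by blast
    thus ?thesis using insert by blast
  qed blast
qed simp

lemma ends_eq:
  assumes "\<epsilon> \<in> edge_ends V E" "\<eta> \<in> edge_ends V E"
    and "\<And>S. fin_cut S \<Longrightarrow> \<epsilon> \<in> ends_in S \<Longrightarrow> \<eta> \<in> ends_in S"
  shows "\<epsilon> = \<eta>"
proof -
  obtain r r' where r: "r \<in> \<epsilon>" "r' \<in> \<eta>" using end_ray(1) assms(1,2) by meson
  have "has_tail r' S" if "fin_cut S" "has_tail r S" for S
    using assms that r ends_in_all unfolding ends_in_def by blast
  hence "(r, r') \<in> edge_equivalence V E" using edge_equivalence_iff r end_ray assms by blast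
  thus ?thesis using r assms(1,2) quotient_eqI[OF equiv_edge_equivalence] unfolding edge_ends_def by blast
qed

lemma edge_end_nbhd_eq:
  assumes "\<epsilon> \<in> edge_ends V E" "finite F"
  shows "\<exists>C\<in>graph_components V (E - F). fin_cut C \<and> \<epsilon> \<in> ends_in C \<and> edge_end_nbhd V E F \<epsilon> = ends_in C"
proof -
  obtain r where r: "r \<in> \<epsilon>" "r \<in> graph_rays E" using end_ray assms by blast
  obtain C where C: "C \<in> graph_components V (E - F)" "has_tail r C" using ray_component r assms by blast
  have fin: "fin_cut C" using component_cases(1)[OF C(1)] assms finite_subset by blast
  have \<epsilon>: "\<epsilon> \<in> ends_in C" using r C assms unfolding ends_in_def by blast
  have unique: "D = C" if "D \<in> graph_components V (E - F)" "has_tail s D" "has_tail s C" for D s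
    using that C has_tail_disjoint components_disjoint by (metis disjoint_iff)
  have "\<eta> \<in> edge_end_nbhd V E F \<epsilon> \<longleftrightarrow> \<eta> \<in> ends_in C" for \<eta>
  proof
    assume \<eta>: "\<eta> \<in> edge_end_nbhd V E F \<epsilon>"
    hence \<eta>1: "\<eta> \<in> edge_ends V E" unfolding edge_end_nbhd_def by blast
    then obtain r' where r': "r' \<in> \<eta>" using end_ray by blast
    hence "\<not> separated_by V E F r r'" using \<eta> r unfolding edge_end_nbhd_def by blast
    then obtain D where "D \<in> graph_components V (E - F)" "has_tail r D" "has_tail r' D"
      unfolding separated_by_iff by blast
    thus "\<eta> \<in> ends_in C" using unique C(2) \<eta>1 r' unfolding ends_in_def by blast
  next
    assume \<eta>: "\<eta> \<in> ends_in C"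
    have "\<not> separated_by V E F R R'" if "R \<in> \<epsilon>" "R' \<in> \<eta>" for R R'
      using ends_in_all[OF \<epsilon> fin that(1)] ends_in_all[OF \<eta> fin that(2)] C unfolding separated_by_iff by blast
    thus "\<eta> \<in> edge_end_nbhd V E F \<epsilon>" using \<eta> unfolding edge_end_nbhd_def ends_in_def by blast
  qed
  thus ?thesis using C fin \<epsilon> by blast
qed

text \<open>The sets \<open>ends_in S\<close> with a finite cut form a base. The generating
  neighbourhoods are of this form with \<open>S\<close> a component; admitting all \<open>S\<close>
  makes the family closed under intersection without any recourse to components.\<close>

lemma openin_edge_end_space:
  "openin (edge_end_space V E) W \<longleftrightarrow> W \<subseteq> edge_ends V E \<and>
     (\<forall>\<epsilon>\<in>W. \<exists>S. fin_cut S \<and> \<epsilon> \<in> ends_in S \<and> ends_in S \<subseteq> W)" (is "_ \<longleftrightarrow> ?open W")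
proof
  let ?B = "{edge_end_nbhd V E F \<epsilon> | F \<epsilon>. finite F \<and> F \<subseteq> E \<and> \<epsilon> \<in> edge_ends V E}"
  assume "openin (edge_end_space V E) W"
  hence "generate_topology_on ?B W"
    unfolding edge_end_space_def openin_topology_generated_by_iff .
  thus "?open W"
  proof induction
    case (Int A B)
    have "\<exists>S. fin_cut S \<and> \<epsilon> \<in> ends_in S \<and> ends_in S \<subseteq> A \<inter> B" if "\<epsilon> \<in> A \<inter> B" for \<epsilon>
    proof -
      obtain S S' where S: "fin_cut S" "\<epsilon> \<in> ends_in S" "ends_in S \<subseteq> A" "fin_cut S'" "\<epsilon> \<in> ends_in S'" "ends_in S' \<subseteq> B"
        using Int \<open>\<epsilon> \<in> A \<inter> B\<close> by (meson IntD1 IntD2)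
      hence "fin_cut (S \<inter> S')" "ends_in (S \<inter> S') = ends_in S \<inter> ends_in S'"
        using finite_edge_cut_Int ends_in_Int by blast+
      thus ?thesis using S by (intro exI[of _ "S \<inter> S'"]) auto
    qed
    thus ?case using Int by auto
  next
    case (UN \<W>)
    show ?case
    proof (intro conjI ballI)
      show "\<Union>\<W> \<subseteq> edge_ends V E" using UN by blast
      fix \<epsilon> assume "\<epsilon> \<in> \<Union>\<W>"
      then obtain A where A: "A \<in> \<W>" "\<epsilon> \<in> A" by blast
      then obtain S where "fin_cut S" "\<epsilon> \<in> ends_in S" "ends_in S \<subseteq> A" using UN by meson
      thus "\<exists>S. fin_cut S \<and> \<epsilon> \<in> ends_in S \<and> ends_in S \<subseteq> \<Union>\<W>" using A by (intro exI[of _ S]) blast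
    qed
  next
    case (Basis A)
    then obtain F \<epsilon> where "A = edge_end_nbhd V E F \<epsilon>" "finite F" "\<epsilon> \<in> edge_ends V E" by blast
    then obtain C where "A = ends_in C" "fin_cut C" using edge_end_nbhd_eq by metis
    thus ?case unfolding ends_in_def by blast
  qed simp
next
  assume W: "?open W"
  show "openin (edge_end_space V E) W"
  proof (subst openin_subopen, intro ballI)
    fix \<epsilon> assume "\<epsilon> \<in> W"
    then obtain S where S: "fin_cut S" "\<epsilon> \<in> ends_in S" "ends_in S \<subseteq> W" using W by blast
    have \<epsilon>: "\<epsilon> \<in> edge_ends V E" using S unfolding ends_in_def by blast
    obtain C where C: "C \<in> graph_components V (E - edge_cut E S)" "fin_cut C" "\<epsilon> \<in> ends_in C"
      "edge_end_nbhd V E (edge_cut E S) \<epsilon> = ends_in C"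
      using edge_end_nbhd_eq[OF \<epsilon> S(1)] by blast
    have "C \<inter> S \<noteq> {}" using ends_in_disjoint[OF C(2) S(1)] C(3) S(2) by blast
    hence "ends_in C \<subseteq> ends_in S" using component_subset[OF C(1)] ends_in_mono by blast
    moreover have "openin (edge_end_space V E) (ends_in C)"
      unfolding edge_end_space_def C(4)[symmetric]
      by (rule topology_generated_by_Basis) (use S \<epsilon> edge_cut_subset in blast)
    ultimately show "\<exists>T. openin (edge_end_space V E) T \<and> \<epsilon> \<in> T \<and> T \<subseteq> W" using C S by blast
  qed
qed

lemma ends_in_UNIV: "ends_in UNIV = edge_ends V E"
  unfolding ends_in_def has_tail_def using end_ray(1) by auto

lemma openin_ends_in: "fin_cut S \<Longrightarrow> openin (edge_end_space V E) (ends_in S)"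
  unfolding openin_edge_end_space by (auto simp: ends_in_def)

lemma topspace_edge_end_space: "topspace (edge_end_space V E) = edge_ends V E"
proof
  show "topspace (edge_end_space V E) \<subseteq> edge_ends V E"
    using openin_topspace openin_edge_end_space by blast
  have "fin_cut UNIV" unfolding edge_cut_def by simp
  thus "edge_ends V E \<subseteq> topspace (edge_end_space V E)"
    using openin_ends_in openin_subset ends_in_UNIV by metis
qed

end

section \<open>Rays and vertex partitions along nested connected sets\<close>

text \<open>From each vertex a shortest path inside the current set leads towards the next set.
  Taking always its next vertex gives a walk that makes progress in a strict order, hence never
  repeats a vertex, and that enters every set for good.\<close>

lemma ray_through_nested_connected_sets:
  assumes E: "\<And>e. e \<in> E \<Longrightarrow> card e = 2"
    and conn: "\<And>k. connected_in E (C k)" and ne: "\<And>k. C k \<noteq> {}"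
    and dec: "\<And>k. C (Suc k) \<subseteq> C k" and empty: "(\<Inter>k. C k) = {}"
  shows "\<exists>r\<in>graph_rays E. \<forall>k. has_tail r (C k)"
proof -
  have anti: "C j \<subseteq> C i" if "i \<le> j" for i j
    using dec that by (rule lift_Suc_antimono_le)
  \<comment> \<open>For \<open>v\<close> in \<open>C 0\<close> this is the last index whose set
    still contains \<open>v\<close>; it exists because the intersection is empty.\<close>
  define lev where "lev v = (LEAST k. v \<notin> C (Suc k))" for v
  have ex: "\<exists>k. v \<notin> C (Suc k)" for v using empty dec by blast
  have lev1: "v \<notin> C (Suc (lev v))" for v unfolding lev_def using ex by (rule LeastI_ex)
  have lev2: "v \<in> C (lev v)" if "v \<in> C 0" for v
  proof (cases "lev v")
    case (Suc k)
    hence "\<not> v \<notin> C (Suc k)" using not_less_Least[of k "\<lambda>k. v \<notin> C (Suc k)"] unfolding lev_def by simp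
    then show ?thesis using Suc by simp
  qed (use that in simp)
  have levI: "k \<le> lev v" if "v \<in> C k" for k v
    using lev1[of v] anti[of "Suc (lev v)" k] that by (meson not_less_eq_eq subsetD)
  define R where "R k = {(x, y). {x, y} \<in> E \<and> x \<in> C k \<and> y \<in> C k}" for k
  \<comment> \<open>The distance from \<open>v\<close> to the next set within \<open>C k\<close>; it
    is finite on \<open>C k\<close> because \<open>C k\<close> is connected
    (\<open>reach\<close>).\<close>
  define depth where "depth k v = (LEAST n. \<exists>w\<in>C (Suc k). (v, w) \<in> R k ^^ n)" for k v
  have reach: "\<exists>w\<in>C (Suc k). (v, w) \<in> (R k)\<^sup>*" if v: "v \<in> C k" for k v
  proof (rule ccontr)
    define B where "B = {v \<in> C k. \<exists>w\<in>C (Suc k). (v, w) \<in> (R k)\<^sup>*}"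
    assume "\<not> ?thesis"
    hence vB: "v \<notin> B" unfolding B_def by blast
    obtain w where w: "w \<in> C (Suc k)" using ne by blast
    hence "w \<in> B" "w \<in> C k" unfolding B_def using dec by blast+
    then obtain e where e: "e \<in> E" "e \<subseteq> C k" "e \<inter> B \<noteq> {}" "\<not> e \<subseteq> B"
      using connected_inD[OF conn, of w k B v] v vB by blast
    then obtain x y where xy: "x \<in> e" "x \<in> B" "y \<in> e" "y \<notin> B" by blast
    hence "e = {y, x}" using E[OF e(1)] by (auto simp: card_2_iff)
    hence yx: "(y, x) \<in> R k" using e xy unfolding R_def by auto
    obtain z where "z \<in> C (Suc k)" "(x, z) \<in> (R k)\<^sup>*" using xy(2) unfolding B_def by blast
    hence "y \<in> B" using yx e(2) xy(3) unfolding B_def by (auto intro: converse_rtrancl_into_rtrancl)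
    thus False using xy(4) by blast
  qed
  \<comment> \<open>Progress is lexicographic: a higher level, or the same level and a smaller
    distance to the next set. The neighbour chosen stays in \<open>C (lev v)\<close>, so the level
    never drops, and since distances are natural numbers it rises again and again.\<close>
  define prec where "prec v u \<longleftrightarrow> lev v < lev u \<or> (lev v = lev u \<and> depth (lev v) u < depth (lev v) v)" for v u
  have step: "\<exists>u. u \<in> C 0 \<and> {v, u} \<in> E \<and> prec v u" if v: "v \<in> C 0" for v
  proof -
    let ?k = "lev v"
    have "\<exists>n. \<exists>w\<in>C (Suc ?k). (v, w) \<in> R ?k ^^ n"
      using reach[OF lev2[OF v]] by (meson rtrancl_imp_relpow)
    hence "\<exists>w\<in>C (Suc ?k). (v, w) \<in> R ?k ^^ depth ?k v"
      unfolding depth_def by (rule LeastI_ex)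
    then obtain w where w: "w \<in> C (Suc ?k)" "(v, w) \<in> R ?k ^^ depth ?k v" by blast
    have "depth ?k v \<noteq> 0"
    proof
      assume "depth ?k v = 0"
      hence "v = w" using w(2) by simp
      thus False using w(1) lev1[of v] by simp
    qed
    then obtain n where n: "depth ?k v = Suc n" using not0_implies_Suc by blast
    then obtain u where u: "(v, u) \<in> R ?k" "(u, w) \<in> R ?k ^^ n"
      using w(2) by (metis relpow_Suc_D2)
    have uk: "u \<in> C ?k" "{v, u} \<in> E" using u unfolding R_def by auto
    have "depth ?k u \<le> n" unfolding depth_def by (rule Least_le) (use u w in blast)
    hence "prec v u" using levI[OF uk(1)] n unfolding prec_def by auto
    thus ?thesis using uk anti[of 0 ?k] by blast
  qed
  obtain nxt where nx: "\<And>v. v \<in> C 0 \<Longrightarrow> nxt v \<in> C 0 \<and> {v, nxt v} \<in> E \<and> prec v (nxt v)"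
    using step by metis
  obtain v0 where v0: "v0 \<in> C 0" using ne by blast
  define r where "r n = (nxt ^^ n) v0" for n
  have r0: "r n \<in> C 0" for n unfolding r_def by (induction n) (use v0 nx in auto)
  have rS: "r (Suc n) = nxt (r n)" for n unfolding r_def by simp
  have prec_trans: "prec a c" if "prec a b" "prec b c" for a b c
    using that unfolding prec_def by auto
  have prec_r: "prec (r i) (r j)" if "i < j" for i j
    using that
  proof (induction j)
    case (Suc j)
    have "prec (r j) (r (Suc j))" using nx r0 rS by simp
    then show ?case using Suc prec_trans by (metis less_SucE)
  qed simp
  have "r i \<noteq> r j" if "i < j" for i j using prec_r[OF that] unfolding prec_def by auto
  hence "inj r" by (metis injI linorder_neqE_nat)
  hence "r \<in> graph_rays E" unfolding graph_rays_def using nx r0 rS by simp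
  moreover have "has_tail r (C k)" for k
  proof -
    have up: "\<exists>m>n. lev (r n) < lev (r m)" for n
    proof (induction "depth (lev (r n)) (r n)" arbitrary: n rule: less_induct)
      case less
      show ?case
      proof (cases "lev (r n) < lev (r (Suc n))")
        case True
        then show ?thesis by blast
      next
        case False
        hence "lev (r n) = lev (r (Suc n))" "depth (lev (r n)) (r (Suc n)) < depth (lev (r n)) (r n)"
          using prec_r[of n "Suc n"] unfolding prec_def by auto
        thus ?thesis using less[of "Suc n"] Suc_lessD by metis
      qed
    qed
    have "\<exists>n. k \<le> lev (r n)"
    proof (induction k)
      case (Suc k)
      then show ?case using up by (meson Suc_leI le_trans order_le_less_trans)
    qed simp
    then obtain n where n: "k \<le> lev (r n)" by blast
    have "r j \<in> C k" if "n \<le> j" for j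
    proof -
      have "lev (r n) \<le> lev (r j)" using prec_r[of n j] that unfolding prec_def by (cases "n = j") auto
      thus ?thesis using lev2[OF r0] anti n by (meson le_trans subsetD)
    qed
    thus ?thesis unfolding has_tail_def by blast
  qed
  ultimately show ?thesis by blast
qed

context graph
begin

text \<open>The function is the distance from a root \<open>r0\<close>. It serves a counting
  argument: a vertex of least depth in a set, other than \<open>r0\<close>, has a neighbour of
  smaller depth outside the set and so accounts for a cut edge.\<close>

lemma component_distance:
  assumes K: "K \<in> graph_components V E"
  shows "\<exists>(depth :: 'v \<Rightarrow> nat) r0. \<forall>v\<in>K. v \<noteq> r0 \<longrightarrow> (\<exists>u. {u, v} \<in> E \<and> depth u < depth v)"
proof -
  let ?R = "{(x, y). {x, y} \<in> E}"
  obtain r0 where r0: "K = {w. (r0, w) \<in> ?R\<^sup>*}" using K unfolding graph_components_def by blast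
  define depth where "depth v = (LEAST n. (r0, v) \<in> ?R ^^ n)" for v
  have "\<exists>u. {u, v} \<in> E \<and> depth u < depth v" if v: "v \<in> K" "v \<noteq> r0" for v
  proof -
    have "\<exists>n. (r0, v) \<in> ?R ^^ n" using v r0 by (simp add: rtrancl_power)
    hence d: "(r0, v) \<in> ?R ^^ depth v" unfolding depth_def by (rule LeastI_ex)
    hence "depth v \<noteq> 0" using v by (intro notI) simp
    then obtain n where n: "depth v = Suc n" using not0_implies_Suc by blast
    then obtain u where u: "(r0, u) \<in> ?R ^^ n" "(u, v) \<in> ?R" using d by auto
    have "depth u \<le> n" unfolding depth_def using u(1) by (rule Least_le)
    thus ?thesis using n u by auto
  qed
  thus ?thesis by blast
qed

definition pieceable :: "'v set \<Rightarrow> bool" where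
  "pieceable C \<longleftrightarrow> (\<exists>K\<in>graph_components V E. C \<subseteq> K) \<and> C \<noteq> {} \<and> connected_in E C \<and> fin_cut C"

lemma component_pieceable: "K \<in> graph_components V E \<Longrightarrow> pieceable K"
  using component_cases[of K "{}"] finite_subset unfolding pieceable_def by auto

text \<open>The removed vertex is one of least depth in \<open>C\<close>. The depth function is
  chosen once for each component, so the vertices removed from nested sets are measured from the
  same root.\<close>

lemma pieceable_split:
  assumes C: "pieceable C"
    and depth: "depth = (\<lambda>K. SOME d :: 'v \<Rightarrow> nat. \<exists>r0. \<forall>v\<in>K. v \<noteq> r0 \<longrightarrow> (\<exists>u. {u, v} \<in> E \<and> d u < d v))"
  shows "\<exists>r \<D>. r \<in> C \<and> (\<forall>K\<in>graph_components V E. C \<subseteq> K \<longrightarrow> (\<forall>v\<in>C. depth K r \<le> depth K v)) \<and>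
    disjoint \<D> \<and> (\<forall>D\<in>\<D>. pieceable D \<and> D \<subseteq> C - {r}) \<and>
    (\<forall>B. B \<subseteq> C - {r} \<and> fin_cut B \<longrightarrow> (\<exists>\<F>\<subseteq>\<D>. finite \<F> \<and> B \<subseteq> \<Union>\<F>))"
proof -
  obtain K where K: "K \<in> graph_components V E" "C \<subseteq> K" using C unfolding pieceable_def by blast
  have C': "C \<noteq> {}" "fin_cut C" using C unfolding pieceable_def by blast+
  obtain r where r: "r \<in> C" "\<And>v. v \<in> C \<Longrightarrow> depth K r \<le> depth K v"
    using C' ex_has_least_nat[of "\<lambda>v. v \<in> C" _ "depth K"] by blast
  have K': "K' = K" if "K' \<in> graph_components V E" "C \<subseteq> K'" for K'
    using components_disjoint[of K' "{}" K r] that K r by auto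
  interpret cg: connected_graph E K
    using edge_card component_cases(2)[of K "{}"] K by unfold_locales auto
  obtain \<D> where \<D>: "disjoint \<D>"
    "\<And>D. D \<in> \<D> \<Longrightarrow> D \<noteq> {} \<and> D \<subseteq> C - {r} \<and> connected_in E D \<and> fin_cut D"
    "\<forall>B. B \<subseteq> C - {r} \<and> fin_cut B \<longrightarrow> (\<exists>\<F>\<subseteq>\<D>. finite \<F> \<and> B \<subseteq> \<Union>\<F>)"
    using cg.finite_cut_partition_off_vertex[OF K(2) C'(2) r(1)] by metis
  have "pieceable D \<and> D \<subseteq> C - {r}" if "D \<in> \<D>" for D
    using \<D>(2)[OF that] K unfolding pieceable_def by blast
  moreover have "\<forall>K\<in>graph_components V E. C \<subseteq> K \<longrightarrow> (\<forall>v\<in>C. depth K r \<le> depth K v)"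
    using K' r by blast
  ultimately show ?thesis using r(1) \<D>(1,3) by (intro exI[of _ r] exI[of _ \<D>]) simp
qed

theorem edge_end_space_piece_tree:
  assumes ne: "edge_ends V E \<noteq> {}"
  shows "\<exists>\<U>. piece_tree (edge_end_space V E) \<U>"
proof -
  define depth where "depth = (\<lambda>K. SOME d :: 'v \<Rightarrow> nat. \<exists>r0. \<forall>v\<in>K. v \<noteq> r0 \<longrightarrow> (\<exists>u. {u, v} \<in> E \<and> d u < d v))"
  have depth: "\<exists>r0. \<forall>v\<in>K. v \<noteq> r0 \<longrightarrow> (\<exists>u. {u, v} \<in> E \<and> depth K u < depth K v)"
    if "K \<in> graph_components V E" for K
    using someI_ex[OF component_distance[OF that]] unfolding depth_def .
  define split where "split C r \<D> \<longleftrightarrow>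
    r \<in> C \<and> (\<forall>K\<in>graph_components V E. C \<subseteq> K \<longrightarrow> (\<forall>v\<in>C. depth K r \<le> depth K v)) \<and>
    disjoint \<D> \<and> (\<forall>D\<in>\<D>. pieceable D \<and> D \<subseteq> C - {r}) \<and>
    (\<forall>B. B \<subseteq> C - {r} \<and> fin_cut B \<longrightarrow> (\<exists>\<F>\<subseteq>\<D>. finite \<F> \<and> B \<subseteq> \<Union>\<F>))" for C r \<D>
  have "\<exists>r \<D>. split C r \<D>" if "pieceable C" for C
    unfolding split_def by (rule pieceable_split[OF that depth_def])
  then obtain rt ch where sp: "\<And>C. pieceable C \<Longrightarrow> split C (rt C) (ch C)" by metis
  have rt: "\<And>C. pieceable C \<Longrightarrow> rt C \<in> C"
    "\<And>C K v. pieceable C \<Longrightarrow> K \<in> graph_components V E \<Longrightarrow> C \<subseteq> K \<Longrightarrow> v \<in> C \<Longrightarrow> depth K (rt C) \<le> depth K v"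
    using sp unfolding split_def by simp_all
  have ch: "disjoint (ch C)" "D \<in> ch C \<Longrightarrow> pieceable D \<and> D \<subseteq> C \<and> rt C \<notin> D"
    "B \<subseteq> C \<Longrightarrow> rt C \<notin> B \<Longrightarrow> fin_cut B \<Longrightarrow> \<exists>\<F>\<subseteq>ch C. finite \<F> \<and> B \<subseteq> \<Union>\<F>"
    if "pieceable C" for C D B
  proof -
    note C = sp[OF that, unfolded split_def]
    show "disjoint (ch C)" using C by (elim conjE)
    show "D \<in> ch C \<Longrightarrow> pieceable D \<and> D \<subseteq> C \<and> rt C \<notin> D" using C by blast
    have "\<forall>B. B \<subseteq> C - {rt C} \<and> fin_cut B \<longrightarrow> (\<exists>\<F>\<subseteq>ch C. finite \<F> \<and> B \<subseteq> \<Union>\<F>)" using C by (elim conjE)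
    thus "B \<subseteq> C \<Longrightarrow> rt C \<notin> B \<Longrightarrow> fin_cut B \<Longrightarrow> \<exists>\<F>\<subseteq>ch C. finite \<F> \<and> B \<subseteq> \<Union>\<F>"
      by (simp add: subset_Diff_insert)
  qed
  define \<V> where "\<V> = rec_nat (graph_components V E) (\<lambda>_ S. \<Union>(ch ` S))"
  have \<V>0: "\<V> 0 = graph_components V E" and \<V>S: "\<And>k. \<V> (Suc k) = \<Union>(ch ` \<V> k)"
    unfolding \<V>_def by simp_all
  have pc: "pieceable C" if "C \<in> \<V> k" for C k
    using that by (induction k arbitrary: C) (auto simp: \<V>0 \<V>S component_pieceable dest: ch(2))
  have finC: "fin_cut C" if "C \<in> \<V> k" for C k using pc[OF that] unfolding pieceable_def by blast
  have disjV: "C = D" if "C \<in> \<V> k" "D \<in> \<V> k" "x \<in> C" "x \<in> D" for C D x k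
    using that
  proof (induction k arbitrary: C D)
    case 0
    then show ?case using components_disjoint[of C "{}" D x] by (simp add: \<V>0)
  next
    case (Suc k)
    then obtain C' D' where CD: "C' \<in> \<V> k" "C \<in> ch C'" "D' \<in> \<V> k" "D \<in> ch D'" by (auto simp: \<V>S)
    hence "x \<in> C'" "x \<in> D'" using Suc.prems ch(2) pc by blast+
    hence "C' = D'" using Suc.IH CD by blast
    then show ?case using CD ch(1)[OF pc[OF CD(1)]] Suc.prems(3,4) disjointD by (metis disjoint_iff)
  qed
  have endsdisj: "C = D" if "C \<in> \<V> k" "D \<in> \<V> k" "\<epsilon> \<in> ends_in C" "\<epsilon> \<in> ends_in D" for C D k \<epsilon>
  proof (rule ccontr)
    assume "C \<noteq> D"
    hence "C \<inter> D = {}" using disjV that by blast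
    thus False using ends_in_disjoint finC that by blast
  qed
  \<comment> \<open>Level 0 has to be the whole space, so the components of the graph come at level
    1. Vertex sets that contain no end are dropped, as pieces are nonempty.\<close>
  define \<U> where "\<U> k = (case k of 0 \<Rightarrow> {edge_ends V E} | Suc j \<Rightarrow> ends_in ` \<V> j - {{}})" for k
  have \<U>0: "\<U> 0 = {edge_ends V E}" and \<U>S: "\<And>k. \<U> (Suc k) = ends_in ` \<V> k - {{}}"
    unfolding \<U>_def by simp_all
  have sub_ends: "ends_in C \<subseteq> edge_ends V E" for C unfolding ends_in_def by blast
  have "\<U> 0 = {topspace (edge_end_space V E)}" by (simp add: \<U>0 topspace_edge_end_space)
  moreover have "disjoint (\<U> k)" for k
  proof (cases k)
    case 0
    then show ?thesis by (simp add: \<U>0)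
  next
    case (Suc j)
    show ?thesis unfolding Suc \<U>S
      by (rule disjointI) (use endsdisj in blast)
  qed
  moreover have "U \<noteq> {} \<and> openin (edge_end_space V E) U" if "U \<in> \<U> k" for U k
  proof (cases k)
    case 0
    then show ?thesis using that ne topspace_edge_end_space openin_topspace by (metis \<U>0 singletonD)
  next
    case (Suc j)
    then show ?thesis using that openin_ends_in finC by (auto simp: \<U>S)
  qed
  moreover have "\<exists>U\<in>\<U> k. W \<subseteq> U" if W: "W \<in> \<U> (Suc k)" for W k
  proof (cases k)
    case 0
    then show ?thesis using W sub_ends by (auto simp: \<U>S \<U>0)
  next
    case (Suc j)
    then obtain C D where CD: "C \<in> \<V> j" "D \<in> ch C" "W = ends_in D" "W \<noteq> {}"
      using W by (auto simp: \<U>S \<V>S)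
    hence "W \<subseteq> ends_in C" using ch(2) pc ends_in_mono by blast
    thus ?thesis using CD Suc by (intro bexI[of _ "ends_in C"]) (auto simp: \<U>S)
  qed
  moreover have "\<Union>(subpieces \<U> k U) = U \<or> (\<exists>x. limit_piece (edge_end_space V E) U (subpieces \<U> k U) x)"
    if U: "U \<in> \<U> k" for k U
  proof (cases k)
    case 0
    have "\<epsilon> \<in> \<Union>(subpieces \<U> k U)" if \<epsilon>: "\<epsilon> \<in> U" for \<epsilon>
    proof -
      have \<epsilon>': "\<epsilon> \<in> edge_ends V E" using \<epsilon> U 0 by (simp add: \<U>0)
      then obtain r where r: "r \<in> \<epsilon>" "r \<in> graph_rays E" using end_ray by blast
      then obtain C where "C \<in> \<V> 0" "has_tail r C"
        using ray_component[of r "{}"] by (auto simp: \<V>0)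
      hence "\<epsilon> \<in> ends_in C" "ends_in C \<in> \<U> (Suc k)" using r \<epsilon>' 0 by (auto simp: \<U>S ends_in_def)
      thus ?thesis using U 0 sub_ends unfolding subpieces_def by (auto simp: \<U>0)
    qed
    then show ?thesis unfolding subpieces_def by blast
  next
    case (Suc j)
    then obtain C where C: "C \<in> \<V> j" "U = ends_in C" "U \<noteq> {}" using U by (auto simp: \<U>S)
    note pC = pc[OF C(1)]
    have sp: "subpieces \<U> k U = ends_in ` ch C - {{}}"
    proof
      show "ends_in ` ch C - {{}} \<subseteq> subpieces \<U> k U"
        using C ch(2)[OF pC] ends_in_mono unfolding subpieces_def Suc by (auto simp: \<U>S \<V>S)
      show "subpieces \<U> k U \<subseteq> ends_in ` ch C - {{}}"
      proof
        fix W assume "W \<in> subpieces \<U> k U"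
        then obtain C' D where CD: "C' \<in> \<V> j" "D \<in> ch C'" "W = ends_in D" "W \<noteq> {}" "W \<subseteq> U"
          unfolding subpieces_def Suc by (auto simp: \<U>S \<V>S)
        have "D \<subseteq> C'" using ch(2)[OF pc[OF CD(1)] CD(2)] by blast
        hence "W \<subseteq> ends_in C'" using ends_in_mono CD(3) by simp
        with CD have "C' = C" using endsdisj[OF CD(1) C(1)] C(2) by blast
        thus "W \<in> ends_in ` ch C - {{}}" using CD by blast
      qed
    qed
    show ?thesis
    proof (cases "\<Union>(subpieces \<U> k U) = U")
      case False
      have subU: "\<Union>(subpieces \<U> k U) \<subseteq> U" unfolding subpieces_def by blast
      then obtain \<epsilon> where \<epsilon>: "\<epsilon> \<in> U" "\<epsilon> \<notin> \<Union>(subpieces \<U> k U)" using False by blast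
      have nD: "\<eta> \<notin> ends_in D" if "\<eta> \<notin> \<Union>(subpieces \<U> k U)" "D \<in> ch C" for \<eta> D using that sp by blast
      \<comment> \<open>A set \<open>S\<close> with a finite cut around a left-over end contains
        \<open>rt C\<close>: otherwise \<open>C \<inter> S\<close> would be covered by finitely many
        children, and one of them would contain the end. Hence \<open>C - S\<close> avoids
        \<open>rt C\<close> and is covered by finitely many children; what they leave of
        \<open>U\<close> lies in \<open>ends_in S\<close>. This gives both the uniqueness of the
        left-over end and its local basis.\<close>
      have key: "\<exists>\<F>. finite \<F> \<and> \<F> \<subseteq> subpieces \<U> k U \<and> U - \<Union>\<F> \<subseteq> ends_in S"
        if S: "fin_cut S" "\<epsilon>' \<in> ends_in S" and \<epsilon>': "\<epsilon>' \<in> U" "\<epsilon>' \<notin> \<Union>(subpieces \<U> k U)" for S \<epsilon>'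
      proof -
        have finS: "fin_cut (C \<inter> S)" "fin_cut (C - S)"
          using S finC[OF C(1)] finite_edge_cut_Int finite_edge_cut_Diff by blast+
        have finD: "fin_cut D" if "D \<in> ch C" for D using ch(2)[OF pC that] unfolding pieceable_def by blast
        have "rt C \<in> S"
        proof (rule ccontr)
          assume "rt C \<notin> S"
        hence "\<exists>\<F>\<subseteq>ch C. finite \<F> \<and> C \<inter> S \<subseteq> \<Union>\<F>"
          by (intro ch(3)[OF pC] finS) auto
        then obtain \<F> where \<F>: "\<F> \<subseteq> ch C" "finite \<F>" "C \<inter> S \<subseteq> \<Union>\<F>" by (elim exE conjE)
          have "\<epsilon>' \<in> ends_in (C \<inter> S)" using ends_in_Int[OF finC[OF C(1)] S(1)] S(2) \<epsilon>' C by blast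
          hence "\<epsilon>' \<in> ends_in (\<Union>\<F>)" using ends_in_mono \<F>(3) by blast
          thus False using ends_in_Union[OF \<F>(2), of \<epsilon>'] \<F>(1) finD nD[OF \<epsilon>'(2)] by blast
        qed
        hence "\<exists>\<F>\<subseteq>ch C. finite \<F> \<and> C - S \<subseteq> \<Union>\<F>"
          by (intro ch(3)[OF pC] finS) auto
        then obtain \<F> where \<F>: "\<F> \<subseteq> ch C" "finite \<F>" "C - S \<subseteq> \<Union>\<F>" by (elim exE conjE)
        have "\<eta> \<in> ends_in S" if \<eta>: "\<eta> \<in> U" "\<eta> \<notin> \<Union>(ends_in ` \<F> - {{}})" for \<eta>
        proof (rule ccontr)
          assume "\<eta> \<notin> ends_in S"
          hence "\<eta> \<in> ends_in (- S)" using ends_in_Compl[OF S(1)] \<eta> C sub_ends by blast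
          moreover have "\<eta> \<in> ends_in C" using \<eta> C(2) by blast
          moreover have "fin_cut (- S)" unfolding edge_cut_Compl by (rule S(1))
          note ends_in_Int[OF finC[OF C(1)] this]
          ultimately have "\<eta> \<in> ends_in (C \<inter> - S)" by (metis IntI)
          moreover have "ends_in (C \<inter> - S) \<subseteq> ends_in (\<Union>\<F>)" using \<F>(3) by (intro ends_in_mono) blast
          ultimately have "\<eta> \<in> ends_in (\<Union>\<F>)" by blast
          then obtain D where "D \<in> \<F>" "\<eta> \<in> ends_in D" using ends_in_Union[OF \<F>(2), of \<eta>] \<F>(1) finD by blast
          thus False using \<eta> by blast
        qed
        moreover have "finite (ends_in ` \<F> - {{}})" "ends_in ` \<F> - {{}} \<subseteq> subpieces \<U> k U"
          using \<F> sp by auto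
        ultimately show ?thesis by (intro exI[of _ "ends_in ` \<F> - {{}}"]) blast
      qed
      have "\<eta> = \<epsilon>" if \<eta>: "\<eta> \<in> U" "\<eta> \<notin> \<Union>(subpieces \<U> k U)" for \<eta>
      proof -
        have "\<epsilon> = \<eta>"
        proof (rule ends_eq)
          show "\<epsilon> \<in> edge_ends V E" "\<eta> \<in> edge_ends V E" using \<eta>(1) \<epsilon>(1) C(2) sub_ends by blast+
          fix S assume "fin_cut S" "\<epsilon> \<in> ends_in S"
          then obtain \<F> where "\<F> \<subseteq> subpieces \<U> k U" "U - \<Union>\<F> \<subseteq> ends_in S" using key[OF _ _ \<epsilon>] by meson
          thus "\<eta> \<in> ends_in S" using \<eta> by blast
        qed
        thus ?thesis by simp
      qed
      hence "U = insert \<epsilon> (\<Union>(subpieces \<U> k U))" using \<epsilon> subU by blast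
      moreover have "local_basis_at (edge_end_space V E) \<epsilon> {U - \<Union>\<F> | \<F>. finite \<F> \<and> \<F> \<subseteq> subpieces \<U> k U}"
        unfolding local_basis_at_def
      proof (intro conjI ballI allI impI)
        fix W assume "W \<in> {U - \<Union>\<F> | \<F>. finite \<F> \<and> \<F> \<subseteq> subpieces \<U> k U}"
        then obtain \<F> where \<F>: "finite \<F>" "\<F> \<subseteq> subpieces \<U> k U" "W = U - \<Union>\<F>" by blast
        show "\<epsilon> \<in> W" using \<epsilon> \<F> by blast
        have "\<forall>W\<in>\<F>. \<exists>D\<in>ch C. W = ends_in D" using \<F>(2) sp by blast
        then obtain d where d: "\<And>W. W \<in> \<F> \<Longrightarrow> d W \<in> ch C \<and> W = ends_in (d W)" by metis
        have fd: "fin_cut (d W)" if "W \<in> \<F>" for W using d[OF that] ch(2)[OF pC] unfolding pieceable_def by blast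
        have fin: "fin_cut (C - \<Union>(d ` \<F>))"
          using finC[OF C(1)] fd \<F>(1) by (intro finite_edge_cut_Diff finite_edge_cut_Union) auto
        have "W = ends_in (C - \<Union>(d ` \<F>))"
        proof
          show "ends_in (C - \<Union>(d ` \<F>)) \<subseteq> W"
          proof
            fix \<eta> assume \<eta>: "\<eta> \<in> ends_in (C - \<Union>(d ` \<F>))"
            have "\<eta> \<notin> W'" if "W' \<in> \<F>" for W'
            proof -
              have "(C - \<Union>(d ` \<F>)) \<inter> d W' = {}" using that by blast
              thus ?thesis using ends_in_disjoint[OF fin fd[OF that]] \<eta> d[OF that] by blast
            qed
            moreover have "\<eta> \<in> U" using \<eta> C ends_in_mono[of "C - \<Union>(d ` \<F>)" C] by blast
            ultimately show "\<eta> \<in> W" using \<F>(3) by blast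
          qed
          show "W \<subseteq> ends_in (C - \<Union>(d ` \<F>))"
          proof
            fix \<eta> assume \<eta>: "\<eta> \<in> W"
            show "\<eta> \<in> ends_in (C - \<Union>(d ` \<F>))"
            proof (rule ccontr)
              assume "\<eta> \<notin> ends_in (C - \<Union>(d ` \<F>))"
              hence "\<eta> \<in> ends_in (- (C - \<Union>(d ` \<F>)))"
                using ends_in_Compl[OF fin] \<eta> \<F> C sub_ends by blast
              moreover have "\<eta> \<in> ends_in C" using \<eta> C(2) \<F>(3) by blast
              moreover have "fin_cut (- (C - \<Union>(d ` \<F>)))" unfolding edge_cut_Compl by (rule fin)
              note ends_in_Int[OF finC[OF C(1)] this]
              ultimately have "\<eta> \<in> ends_in (C \<inter> - (C - \<Union>(d ` \<F>)))" by (metis IntI)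
              moreover have "ends_in (C \<inter> - (C - \<Union>(d ` \<F>))) \<subseteq> ends_in (\<Union>(d ` \<F>))"
                by (intro ends_in_mono) blast
              ultimately have "\<eta> \<in> ends_in (\<Union>(d ` \<F>))" by blast
              then obtain D where "D \<in> d ` \<F>" "\<eta> \<in> ends_in D"
                using ends_in_Union[of "d ` \<F>" \<eta>] \<F>(1) fd by blast
              thus False using d \<eta> \<F>(3) by blast
            qed
          qed
        qed
        thus "openin (edge_end_space V E) W" using fin openin_ends_in by blast
      next
        fix W assume W: "openin (edge_end_space V E) W \<and> \<epsilon> \<in> W"
        then obtain S where S: "fin_cut S" "\<epsilon> \<in> ends_in S" "ends_in S \<subseteq> W"
          using openin_edge_end_space by metis
        then obtain \<F> where "finite \<F>" "\<F> \<subseteq> subpieces \<U> k U" "U - \<Union>\<F> \<subseteq> ends_in S"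
          using key[OF _ _ \<epsilon>] by meson
        thus "\<exists>V\<in>{U - \<Union>\<F> | \<F>. finite \<F> \<and> \<F> \<subseteq> subpieces \<U> k U}. V \<subseteq> W"
          using S(3) by (intro bexI[of _ "U - \<Union>\<F>"]) blast+
      qed
      ultimately have "limit_piece (edge_end_space V E) U (subpieces \<U> k U) \<epsilon>"
        unfolding limit_piece_def by (intro conjI \<epsilon>(2))
      thus ?thesis by blast
    qed blast
  qed
  moreover have "\<exists>x. \<Inter>(range f) = {x} \<and> local_basis_at (edge_end_space V E) x (range f)"
    if f: "\<forall>k. f k \<in> \<U> k \<and> f (Suc k) \<subseteq> f k" for f
  proof -
    have "\<exists>C. C \<in> \<V> k \<and> f (Suc k) = ends_in C \<and> f (Suc k) \<noteq> {}" for k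
      using f[rule_format, of "Suc k"] unfolding \<U>S by blast
    then obtain C where C: "\<And>k. C k \<in> \<V> k" "\<And>k. f (Suc k) = ends_in (C k)" "\<And>k. f (Suc k) \<noteq> {}" by metis
    have Cch: "C (Suc k) \<in> ch (C k)" for k
    proof -
      obtain C' where C': "C' \<in> \<V> k" "C (Suc k) \<in> ch C'" using C(1)[of "Suc k"] by (auto simp: \<V>S)
      obtain \<epsilon> where \<epsilon>: "\<epsilon> \<in> f (Suc (Suc k))" using C(3) by blast
      have "\<epsilon> \<in> ends_in (C k)" using \<epsilon> f[rule_format, of "Suc k"] C(2)[of k] by blast
      moreover have "\<epsilon> \<in> ends_in C'"
        using \<epsilon> C(2)[of "Suc k"] ends_in_mono[of "C (Suc k)" C'] ch(2)[OF pc[OF C'(1)] C'(2)] by blast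
      ultimately have "C k = C'" using endsdisj[OF C(1) C'(1)] by blast
      thus ?thesis using C'(2) by simp
    qed
    note pC = pc[OF C(1)]
    have dec: "C (Suc k) \<subseteq> C k" and rtC: "rt (C k) \<notin> C (Suc k)" for k using ch(2)[OF pC Cch] by blast+
    have anti: "C j \<subseteq> C i" if "i \<le> j" for i j
      using dec that by (rule lift_Suc_antimono_le)
    define K where "K = C 0"
    have K: "K \<in> graph_components V E" "\<And>k. C k \<subseteq> K" using C(1)[of 0] anti by (simp_all add: K_def \<V>0)
    \<comment> \<open>A common vertex bounds the depths of the vertices \<open>rt (C k)\<close>.
      These depths do not decrease along the branch, so they are constant from some \<open>m\<close>
      on. The vertices are distinct, and their neighbours of smaller depth lie outside
      \<open>C m\<close>, which gives \<open>C m\<close> an infinite cut.\<close>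
    have empty: "(\<Inter>k. C k) = {}"
    proof (rule ccontr)
      assume "\<not> ?thesis"
      then obtain v where v: "\<And>k. v \<in> C k" by blast
      let ?d = "\<lambda>k. depth K (rt (C k))"
      have mono: "mono ?d"
        using rt(2)[OF pC K(1) K(2)] rt(1)[OF pC] dec by (simp add: mono_iff_le_Suc subset_iff)
      have bound: "?d k \<le> depth K v" for k using rt(2)[OF pC K(1) K(2) v] .
      obtain m where m: "\<And>k. ?d k \<le> ?d m"
      proof -
        have "finite (range ?d)" using bound finite_subset[of "range ?d" "{..depth K v}"] by auto
        hence "Max (range ?d) \<in> range ?d" by (intro Max_in) auto
        then obtain m where "?d m = Max (range ?d)" by auto
        thus ?thesis using that[of m] \<open>finite (range ?d)\<close> by simp
      qed
      have const: "?d k = ?d m" if "m \<le> k" for k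
        using monoD[OF mono that] m[of k] by simp
      obtain r0 where r0: "\<And>v. v \<in> K \<Longrightarrow> v \<noteq> r0 \<Longrightarrow> \<exists>u. {u, v} \<in> E \<and> depth K u < depth K v"
        using depth[OF K(1)] by blast
      have rt_inj: "rt (C i) \<noteq> rt (C j)" if "i < j" for i j
        using rtC[of i] rt(1)[OF pC, of j] anti[of "Suc i" j] that by (auto simp: Suc_le_eq)
      have rt_inj': "inj (\<lambda>k. rt (C k))" using rt_inj by (metis injI linorder_neqE_nat)
      \<comment> \<open>The root \<open>r0\<close> is set aside because no neighbour of smaller
        depth is available for it. It is removed at most once along the branch.\<close>
      let ?A = "{k. m \<le> k \<and> rt (C k) \<noteq> r0}"
      have "\<exists>u. {u, rt (C k)} \<in> edge_cut E (C m) \<and> u \<notin> C m" if k: "k \<in> ?A" for k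
      proof -
        have "rt (C k) \<in> C m" using rt(1)[OF pC, of k] anti[of m k] k by blast
        moreover obtain u where u: "{u, rt (C k)} \<in> E" "depth K u < depth K (rt (C k))"
          using r0[of "rt (C k)"] k K(2)[of k] rt(1)[OF pC, of k] by blast
        moreover have "u \<notin> C m" using rt(2)[OF pC[of m] K(1) K(2), of u] u(2) const[of k] k by force
        ultimately show ?thesis unfolding edge_cut_def by blast
      qed
      then obtain u where u: "\<And>k. k \<in> ?A \<Longrightarrow> {u k, rt (C k)} \<in> edge_cut E (C m) \<and> u k \<notin> C m" by metis
      have "inj_on (\<lambda>k. {u k, rt (C k)}) ?A"
      proof (rule inj_onI)
        fix i j assume ij: "i \<in> ?A" "j \<in> ?A" "{u i, rt (C i)} = {u j, rt (C j)}"
        have "rt (C i) \<in> C m" using rt(1)[OF pC, of i] anti[of m i] ij by blast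
        hence "rt (C i) = rt (C j)" using ij u[of j] by (auto simp: doubleton_eq_iff)
        thus "i = j" using rt_inj' by (meson injD)
      qed
      moreover have "(\<lambda>k. {u k, rt (C k)}) ` ?A \<subseteq> edge_cut E (C m)" using u by blast
      ultimately have "finite ?A" using finC[OF C(1)[of m]] finite_imageD finite_subset by meson
      moreover have "finite {k. rt (C k) = r0}"
        using rt_inj' finite_vimageI[of "{r0}" "\<lambda>k. rt (C k)"] by (simp add: vimage_def)
      moreover have "{m..} \<subseteq> ?A \<union> {k. rt (C k) = r0}" by auto
      ultimately have "finite {m..}" by (meson finite_UnI finite_subset)
      thus False by (simp add: infinite_Ici)
    qed
    have conn: "connected_in E (C k)" "C k \<noteq> {}" for k using pC[of k] unfolding pieceable_def by blast+
    obtain r where r: "r \<in> graph_rays E" "\<And>k. has_tail r (C k)"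
      using ray_through_nested_connected_sets[OF edge_card conn dec empty] by blast
    obtain \<epsilon> where \<epsilon>: "\<epsilon> \<in> edge_ends V E" "r \<in> \<epsilon>" using end_of_ray r by blast
    have in_C: "\<epsilon> \<in> ends_in (C k)" for k using \<epsilon> r unfolding ends_in_def by blast
    \<comment> \<open>The sets \<open>C k\<close> have no common vertex, so one of them avoids the
      finitely many endvertices of the cut of \<open>S\<close>. Being connected and meeting
      \<open>S\<close>, it lies inside \<open>S\<close>.\<close>
    have small: "\<exists>k. C k \<subseteq> S" if S: "fin_cut S" "\<eta> \<in> ends_in S" "\<And>k. \<eta> \<in> ends_in (C k)" for S \<eta>
    proof -
      have "finite (\<Union>(edge_cut E S))"
        using S(1) edge_card by (intro finite_Union) (auto simp: edge_cut_def card_2_iff)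
      moreover have "\<exists>k. C k \<inter> Y = {}" if "finite Y" for Y
        using that
      proof (induction Y rule: finite_induct)
        case (insert y Y)
        then obtain k where "C k \<inter> Y = {}" by blast
        moreover obtain j where "y \<notin> C j" using empty by blast
        ultimately have "C (max j k) \<inter> insert y Y = {}" using anti[of k "max j k"] anti[of j "max j k"] by auto
        thus ?case by blast
      qed simp
      ultimately obtain k where k: "C k \<inter> \<Union>(edge_cut E S) = {}" by blast
      have "C k \<inter> S \<noteq> {}" using ends_in_disjoint[OF finC[OF C(1)] S(1)] S by blast
      hence "C k \<subseteq> S"
        using conn(1)[of k] k unfolding connected_in_def edge_cut_def by blast
      thus ?thesis by blast
    qed
    have fC: "\<epsilon> \<in> f k" for k
      using in_C C(2) f \<epsilon>(1) \<U>0 by (cases k) auto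
    have "\<eta> = \<epsilon>" if \<eta>: "\<eta> \<in> \<Inter>(range f)" for \<eta>
    proof -
      have "\<eta> \<in> ends_in (C k)" for k using \<eta> C(2)[of k] by blast
      hence "\<And>S. fin_cut S \<Longrightarrow> \<epsilon> \<in> ends_in S \<Longrightarrow> \<eta> \<in> ends_in S"
        using small in_C ends_in_mono by blast
      moreover have "\<eta> \<in> edge_ends V E" using \<eta> f \<U>0 by blast
      ultimately show ?thesis using ends_eq \<epsilon>(1) by metis
    qed
    hence "\<Inter>(range f) = {\<epsilon>}" using fC by blast
    moreover have "local_basis_at (edge_end_space V E) \<epsilon> (range f)"
      unfolding local_basis_at_def
    proof (intro conjI ballI allI impI)
      fix W assume "W \<in> range f"
      then obtain k where k: "W = f k" by blast
      show "\<epsilon> \<in> W" using fC k by blast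
      show "openin (edge_end_space V E) W"
      proof (cases k)
        case 0
        then show ?thesis using k f \<U>0 topspace_edge_end_space openin_topspace by (metis singletonD)
      next
        case (Suc j)
        then show ?thesis using k C(2) finC[OF C(1)] openin_ends_in by simp
      qed
    next
      fix W assume "openin (edge_end_space V E) W \<and> \<epsilon> \<in> W"
      then obtain S where S: "fin_cut S" "\<epsilon> \<in> ends_in S" "ends_in S \<subseteq> W"
        using openin_edge_end_space by metis
      then obtain k where "C k \<subseteq> S" using small in_C by blast
      hence "f (Suc k) \<subseteq> W" using C(2) ends_in_mono S(3) by blast
      thus "\<exists>V\<in>range f. V \<subseteq> W" by blast
    qed
    ultimately show ?thesis by blast
  qed
  ultimately show ?thesis unfolding piece_tree_def by (intro exI[of _ \<U>]) simp
qed

end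

theorem graph_imp_piece_tree:
  assumes "is_graph V E" and "X homeomorphic_space edge_end_space V E" and "topspace X \<noteq> {}"
  shows "\<exists>\<U>. piece_tree X \<U>"
proof -
  interpret graph V E using assms(1) by unfold_locales
  obtain f where f: "homeomorphic_map (edge_end_space V E) X f"
    using assms(2) homeomorphic_space homeomorphic_space_sym by metis
  have "edge_ends V E \<noteq> {}"
    using homeomorphic_imp_surjective_map[OF f] assms(3)
    unfolding topspace_edge_end_space by (metis image_empty)
  thus ?thesis using edge_end_space_piece_tree piece_tree_homeomorphic_image[OF f] by blast
qed

section \<open>The graph of a tree of pieces and its finite cuts\<close>

section \<open>From trees of pieces to graphs\<close>

lemma local_basis_atD:
  assumes "local_basis_at X x B"
  shows "V \<in> B \<Longrightarrow> openin X V" "V \<in> B \<Longrightarrow> x \<in> V"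
    and "openin X W \<Longrightarrow> x \<in> W \<Longrightarrow> \<exists>V\<in>B. V \<subseteq> W"
  using assms by (auto simp: local_basis_at_def)

lemma limit_pieceD:
  assumes "limit_piece X U \<P> x"
  shows "x \<in> U" "x \<notin> \<Union>\<P>" "y \<in> U \<Longrightarrow> y \<notin> \<Union>\<P> \<Longrightarrow> y = x"
    and "local_basis_at X x {U - \<Union>\<F> | \<F>. finite \<F> \<and> \<F> \<subseteq> \<P>}"
  using assms by (auto simp: limit_piece_def)

locale tree_of_pieces =
  fixes X :: "'a topology" and \<U> :: "nat \<Rightarrow> 'a set set"
  assumes tree: "piece_tree X \<U>"
begin

lemmas level0 = piece_treeD(1)[OF tree]
  and level_disjoint = piece_treeD(2)[OF tree]
  and piece_open = piece_treeD(3)[OF tree]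
  and parent = piece_treeD(4)[OF tree]
  and piece_cases = piece_treeD(5)[OF tree]
  and branch_point = piece_treeD(6)[OF tree]

lemma piece_unique: "U \<in> \<U> k \<Longrightarrow> W \<in> \<U> k \<Longrightarrow> x \<in> U \<Longrightarrow> x \<in> W \<Longrightarrow> U = W"
  using level_disjoint[of k] disjointD by (metis disjoint_iff)

lemma piece_sub_topspace: "U \<in> \<U> k \<Longrightarrow> U \<subseteq> topspace X"
  using piece_open openin_subset by blast

lemma ancestor:
  assumes "W \<in> \<U> j" "k \<le> j"
  shows "\<exists>U\<in>\<U> k. W \<subseteq> U"
  using assms(2,1)
proof (induction j arbitrary: W rule: dec_induct)
  case (step j)
  then obtain P where "P \<in> \<U> j" "W \<subseteq> P" using parent[OF step.prems] by blast
  then show ?case using step.IH[of P] by blast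
qed blast

lemma nested:
  assumes "U \<in> \<U> k" "W \<in> \<U> j" "k \<le> j" "x \<in> U" "x \<in> W"
  shows "W \<subseteq> U"
  using ancestor[OF assms(2,3)] piece_unique assms by blast

text \<open>Stated without the limit point, so that it makes sense for any set. A piece without
  subpieces counts as a limit piece, too.\<close>

definition is_limit :: "nat \<Rightarrow> 'a set \<Rightarrow> bool" where
  "is_limit k U \<longleftrightarrow> \<Union>(subpieces \<U> k U) \<noteq> U"

text \<open>Vertices have to come from \<open>'a \<times> nat\<close>, so a piece is represented by
  one of its points. The level \<open>k\<close> in the second component separates pieces that share
  a point, because pieces of the same level are disjoint; \<open>i\<close> numbers the
  copies.\<close>

definition node_vertex :: "nat \<Rightarrow> 'a set \<Rightarrow> nat \<Rightarrow> 'a \<times> nat" where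
  "node_vertex k U i = ((SOME x. x \<in> U), prod_encode (k, i))"

lemma node_vertex_inject:
  assumes "U \<in> \<U> k" "W \<in> \<U> j" "node_vertex k U i = node_vertex j W l"
  shows "k = j \<and> U = W \<and> i = l"
proof -
  have kj: "k = j" "i = l" using assms(3) by (auto simp: node_vertex_def)
  have "(SOME x. x \<in> U) \<in> U" "(SOME x. x \<in> W) \<in> W"
    using piece_open[OF assms(1)] piece_open[OF assms(2)] by (simp_all add: some_in_eq)
  moreover have "(SOME x. x \<in> U) = (SOME x. x \<in> W)" using assms(3) by (simp add: node_vertex_def)
  ultimately show ?thesis using kj piece_unique assms(1,2) by metis
qed

text \<open>A limit piece carries a complete graph on infinitely many vertices.\<close>

definition below :: "nat \<Rightarrow> 'a set \<Rightarrow> ('a \<times> nat) set" where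
  "below k U = {node_vertex j W i | j W i. k \<le> j \<and> W \<in> \<U> j \<and> W \<subseteq> U \<and> (i = 0 \<or> is_limit j W)}"

definition verts :: "('a \<times> nat) set" where
  "verts = below 0 (topspace X)"

definition inner_edges :: "('a \<times> nat) set set" where
  "inner_edges = {{node_vertex k U i, node_vertex k U j} | k U i j. U \<in> \<U> k \<and> is_limit k U \<and> i \<noteq> j}"

definition bridges :: "('a \<times> nat) set set" where
  "bridges = {{node_vertex k U 0, node_vertex (Suc k) W 0} | k U W. U \<in> \<U> k \<and> W \<in> subpieces \<U> k U}"

abbreviation edges :: "('a \<times> nat) set set" where
  "edges \<equiv> inner_edges \<union> bridges"

lemma node_in_below:
  assumes "U \<in> \<U> k" "W \<in> \<U> j"
  shows "node_vertex j W i \<in> below k U \<longleftrightarrow> k \<le> j \<and> W \<subseteq> U \<and> (i = 0 \<or> is_limit j W)"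
proof
  assume "node_vertex j W i \<in> below k U"
  then obtain j' W' i' where *: "node_vertex j W i = node_vertex j' W' i'"
    "k \<le> j'" "W' \<in> \<U> j'" "W' \<subseteq> U" "i' = 0 \<or> is_limit j' W'" unfolding below_def by blast
  thus "k \<le> j \<and> W \<subseteq> U \<and> (i = 0 \<or> is_limit j W)"
    using node_vertex_inject[OF assms(2) *(3,1)] by simp
next
  assume "k \<le> j \<and> W \<subseteq> U \<and> (i = 0 \<or> is_limit j W)"
  thus "node_vertex j W i \<in> below k U" using assms(2) unfolding below_def by blast
qed

lemma belowE:
  assumes "v \<in> below k U"
  obtains j W i where "v = node_vertex j W i" "k \<le> j" "W \<in> \<U> j" "W \<subseteq> U" "i = 0 \<or> is_limit j W"
  using assms unfolding below_def by blast

lemma edgeE: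
  assumes "e \<in> edges"
  obtains (inner) k U i j where "e = {node_vertex k U i, node_vertex k U j}" "U \<in> \<U> k" "is_limit k U" "i \<noteq> j"
  | (bridge) k U W where "e = {node_vertex k U 0, node_vertex (Suc k) W 0}" "U \<in> \<U> k" "W \<in> \<U> (Suc k)" "W \<subseteq> U"
  using assms unfolding inner_edges_def bridges_def subpieces_def by blast

lemma inner_edgeI: "U \<in> \<U> k \<Longrightarrow> is_limit k U \<Longrightarrow> i \<noteq> j \<Longrightarrow> {node_vertex k U i, node_vertex k U j} \<in> edges"
  unfolding inner_edges_def by blast

lemma bridgeI: "U \<in> \<U> k \<Longrightarrow> W \<in> \<U> (Suc k) \<Longrightarrow> W \<subseteq> U \<Longrightarrow> {node_vertex k U 0, node_vertex (Suc k) W 0} \<in> edges"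
  unfolding bridges_def subpieces_def by blast

lemma node_vertex_in_verts: "U \<in> \<U> k \<Longrightarrow> i = 0 \<or> is_limit k U \<Longrightarrow> node_vertex k U i \<in> verts"
  unfolding verts_def below_def using piece_sub_topspace by blast

lemma is_graph_pieces: "is_graph verts edges"
  unfolding is_graph_def
proof
  fix e assume "e \<in> edges"
  thus "e \<subseteq> verts \<and> card e = 2"
  proof (cases rule: edgeE)
    case (inner k U i j)
    then have "node_vertex k U i \<noteq> node_vertex k U j" using node_vertex_inject by blast
    then show ?thesis using inner node_vertex_in_verts by simp
  next
    case (bridge k U W)
    then have "node_vertex k U 0 \<noteq> node_vertex (Suc k) W 0" using node_vertex_inject[of U k W "Suc k"] by auto
    then show ?thesis using bridge node_vertex_in_verts by simp
  qed
qed

sublocale G: graph verts edges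
  by unfold_locales (rule is_graph_pieces)

text \<open>Inner edges stay within one piece and bridges join consecutive levels, so the part below
  \<open>U\<close> can only be left through the bridge to its parent. For \<open>k = 0\<close> there
  is no way out at all.\<close>

lemma edge_cut_below:
  assumes U: "U \<in> \<U> k"
  shows "edge_cut edges (below k U) \<subseteq>
    {{node_vertex j P 0, node_vertex k U 0} | j P. k = Suc j \<and> P \<in> \<U> j \<and> U \<subseteq> P}"
proof
  fix e assume "e \<in> edge_cut edges (below k U)"
  hence e: "e \<in> edges" "e \<inter> below k U \<noteq> {}" "\<not> e \<subseteq> below k U" unfolding edge_cut_def by auto
  from e(1) show "e \<in> {{node_vertex j P 0, node_vertex k U 0} | j P. k = Suc j \<and> P \<in> \<U> j \<and> U \<subseteq> P}"
  proof (cases rule: edgeE)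
    case (inner j W i l)
    then show ?thesis using e node_in_below[OF U] by auto
  next
    case (bridge j P W)
    have P: "\<not> (k \<le> j \<and> P \<subseteq> U)"
    proof
      assume "k \<le> j \<and> P \<subseteq> U"
      hence "e \<subseteq> below k U" using bridge node_in_below[OF U] by auto
      thus False using e by blast
    qed
    have W: "k \<le> Suc j" "W \<subseteq> U" using e P bridge node_in_below[OF U] by auto
    obtain x where x: "x \<in> W" using piece_open bridge(3) by blast
    have "\<not> k \<le> j" using nested[OF U bridge(2), of x] P x W bridge(4) by blast
    hence k: "k = Suc j" using W by simp
    hence "W = U" using piece_unique[of W k U x] x W U bridge(3) by blast
    then show ?thesis using bridge k by blast
  qed
qed

lemma finite_cut_below:
  assumes U: "U \<in> \<U> k"
  shows "finite (edge_cut edges (below k U))"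
proof -
  obtain x where x: "x \<in> U" using piece_open U by blast
  have "e = e'" if e: "e \<in> edge_cut edges (below k U)" "e' \<in> edge_cut edges (below k U)" for e e'
  proof -
    obtain j P where P: "e = {node_vertex j P 0, node_vertex k U 0}" "k = Suc j" "P \<in> \<U> j" "U \<subseteq> P"
      using subsetD[OF edge_cut_below[OF U] e(1)] by blast
    obtain j' P' where P': "e' = {node_vertex j' P' 0, node_vertex k U 0}" "k = Suc j'" "P' \<in> \<U> j'" "U \<subseteq> P'"
      using subsetD[OF edge_cut_below[OF U] e(2)] by blast
    have "j' = j" using P P' by simp
    moreover have "P' = P" using piece_unique[of P' j P x] P P' x by auto
    ultimately show ?thesis using P P' by simp
  qed
  thus ?thesis by (metis finite.simps is_singletonI' is_singleton_def)
qed

lemma below_mono: "k \<le> j \<Longrightarrow> W \<subseteq> U \<Longrightarrow> below j W \<subseteq> below k U"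
  unfolding below_def by fastforce

lemma below_disjoint:
  assumes "U \<in> \<U> k" "W \<in> \<U> k" "U \<noteq> W"
  shows "below k U \<inter> below k W = {}"
proof (rule ccontr)
  assume "\<not> ?thesis"
  then obtain v where v: "v \<in> below k U" "v \<in> below k W" by blast
  then obtain j Y i where Y: "v = node_vertex j Y i" "Y \<in> \<U> j" "Y \<subseteq> U" by (meson belowE)
  hence "Y \<subseteq> W" using v(2) node_in_below[OF assms(2)] by blast
  moreover obtain x where "x \<in> Y" using piece_open Y(2) by blast
  ultimately show False using piece_unique assms Y(3) by blast
qed

lemma below_cases:
  assumes U: "U \<in> \<U> k" and v: "v \<in> below k U"
  shows "(\<exists>i. v = node_vertex k U i \<and> (i = 0 \<or> is_limit k U)) \<or> (\<exists>W\<in>subpieces \<U> k U. v \<in> below (Suc k) W)"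
proof -
  obtain j W i where W: "v = node_vertex j W i" "k \<le> j" "W \<in> \<U> j" "W \<subseteq> U" "i = 0 \<or> is_limit j W"
    using v by (rule belowE)
  obtain x where x: "x \<in> W" using piece_open W(3) by blast
  show ?thesis
  proof (cases "j = k")
    case True
    then have "W = U" using piece_unique[of W k U x] W x U by blast
    then show ?thesis using W True by blast
  next
    case False
    then have "Suc k \<le> j" using W by simp
    then obtain Y where Y: "Y \<in> \<U> (Suc k)" "W \<subseteq> Y" using ancestor[OF W(3)] by blast
    have "Y \<subseteq> U" using nested[OF U Y(1), of x] W Y x by auto
    then show ?thesis using Y W \<open>Suc k \<le> j\<close> unfolding subpieces_def below_def by blast
  qed
qed

text \<open>A vertex is adjacent to vertex 0 of its own piece unless it is that vertex, and the
  vertices numbered 0 are joined by bridges up to the one of \<open>U\<close>.\<close>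

lemma connected_below:
  assumes U: "U \<in> \<U> k"
  shows "connected_in edges (below k U)"
  unfolding connected_in_def
proof (intro allI impI, rule ccontr)
  fix B assume B: "below k U \<inter> B \<noteq> {} \<and> below k U - B \<noteq> {}"
  assume "\<not> (\<exists>e\<in>edges. e \<subseteq> below k U \<and> e \<inter> B \<noteq> {} \<and> \<not> e \<subseteq> B)"
  hence no0: "\<forall>e\<in>edges. e \<subseteq> below k U \<longrightarrow> e \<inter> B \<noteq> {} \<longrightarrow> e \<subseteq> B" by metis
  have no: "x \<in> B \<longleftrightarrow> y \<in> B" if xy: "{x, y} \<in> edges" "x \<in> below k U" "y \<in> below k U" for x y
    using no0[rule_format, OF xy(1)] xy(2,3) by (cases "x \<in> B") auto
  have root: "node_vertex j W 0 \<in> B \<longleftrightarrow> node_vertex k U 0 \<in> B" if "k \<le> j" "W \<in> \<U> j" "W \<subseteq> U" for j W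
    using that
  proof (induction j arbitrary: W rule: dec_induct)
    case base
    obtain x where "x \<in> W" using piece_open base by blast
    hence "W = U" using piece_unique U base by blast
    then show ?case by simp
  next
    case (step j)
    obtain P where P: "P \<in> \<U> j" "W \<subseteq> P" using parent step.prems by blast
    obtain x where "x \<in> W" using piece_open step.prems by blast
    hence PU: "P \<subseteq> U" using nested[OF U P(1), of x] step P by blast
    have "node_vertex j P 0 \<in> B \<longleftrightarrow> node_vertex (Suc j) W 0 \<in> B"
      using step PU P by (intro no bridgeI) (auto simp: node_in_below[OF U])
    then show ?case using step.IH P PU by blast
  qed
  have "v \<in> B \<longleftrightarrow> node_vertex k U 0 \<in> B" if v: "v \<in> below k U" for v
  proof -
    obtain j W i where W: "v = node_vertex j W i" "k \<le> j" "W \<in> \<U> j" "W \<subseteq> U" "i = 0 \<or> is_limit j W"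
      using v by (rule belowE)
    have "node_vertex j W i \<in> B \<longleftrightarrow> node_vertex j W 0 \<in> B"
    proof (cases "i = 0")
      case False
      then show ?thesis using W by (intro no inner_edgeI) (auto simp: node_in_below[OF U])
    qed simp
    thus ?thesis using root W by simp
  qed
  thus False using B by blast
qed

section \<open>Matching points and ends through the pieces that contain them\<close>

text \<open>Together with \<open>end_pieces\<close> this is the dictionary between the two spaces:
  both maps are injective and have the same range, which yields the bijection
  \<open>end_of\<close>.\<close>

definition point_pieces :: "'a \<Rightarrow> (nat \<times> 'a set) set" where
  "point_pieces x = {(k, U). U \<in> \<U> k \<and> x \<in> U}"

definition end_pieces :: "(nat \<Rightarrow> 'a \<times> nat) set \<Rightarrow> (nat \<times> 'a set) set" where
  "end_pieces \<epsilon> = {(k, U). U \<in> \<U> k \<and> \<epsilon> \<in> G.ends_in (below k U)}"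

text \<open>At the first level that misses \<open>x\<close>, the piece one level higher contains
  \<open>x\<close> but none of its subpieces does, so \<open>x\<close> is its limit point.\<close>

lemma branch_or_limit:
  assumes x: "x \<in> topspace X"
  obtains (branch) f where "\<And>k. f k \<in> \<U> k" "\<And>k. f (Suc k) \<subseteq> f k" "\<Inter>(range f) = {x}" "local_basis_at X x (range f)"
  | (limit) k U where "U \<in> \<U> k" "is_limit k U" "limit_piece X U (subpieces \<U> k U) x"
proof (cases "\<forall>k. \<exists>U\<in>\<U> k. x \<in> U")
  case True
  then obtain f where f: "\<And>k. f k \<in> \<U> k \<and> x \<in> f k" by metis
  have dec: "f (Suc k) \<subseteq> f k" for k using nested[of "f k" k "f (Suc k)" "Suc k" x] f by simp
  obtain y where "\<Inter>(range f) = {y}" "local_basis_at X y (range f)" using branch_point[of f] f dec by blast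
  moreover have "x \<in> \<Inter>(range f)" using f by blast
  ultimately show ?thesis using branch f dec that(1) by (metis singletonD)
next
  case False
  let ?P = "\<lambda>k. \<not> (\<exists>U\<in>\<U> k. x \<in> U)"
  define k where "k = (LEAST k. ?P k)"
  have k: "?P k" unfolding k_def using False by (intro LeastI_ex[of ?P]) blast
  have k2: "\<exists>U\<in>\<U> j. x \<in> U" if "j < k" for j
    using not_less_Least[of j ?P] that unfolding k_def by blast
  have "k \<noteq> 0" by (rule notI) (use k(1) x level0 in simp)
  then obtain j where j: "k = Suc j" using not0_implies_Suc by blast
  then obtain U where U: "U \<in> \<U> j" "x \<in> U" using k2[of j] by blast
  have nx: "x \<notin> \<Union>(subpieces \<U> j U)" using k(1) j unfolding subpieces_def by blast
  then obtain y where y: "limit_piece X U (subpieces \<U> j U) y" using piece_cases[OF U(1)] U(2) by blast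
  hence "x = y" using nx U(2) unfolding limit_piece_def by blast
  thus ?thesis using that(2)[of U j] U nx y unfolding is_limit_def by blast
qed

text \<open>A vertex has a fixed level and so drops out of the sets below the branch. From some
  level on they avoid all endvertices of the cut of \<open>S\<close>, and connectedness puts them on
  one side.\<close>

lemma branch_small:
  assumes f: "\<And>k. f k \<in> \<U> k" "\<And>k. f (Suc k) \<subseteq> f k" and S: "finite (edge_cut edges S)"
  shows "\<exists>k. below k (f k) \<subseteq> S \<or> below k (f k) \<inter> S = {}"
proof -
  have dec: "below j (f j) \<subseteq> below i (f i)" if "i \<le> j" for i j
  proof (rule below_mono[OF that])
    show "f j \<subseteq> f i" using f(2) that by (rule lift_Suc_antimono_le)
  qed
  have empty: "\<exists>k. v \<notin> below k (f k)" for v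
  proof (rule ccontr)
    assume "\<not> ?thesis"
    hence *: "v \<in> below k (f k)" for k by blast
    obtain j W i where W: "v = node_vertex j W i" "W \<in> \<U> j" using *[of 0] by (rule belowE)
    show False using *[of "Suc j"] node_in_below[OF f(1) W(2)] W(1) by simp
  qed
  have "finite (\<Union>(edge_cut edges S))"
    using S G.edge_card by (intro finite_Union) (auto simp: edge_cut_def card_2_iff)
  moreover have "\<exists>k. below k (f k) \<inter> Y = {}" if "finite Y" for Y
    using that
  proof (induction Y rule: finite_induct)
    case (insert y Y)
    obtain k where "below k (f k) \<inter> Y = {}" using insert by blast
    moreover obtain j where "y \<notin> below j (f j)" using empty by blast
    ultimately have "below (max j k) (f (max j k)) \<inter> insert y Y = {}"
      using dec[of k "max j k"] dec[of j "max j k"] by auto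
    thus ?case by blast
  qed simp
  ultimately obtain k where k: "below k (f k) \<inter> \<Union>(edge_cut edges S) = {}" by blast
  have "below k (f k) \<subseteq> S" if "below k (f k) \<inter> S \<noteq> {}"
    using connected_below[OF f(1)[of k]] k that unfolding connected_in_def edge_cut_def by blast
  thus ?thesis by blast
qed

text \<open>Splitting an infinite complete graph into two nonempty parts cuts infinitely many
  edges.\<close>

lemma limit_block:
  assumes U: "U \<in> \<U> k" "is_limit k U" and S: "finite (edge_cut edges S)"
  shows "range (node_vertex k U) \<subseteq> S \<or> range (node_vertex k U) \<inter> S = {}"
proof (rule ccontr)
  let ?v = "node_vertex k U"
  assume "\<not> ?thesis"
  then obtain a b where ab: "?v a \<in> S" "?v b \<notin> S" by blast
  have inj: "?v i = ?v j \<longleftrightarrow> i = j" for i j using node_vertex_inject[OF U(1) U(1)] by blast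
  \<comment> \<open>Every vertex is paired with a fixed vertex of the opposite side, which gives a
    cut edge for each index. A given edge arises from finitely many indices only, so the pigeonhole
    principle applies.\<close>
  let ?other = "\<lambda>i. if ?v i \<in> S then ?v b else ?v a"
  have cut: "{?v i, ?other i} \<in> edge_cut edges S" for i
  proof (cases "?v i \<in> S")
    case True
    then have "i \<noteq> b" using ab by auto
    then show ?thesis using inner_edgeI[OF U, of i b] ab True unfolding edge_cut_def by simp
  next
    case False
    then have "i \<noteq> a" using ab by auto
    then show ?thesis using inner_edgeI[OF U, of i a] ab False unfolding edge_cut_def by simp
  qed
  hence "range (\<lambda>i. {?v i, ?other i}) \<subseteq> edge_cut edges S" by (rule image_subsetI)
  hence "finite (range (\<lambda>i. {?v i, ?other i}))" using S by (rule finite_subset)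
  moreover have "finite ((\<lambda>i. {?v i, ?other i}) -` {e})" for e
  proof (cases "e \<in> edges")
    case True
    then have "finite e" using G.edge_card card.infinite by fastforce
    then have "finite (?v -` e)" using inj by (intro finite_vimageI) (auto simp: inj_def)
    then show ?thesis by (rule finite_subset[rotated]) auto
  next
    case False
    then have "(\<lambda>i. {?v i, ?other i}) -` {e} = {}"
      using cut edge_cut_subset by blast
    then show ?thesis by simp
  qed
  ultimately show False
    using pigeonhole_infinite[of UNIV "\<lambda>i. {?v i, ?other i}"] by (auto simp: vimage_def)
qed

text \<open>Each subpiece that is not inside \<open>S\<close> contributes a cut edge: its bridge to
  vertex 0 of \<open>U\<close>, or an edge inside it if its own vertex 0 is in \<open>S\<close>.
  These edges are distinct for distinct subpieces, so only finitely many subpieces are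
  concerned.\<close>

lemma limit_small:
  assumes U: "U \<in> \<U> k" and S: "finite (edge_cut edges S)"
    and block: "\<And>i. i = 0 \<or> is_limit k U \<Longrightarrow> node_vertex k U i \<in> S"
  shows "\<exists>\<F>\<subseteq>subpieces \<U> k U. finite \<F> \<and> below k U - S \<subseteq> (\<Union>W\<in>\<F>. below (Suc k) W)"
proof -
  let ?\<F> = "{W \<in> subpieces \<U> k U. \<not> below (Suc k) W \<subseteq> S}"
  have sub: "W \<in> \<U> (Suc k)" "W \<subseteq> U" if "W \<in> subpieces \<U> k U" for W
    using that unfolding subpieces_def by auto
  define cuts where "cuts W e \<longleftrightarrow> e \<in> edge_cut edges S \<and> e \<inter> below (Suc k) W \<noteq> {} \<and>
    e \<subseteq> insert (node_vertex k U 0) (below (Suc k) W)" for W e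
  have "\<exists>e. cuts W e" if W: "W \<in> ?\<F>" for W
  proof -
    have W': "W \<in> \<U> (Suc k)" "W \<subseteq> U" using W sub by blast+
    have w0: "node_vertex (Suc k) W 0 \<in> below (Suc k) W" using node_in_below[OF W'(1) W'(1)] by simp
    show ?thesis
    proof (cases "node_vertex (Suc k) W 0 \<in> S")
      case False
      have "{node_vertex k U 0, node_vertex (Suc k) W 0} \<in> edges" using bridgeI U W' by blast
      then show ?thesis using False w0 block[of 0] unfolding cuts_def edge_cut_def
        by (intro exI[of _ "{node_vertex k U 0, node_vertex (Suc k) W 0}"]) auto
    next
      case True
      obtain y where "y \<in> below (Suc k) W" "y \<notin> S" using W by blast
      then obtain e where e: "e \<in> edges" "e \<subseteq> below (Suc k) W" "e \<inter> S \<noteq> {}" "\<not> e \<subseteq> S"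
        using connected_inD[OF connected_below[OF W'(1)] w0 True] by blast
      then show ?thesis unfolding cuts_def edge_cut_def by (intro exI[of _ e]) blast
    qed
  qed
  then obtain g where "\<And>W. W \<in> ?\<F> \<Longrightarrow> cuts W (g W)" by metis
  note g = this[unfolded cuts_def]
  have "inj_on g ?\<F>"
  proof (rule inj_onI)
    fix W W' assume WW: "W \<in> ?\<F>" "W' \<in> ?\<F>" "g W = g W'"
    obtain z where z: "z \<in> g W" "z \<in> below (Suc k) W" using g[OF WW(1)] by blast
    have "W \<in> \<U> (Suc k)" "W' \<in> \<U> (Suc k)" using WW sub by blast+
    moreover have "z \<noteq> node_vertex k U 0"
      using z(2) node_in_below[of W "Suc k" U k 0] sub WW U by auto
    hence "z \<in> below (Suc k) W'" using g[OF WW(2)] WW(3) z(1) by blast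
    ultimately show "W = W'" using below_disjoint z(2) by blast
  qed
  moreover have "g ` ?\<F> \<subseteq> edge_cut edges S" using g by blast
  ultimately have "finite ?\<F>" by (rule inj_on_finite[OF _ _ S])
  moreover have "below k U - S \<subseteq> (\<Union>W\<in>?\<F>. below (Suc k) W)"
  proof
    fix v assume v: "v \<in> below k U - S"
    hence "\<not> (\<exists>i. v = node_vertex k U i \<and> (i = 0 \<or> is_limit k U))" using block by blast
    then obtain W where "W \<in> subpieces \<U> k U" "v \<in> below (Suc k) W" using below_cases[OF U, of v] v by blast
    thus "v \<in> (\<Union>W\<in>?\<F>. below (Suc k) W)" using v by blast
  qed
  ultimately show ?thesis by (intro exI[of _ ?\<F>] conjI) auto
qed

lemma end_in_block:
  assumes U: "U \<in> \<U> k" and S: "finite (edge_cut edges S)"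
    and block: "\<And>i. i = 0 \<or> is_limit k U \<Longrightarrow> node_vertex k U i \<in> S"
  shows "\<exists>\<F>\<subseteq>subpieces \<U> k U. finite \<F> \<and>
    G.ends_in (below k U) - (\<Union>W\<in>\<F>. G.ends_in (below (Suc k) W)) \<subseteq> G.ends_in S"
proof -
  obtain \<F> where \<F>: "\<F> \<subseteq> subpieces \<U> k U" "finite \<F>" "below k U - S \<subseteq> (\<Union>W\<in>\<F>. below (Suc k) W)"
    using limit_small[OF assms] by metis
  have "\<epsilon> \<in> G.ends_in S" if \<epsilon>: "\<epsilon> \<in> G.ends_in (below k U)" "\<epsilon> \<notin> (\<Union>W\<in>\<F>. G.ends_in (below (Suc k) W))" for \<epsilon>
  proof (rule ccontr)
    assume "\<epsilon> \<notin> G.ends_in S"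
    moreover have "\<epsilon> \<in> edge_ends verts edges" using \<epsilon>(1) unfolding G.ends_in_def by blast
    ultimately have "\<epsilon> \<in> G.ends_in (- S)" using G.ends_in_Compl[OF S] by blast
    moreover have "finite (edge_cut edges (- S))" unfolding edge_cut_Compl by (rule S)
    note G.ends_in_Int[OF finite_cut_below[OF U] this]
    ultimately have "\<epsilon> \<in> G.ends_in (below k U \<inter> - S)" using \<epsilon>(1) by (metis IntI)
    moreover have "G.ends_in (below k U \<inter> - S) \<subseteq> G.ends_in (\<Union>(below (Suc k) ` \<F>))"
      using \<F>(3) by (intro G.ends_in_mono) blast
    ultimately have "\<epsilon> \<in> G.ends_in (\<Union>(below (Suc k) ` \<F>))" by blast
    moreover have "finite (edge_cut edges A)" if "A \<in> below (Suc k) ` \<F>" for A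
      using that \<F>(1) finite_cut_below unfolding subpieces_def by auto
    ultimately obtain A where "A \<in> below (Suc k) ` \<F>" "\<epsilon> \<in> G.ends_in A"
      using G.ends_in_Union[of "below (Suc k) ` \<F>" \<epsilon>] \<F>(2) by blast
    thus False using \<epsilon>(2) by blast
  qed
  thus ?thesis using \<F>(1,2) by (intro exI[of _ \<F>]) blast
qed

text \<open>Here \<open>U\<close> has the single vertex \<open>?v\<close>, which a ray meets at most
  once. From then on the ray cannot change the subpiece, whose only exit is the bridge to
  \<open>?v\<close>.\<close>

lemma end_in_some_subpiece:
  assumes U: "U \<in> \<U> k" and nl: "\<not> is_limit k U" and \<epsilon>: "\<epsilon> \<in> G.ends_in (below k U)"
  shows "\<exists>W\<in>subpieces \<U> k U. \<epsilon> \<in> G.ends_in (below (Suc k) W)"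
proof -
  let ?v = "node_vertex k U 0"
  obtain r m where r: "r \<in> \<epsilon>" "r ` {m..} \<subseteq> below k U" "\<epsilon> \<in> edge_ends verts edges"
    using \<epsilon> unfolding G.ends_in_def has_tail_def by blast
  have ray: "inj r" "\<And>n. {r n, r (Suc n)} \<in> edges" using G.end_ray(2)[OF r(3,1)] unfolding graph_rays_def by auto
  have "finite (r -` {?v})" using ray(1) by (intro finite_vimageI) auto
  then obtain M where M: "\<And>n. n \<in> r -` {?v} \<Longrightarrow> n < M" unfolding finite_nat_set_iff_bounded by blast
  let ?N = "max m M"
  have nv: "r n \<noteq> ?v" if "?N \<le> n" for n using M[of n] that by auto
  have inW: "\<exists>W\<in>subpieces \<U> k U. r n \<in> below (Suc k) W" if "?N \<le> n" for n
    using below_cases[OF U, of "r n"] nv[OF that] r(2) that nl by auto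
  then obtain W where W: "W \<in> subpieces \<U> k U" "r ?N \<in> below (Suc k) W" by blast
  have W': "W \<in> \<U> (Suc k)" "W \<subseteq> U" using W unfolding subpieces_def by auto
  have "r n \<in> below (Suc k) W" if "?N \<le> n" for n
    using that
  proof (induction n rule: dec_induct)
    case (step n)
    show ?case
    proof (rule ccontr)
      assume no: "r (Suc n) \<notin> below (Suc k) W"
      hence "{r n, r (Suc n)} \<in> edge_cut edges (below (Suc k) W)" using step ray(2) unfolding edge_cut_def by auto
      then obtain P where P: "P \<in> \<U> k" "W \<subseteq> P" "{r n, r (Suc n)} = {node_vertex k P 0, node_vertex (Suc k) W 0}"
        using edge_cut_below[OF W'(1)] by blast
      obtain x where "x \<in> W" using piece_open W'(1) by blast
      hence "P = U" using piece_unique[of P k U x] P U W' by blast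
      hence "r n = ?v \<or> r (Suc n) = ?v" using P(3) by (auto simp: doubleton_eq_iff)
      thus False using nv step(1) by (meson le_Suc_eq)
    qed
  qed (use W in blast)
  hence "has_tail r (below (Suc k) W)" unfolding has_tail_def by (intro exI[of _ ?N]) auto
  thus ?thesis using W(1) r unfolding G.ends_in_def by blast
qed

lemma ends_below_mono: "k \<le> j \<Longrightarrow> W \<subseteq> U \<Longrightarrow> G.ends_in (below j W) \<subseteq> G.ends_in (below k U)"
  by (intro G.ends_in_mono below_mono)

lemma ends_below_unique:
  assumes "U \<in> \<U> k" "W \<in> \<U> k" "\<epsilon> \<in> G.ends_in (below k U)" "\<epsilon> \<in> G.ends_in (below k W)"
  shows "U = W"
  using G.ends_in_disjoint[OF finite_cut_below[OF assms(1)] finite_cut_below[OF assms(2)]]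
    below_disjoint[OF assms(1,2)] assms(3,4) by blast

lemma ends_below_root:
  assumes "\<epsilon> \<in> edge_ends verts edges"
  shows "\<epsilon> \<in> G.ends_in (below 0 (topspace X))"
proof -
  obtain r where "r \<in> \<epsilon>" using G.end_ray assms by blast
  moreover have "r n \<in> below 0 (topspace X)" for n
    using G.ray_in_V[OF G.end_ray(2)[OF assms \<open>r \<in> \<epsilon>\<close>]] unfolding verts_def .
  hence "has_tail r (below 0 (topspace X))" unfolding has_tail_def by blast
  ultimately show ?thesis using assms unfolding G.ends_in_def by blast
qed

lemma end_branch_or_limit:
  assumes \<epsilon>: "\<epsilon> \<in> edge_ends verts edges"
  obtains (branch) f where "\<And>k. f k \<in> \<U> k" "\<And>k. f (Suc k) \<subseteq> f k" "\<And>k. \<epsilon> \<in> G.ends_in (below k (f k))"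
  | (limit) k U where "U \<in> \<U> k" "is_limit k U" "\<epsilon> \<in> G.ends_in (below k U)"
      "\<And>W. W \<in> \<U> (Suc k) \<Longrightarrow> \<epsilon> \<notin> G.ends_in (below (Suc k) W)"
proof (cases "\<forall>k. \<exists>U\<in>\<U> k. \<epsilon> \<in> G.ends_in (below k U)")
  case True
  then obtain f where f: "\<And>k. f k \<in> \<U> k \<and> \<epsilon> \<in> G.ends_in (below k (f k))" by metis
  have dec: "f (Suc k) \<subseteq> f k" for k
  proof -
    obtain P where P: "P \<in> \<U> k" "f (Suc k) \<subseteq> P" using parent f by blast
    have "\<epsilon> \<in> G.ends_in (below k P)" using f[of "Suc k"] ends_below_mono[of k "Suc k" "f (Suc k)" P] P by auto
    thus ?thesis using ends_below_unique P f by blast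
  qed
  show ?thesis using that(1)[of f] f dec by blast
next
  case False
  then obtain k where k: "\<not> (\<exists>U\<in>\<U> k. \<epsilon> \<in> G.ends_in (below k U))"
    "\<And>j. j < k \<Longrightarrow> \<exists>U\<in>\<U> j. \<epsilon> \<in> G.ends_in (below j U)"
    using exists_least_iff[of "\<lambda>k. \<not> (\<exists>U\<in>\<U> k. \<epsilon> \<in> G.ends_in (below k U))"] by blast
  have "k \<noteq> 0" by (rule notI) (use k(1) ends_below_root[OF \<epsilon>] level0 in simp)
  then obtain j where j: "k = Suc j" using not0_implies_Suc by blast
  then obtain U where U: "U \<in> \<U> j" "\<epsilon> \<in> G.ends_in (below j U)" using k(2)[of j] by blast
  have no: "\<epsilon> \<notin> G.ends_in (below (Suc j) W)" if "W \<in> \<U> (Suc j)" for W using k(1) j that by blast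
  hence "is_limit j U" using end_in_some_subpiece[OF U(1) _ U(2)] unfolding subpieces_def by blast
  thus ?thesis using that(2) U no by blast
qed

lemma point_pieces_inj:
  assumes "x \<in> topspace X" "y \<in> topspace X" "point_pieces x = point_pieces y"
  shows "x = y"
  using assms(1)
proof (cases rule: branch_or_limit)
  case (branch f)
  then have "(k, f k) \<in> point_pieces x" for k unfolding point_pieces_def by blast
  then have "y \<in> f k" for k using assms(3) unfolding point_pieces_def by blast
  then have "y \<in> \<Inter>(range f)" by blast
  then show ?thesis using branch(3) by simp
next
  case (limit k U)
  then have "(k, U) \<in> point_pieces x" "\<And>W. W \<in> subpieces \<U> k U \<Longrightarrow> (Suc k, W) \<notin> point_pieces x"
    unfolding point_pieces_def limit_piece_def by blast+
  then have "y \<in> U" "y \<notin> \<Union>(subpieces \<U> k U)"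
    using assms(3) unfolding point_pieces_def subpieces_def by auto
  then show ?thesis using limit_pieceD(3)[OF limit(3)] by simp
qed

text \<open>The end in question is that of the complete graph at \<open>U\<close>. By
  \<open>limit_block\<close> this graph lies in \<open>S\<close> or in its complement, and
  \<open>end_in_block\<close> puts the end on the same side.\<close>

lemma limit_end_iff:
  assumes U: "U \<in> \<U> k" "is_limit k U" "\<epsilon> \<in> G.ends_in (below k U)"
      "\<And>W. W \<in> \<U> (Suc k) \<Longrightarrow> \<epsilon> \<notin> G.ends_in (below (Suc k) W)"
    and S: "finite (edge_cut edges S)"
  shows "\<epsilon> \<in> G.ends_in S \<longleftrightarrow> range (node_vertex k U) \<subseteq> S"
proof -
  have in_S: "\<epsilon> \<in> G.ends_in S" if S: "finite (edge_cut edges S)" "range (node_vertex k U) \<subseteq> S" for S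
  proof -
    have "\<exists>\<F>\<subseteq>subpieces \<U> k U. finite \<F> \<and>
      G.ends_in (below k U) - (\<Union>W\<in>\<F>. G.ends_in (below (Suc k) W)) \<subseteq> G.ends_in S"
      by (rule end_in_block[OF U(1) S(1)]) (use S(2) in blast)
    then obtain \<F> where \<F>: "\<F> \<subseteq> subpieces \<U> k U"
      "G.ends_in (below k U) - (\<Union>W\<in>\<F>. G.ends_in (below (Suc k) W)) \<subseteq> G.ends_in S" by (elim exE conjE)
    have "\<epsilon> \<notin> (\<Union>W\<in>\<F>. G.ends_in (below (Suc k) W))" using U(4) \<F>(1) unfolding subpieces_def by auto
    thus ?thesis using \<F>(2) U(3) by blast
  qed
  show ?thesis
  proof
    assume \<epsilon>: "\<epsilon> \<in> G.ends_in S"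
    show "range (node_vertex k U) \<subseteq> S"
    proof (rule ccontr)
      assume "\<not> ?thesis"
      hence "range (node_vertex k U) \<subseteq> - S" using limit_block[OF U(1,2) S] by blast
      moreover have fin: "finite (edge_cut edges (- S))" unfolding edge_cut_Compl by (rule S)
      ultimately have "\<epsilon> \<in> G.ends_in (- S)" using in_S by blast
      moreover have "G.ends_in S \<inter> G.ends_in (- S) = {}" by (rule G.ends_in_disjoint[OF S fin]) simp
      ultimately show False using \<epsilon> by blast
    qed
  qed (rule in_S[OF S])
qed

lemma end_pieces_inj:
  assumes \<epsilon>: "\<epsilon> \<in> edge_ends verts edges" and \<eta>: "\<eta> \<in> edge_ends verts edges"
    and eq: "end_pieces \<epsilon> = end_pieces \<eta>"
  shows "\<epsilon> = \<eta>"
proof (rule G.ends_eq[OF \<epsilon> \<eta>])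
  fix S assume S: "finite (edge_cut edges S)" "\<epsilon> \<in> G.ends_in S"
  have iff: "\<epsilon> \<in> G.ends_in (below k U) \<longleftrightarrow> \<eta> \<in> G.ends_in (below k U)" if "U \<in> \<U> k" for k U
    using eq that unfolding end_pieces_def by blast
  show "\<eta> \<in> G.ends_in S"
    using \<epsilon>
  proof (cases rule: end_branch_or_limit)
    case (branch f)
    obtain k where k: "below k (f k) \<subseteq> S \<or> below k (f k) \<inter> S = {}"
      using branch_small[OF branch(1,2) S(1)] by blast
    have "below k (f k) \<inter> S \<noteq> {}"
      using G.ends_in_disjoint[OF finite_cut_below[OF branch(1)] S(1), of k] branch(3)[of k] S(2) by blast
    hence "G.ends_in (below k (f k)) \<subseteq> G.ends_in S" using k G.ends_in_mono by blast
    then show ?thesis using iff[OF branch(1)] branch(3)[of k] by blast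
  next
    case (limit k U)
    have "range (node_vertex k U) \<subseteq> S" using limit_end_iff[OF limit S(1)] S(2) by blast
    moreover have "\<eta> \<in> G.ends_in (below k U)" using iff limit by blast
    moreover have "\<eta> \<notin> G.ends_in (below (Suc k) W)" if "W \<in> \<U> (Suc k)" for W using iff limit(4) that by blast
    ultimately show ?thesis using limit_end_iff[OF limit(1,2) _ _ S(1), of \<eta>] by blast
  qed
qed

lemma end_pieces_of_chain:
  assumes f: "\<And>k. f k \<in> \<U> k" "\<And>k. \<epsilon> \<in> G.ends_in (below k (f k))"
  shows "end_pieces \<epsilon> = {(k, f k) | k. True}"
  using f ends_below_unique unfolding end_pieces_def by blast

lemma point_pieces_of_chain:
  assumes f: "\<And>k. f k \<in> \<U> k" "\<And>k. x \<in> f k"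
  shows "point_pieces x = {(k, f k) | k. True}"
  using f piece_unique unfolding point_pieces_def by blast

lemma end_pieces_of_limit:
  assumes U: "U \<in> \<U> k" "\<epsilon> \<in> G.ends_in (below k U)"
      "\<And>W. W \<in> \<U> (Suc k) \<Longrightarrow> \<epsilon> \<notin> G.ends_in (below (Suc k) W)"
  shows "end_pieces \<epsilon> = {(j, W). j \<le> k \<and> W \<in> \<U> j \<and> U \<subseteq> W}"
proof -
  have "j \<le> k \<and> U \<subseteq> W" if W: "W \<in> \<U> j" "\<epsilon> \<in> G.ends_in (below j W)" for j W
  proof -
    have "j \<le> k"
    proof (rule ccontr)
      assume "\<not> j \<le> k"
      then obtain Y where Y: "Y \<in> \<U> (Suc k)" "W \<subseteq> Y" using ancestor[OF W(1), of "Suc k"] by auto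
      hence "\<epsilon> \<in> G.ends_in (below (Suc k) Y)" using ends_below_mono[of "Suc k" j W Y] W \<open>\<not> j \<le> k\<close> by auto
      thus False using U(3) Y(1) by blast
    qed
    moreover obtain Y where Y: "Y \<in> \<U> j" "U \<subseteq> Y" using ancestor[OF U(1) \<open>j \<le> k\<close>] by blast
    have "\<epsilon> \<in> G.ends_in (below j Y)" using ends_below_mono[OF \<open>j \<le> k\<close> Y(2)] U(2) by blast
    hence "Y = W" using ends_below_unique Y W by blast
    ultimately show ?thesis using Y by blast
  qed
  moreover have "\<epsilon> \<in> G.ends_in (below j W)" if "j \<le> k" "U \<subseteq> W" for j W
    using ends_below_mono[OF that] U(2) by blast
  ultimately show ?thesis unfolding end_pieces_def by blast
qed

lemma point_pieces_of_limit:
  assumes U: "U \<in> \<U> k" "limit_piece X U (subpieces \<U> k U) x"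
  shows "point_pieces x = {(j, W). j \<le> k \<and> W \<in> \<U> j \<and> U \<subseteq> W}"
proof -
  have x: "x \<in> U" "x \<notin> \<Union>(subpieces \<U> k U)" using U unfolding limit_piece_def by blast+
  have "j \<le> k \<and> U \<subseteq> W" if W: "W \<in> \<U> j" "x \<in> W" for j W
  proof -
    have "j \<le> k"
    proof (rule ccontr)
      assume "\<not> j \<le> k"
      then obtain Y where Y: "Y \<in> \<U> (Suc k)" "W \<subseteq> Y" using ancestor[OF W(1), of "Suc k"] by auto
      hence "Y \<subseteq> U" using nested[OF U(1) Y(1), of x] x W by auto
      thus False using x(2) Y W unfolding subpieces_def by blast
    qed
    thus ?thesis using nested[OF W(1) U(1)] W x by blast
  qed
  thus ?thesis using x unfolding point_pieces_def by blast
qed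

text \<open>For a point on a branch the ray runs through the vertices numbered 0 of the branch; for
  a limit point it enumerates the complete graph of the limit piece.\<close>

lemma ex_end:
  assumes x: "x \<in> topspace X"
  shows "\<exists>\<epsilon>\<in>edge_ends verts edges. end_pieces \<epsilon> = point_pieces x"
  using x
proof (cases rule: branch_or_limit)
  case (branch f)
  define r where "r k = node_vertex k (f k) 0" for k
  have "inj r" unfolding r_def inj_def using node_vertex_inject[OF branch(1) branch(1)] by blast
  moreover have "{r k, r (Suc k)} \<in> edges" for k unfolding r_def using bridgeI branch(1,2) by blast
  ultimately have "r \<in> graph_rays edges" unfolding graph_rays_def by blast
  then obtain \<epsilon> where \<epsilon>: "\<epsilon> \<in> edge_ends verts edges" "r \<in> \<epsilon>" using G.end_of_ray by blast
  have "r j \<in> below k (f k)" if "k \<le> j" for k j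
  proof -
    have "f j \<subseteq> f k" using branch(2) that by (rule lift_Suc_antimono_le)
    thus ?thesis unfolding r_def using that node_in_below[OF branch(1) branch(1)] by simp
  qed
  hence "has_tail r (below k (f k))" for k unfolding has_tail_def by (intro exI[of _ k]) auto
  hence "\<epsilon> \<in> G.ends_in (below k (f k))" for k using \<epsilon> unfolding G.ends_in_def by blast
  hence "end_pieces \<epsilon> = {(k, f k) | k. True}" using end_pieces_of_chain[of f] branch(1) by blast
  moreover have "x \<in> f k" for k using branch(3) by blast
  hence "point_pieces x = {(k, f k) | k. True}" using point_pieces_of_chain[of f] branch(1) by blast
  ultimately show ?thesis using \<epsilon>(1) by auto
next
  case (limit k U)
  let ?r = "node_vertex k U"
  have "inj ?r" unfolding inj_def using node_vertex_inject[OF limit(1) limit(1)] by blast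
  moreover have "{?r i, ?r (Suc i)} \<in> edges" for i using inner_edgeI[OF limit(1,2)] by simp
  ultimately have ray: "?r \<in> graph_rays edges" unfolding graph_rays_def by blast
  then obtain \<epsilon> where \<epsilon>: "\<epsilon> \<in> edge_ends verts edges" "?r \<in> \<epsilon>" using G.end_of_ray by blast
  have "?r i \<in> below k U" for i using node_in_below[OF limit(1) limit(1)] limit(2) by simp
  hence 1: "\<epsilon> \<in> G.ends_in (below k U)" using \<epsilon> unfolding G.ends_in_def has_tail_def by blast
  have 2: "\<epsilon> \<notin> G.ends_in (below (Suc k) W)" if "W \<in> \<U> (Suc k)" for W
  proof
    assume "\<epsilon> \<in> G.ends_in (below (Suc k) W)"
    hence "has_tail ?r (below (Suc k) W)" using G.ends_in_all finite_cut_below[OF that] \<epsilon>(2) by blast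
    then obtain i where "?r i \<in> below (Suc k) W" unfolding has_tail_def by auto
    thus False using node_in_below[OF that limit(1)] by simp
  qed
  show ?thesis
    using end_pieces_of_limit[OF limit(1) 1 2] point_pieces_of_limit[OF limit(1,3)] \<epsilon>(1) by auto
qed

lemma ex_point:
  assumes \<epsilon>: "\<epsilon> \<in> edge_ends verts edges"
  shows "\<exists>x\<in>topspace X. end_pieces \<epsilon> = point_pieces x"
  using \<epsilon>
proof (cases rule: end_branch_or_limit)
  case (branch f)
  then obtain x where x: "\<Inter>(range f) = {x}" using branch_point[of f] by blast
  hence "x \<in> \<Inter>(range f)" by simp
  hence xf: "x \<in> f k" for k by simp
  have "end_pieces \<epsilon> = point_pieces x"
    using end_pieces_of_chain[of f, OF branch(1,3)] point_pieces_of_chain[of f x, OF branch(1) xf] by simp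
  moreover have "x \<in> topspace X" using piece_sub_topspace[OF branch(1)] xf[of 0] by blast
  ultimately show ?thesis by blast
next
  case (limit k U)
  then obtain x where x: "limit_piece X U (subpieces \<U> k U) x"
    using piece_cases[OF limit(1)] unfolding is_limit_def by blast
  hence "x \<in> U" unfolding limit_piece_def by blast
  hence "x \<in> topspace X" using piece_sub_topspace limit(1) by blast
  moreover have "end_pieces \<epsilon> = point_pieces x"
    using end_pieces_of_limit[OF limit(1,3,4)] point_pieces_of_limit[OF limit(1) x] by simp
  ultimately show ?thesis by blast
qed

definition end_of :: "'a \<Rightarrow> (nat \<Rightarrow> 'a \<times> nat) set" where
  "end_of x = (SOME \<epsilon>. \<epsilon> \<in> edge_ends verts edges \<and> end_pieces \<epsilon> = point_pieces x)"

lemma end_of: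
  assumes "x \<in> topspace X"
  shows "end_of x \<in> edge_ends verts edges" "end_pieces (end_of x) = point_pieces x"
proof -
  have "end_of x \<in> edge_ends verts edges \<and> end_pieces (end_of x) = point_pieces x"
    unfolding end_of_def by (rule someI_ex) (use ex_end[OF assms] in blast)
  thus "end_of x \<in> edge_ends verts edges" "end_pieces (end_of x) = point_pieces x" by auto
qed

lemma bij_end_of: "bij_betw end_of (topspace X) (edge_ends verts edges)"
  unfolding bij_betw_def
proof
  show "inj_on end_of (topspace X)"
    by (rule inj_onI) (metis end_of(2) point_pieces_inj)
  show "end_of ` topspace X = edge_ends verts edges"
  proof
    show "end_of ` topspace X \<subseteq> edge_ends verts edges" using end_of(1) by blast
    show "edge_ends verts edges \<subseteq> end_of ` topspace X"
    proof
      fix \<epsilon> assume \<epsilon>: "\<epsilon> \<in> edge_ends verts edges"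
      obtain x where x: "x \<in> topspace X" "end_pieces \<epsilon> = point_pieces x" using ex_point[OF \<epsilon>] by blast
      hence "\<epsilon> = end_of x" using end_pieces_inj[OF \<epsilon>] end_of[OF x(1)] by metis
      thus "\<epsilon> \<in> end_of ` topspace X" using x by blast
    qed
  qed
qed

lemma end_of_in_piece:
  assumes "x \<in> topspace X" "U \<in> \<U> k"
  shows "end_of x \<in> G.ends_in (below k U) \<longleftrightarrow> x \<in> U"
  using end_of(2)[OF assms(1)] assms(2) unfolding end_pieces_def point_pieces_def by blast

text \<open>This is continuity of \<open>end_of\<close>: a set with a finite cut around the end
  takes in everything below some piece of the branch, or everything below the limit piece except
  finitely many subpieces.\<close>

lemma end_of_neighbourhood:
  assumes x: "x \<in> topspace X" and S: "finite (edge_cut edges S)" "end_of x \<in> G.ends_in S"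
  shows "\<exists>V. openin X V \<and> x \<in> V \<and> end_of ` V \<subseteq> G.ends_in S"
  using x
proof (cases rule: branch_or_limit)
  case (branch f)
  obtain k where k: "below k (f k) \<subseteq> S \<or> below k (f k) \<inter> S = {}"
    using branch_small[OF branch(1,2) S(1)] by blast
  have xk: "x \<in> f k" using branch(3) by blast
  hence "end_of x \<in> G.ends_in (below k (f k))" using end_of_in_piece[OF x branch(1)] by blast
  hence "below k (f k) \<inter> S \<noteq> {}"
    using G.ends_in_disjoint[OF finite_cut_below[OF branch(1)] S(1), of k] S(2) by blast
  hence "G.ends_in (below k (f k)) \<subseteq> G.ends_in S" using k G.ends_in_mono by blast
  moreover have "end_of y \<in> G.ends_in (below k (f k))" if "y \<in> f k" for y
    using end_of_in_piece[OF _ branch(1), of y k] piece_sub_topspace[OF branch(1)] that by blast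
  ultimately show ?thesis using xk piece_open[OF branch(1)] by (intro exI[of _ "f k"]) blast
next
  case (limit k U)
  have xU: "x \<in> U" and xn: "\<And>W. W \<in> \<U> (Suc k) \<Longrightarrow> x \<notin> W"
  proof -
    show 1: "x \<in> U" using limit unfolding limit_piece_def by blast
    show "x \<notin> W" if "W \<in> \<U> (Suc k)" for W
      using limit(3) nested[OF limit(1) that, of x] that 1 unfolding limit_piece_def subpieces_def by auto
  qed
  have "range (node_vertex k U) \<subseteq> S"
    using limit_end_iff[OF limit(1,2) _ _ S(1), of "end_of x"] S(2) end_of_in_piece[OF x] limit(1) xU xn by blast
  hence "\<exists>\<F>\<subseteq>subpieces \<U> k U. finite \<F> \<and>
      G.ends_in (below k U) - (\<Union>W\<in>\<F>. G.ends_in (below (Suc k) W)) \<subseteq> G.ends_in S"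
    by (intro end_in_block[OF limit(1) S(1)]) blast
  then obtain \<F> where \<F>: "\<F> \<subseteq> subpieces \<U> k U" "finite \<F>"
      "G.ends_in (below k U) - (\<Union>W\<in>\<F>. G.ends_in (below (Suc k) W)) \<subseteq> G.ends_in S" by (elim exE conjE)
  let ?V = "U - \<Union>\<F>"
  have V: "?V \<in> {U - \<Union>\<F> | \<F>. finite \<F> \<and> \<F> \<subseteq> subpieces \<U> k U}" using \<F> by blast
  have "openin X ?V" "x \<in> ?V"
    by (rule local_basis_atD(1,2)[OF limit_pieceD(4)[OF limit(3)] V])+
  moreover have "end_of y \<in> G.ends_in S" if y: "y \<in> ?V" for y
  proof -
    have yX: "y \<in> topspace X" using y piece_sub_topspace[OF limit(1)] by blast
    have "end_of y \<in> G.ends_in (below k U)" using end_of_in_piece[OF yX limit(1)] y by blast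
    moreover have "end_of y \<notin> G.ends_in (below (Suc k) W)" if "W \<in> \<F>" for W
      using end_of_in_piece[OF yX, of W "Suc k"] \<F>(1) y that unfolding subpieces_def by blast
    ultimately show ?thesis using \<F>(3) by blast
  qed
  ultimately show ?thesis by (intro exI[of _ ?V]) blast
qed

text \<open>This is openness of \<open>end_of\<close>: the members of the local bases, namely pieces
  and limit pieces minus finitely many subpieces, come from vertex sets with a finite cut.\<close>

lemma open_neighbourhood_end_of:
  assumes W: "openin X W" "x \<in> W"
  shows "\<exists>S. finite (edge_cut edges S) \<and> end_of x \<in> G.ends_in S \<and> G.ends_in S \<subseteq> end_of ` W"
proof -
  have x: "x \<in> topspace X" using W openin_subset by blast
  have pre: "\<exists>y\<in>topspace X. \<eta> = end_of y" if "\<eta> \<in> G.ends_in S" for \<eta> S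
    using that bij_end_of unfolding G.ends_in_def bij_betw_def by blast
  from x show ?thesis
  proof (cases rule: branch_or_limit)
    case (branch f)
    then obtain k where k: "f k \<subseteq> W" using W unfolding local_basis_at_def by blast
    have "end_of x \<in> G.ends_in (below k (f k))" using end_of_in_piece[OF x branch(1)] branch(3) by blast
    moreover have "G.ends_in (below k (f k)) \<subseteq> end_of ` W"
      using pre end_of_in_piece[OF _ branch(1)] k by blast
    ultimately show ?thesis using finite_cut_below[OF branch(1)] by blast
  next
    case (limit k U)
    have "local_basis_at X x {U - \<Union>\<F> | \<F>. finite \<F> \<and> \<F> \<subseteq> subpieces \<U> k U}"
      using limit(3) unfolding limit_piece_def by (elim conjE)
    hence "\<exists>V\<in>{U - \<Union>\<F> | \<F>. finite \<F> \<and> \<F> \<subseteq> subpieces \<U> k U}. V \<subseteq> W"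
      using W unfolding local_basis_at_def by simp
    then obtain \<F> where \<F>: "finite \<F>" "\<F> \<subseteq> subpieces \<U> k U" "U - \<Union>\<F> \<subseteq> W" by auto
    let ?S = "below k U - \<Union>(below (Suc k) ` \<F>)"
    have sub: "Y \<in> \<U> (Suc k)" "Y \<subseteq> U" if "Y \<in> \<F>" for Y using that \<F>(2) unfolding subpieces_def by auto
    have fin: "finite (edge_cut edges (\<Union>(below (Suc k) ` \<F>)))"
      using \<F>(1) sub finite_cut_below by (intro finite_edge_cut_Union) auto
    have finS: "finite (edge_cut edges ?S)" using finite_cut_below[OF limit(1)] fin by (rule finite_edge_cut_Diff)
    have eS: "\<eta> \<in> G.ends_in ?S \<longleftrightarrow> \<eta> \<in> G.ends_in (below k U) \<and> (\<forall>Y\<in>\<F>. \<eta> \<notin> G.ends_in (below (Suc k) Y))" for \<eta>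
    proof
      assume \<eta>: "\<eta> \<in> G.ends_in ?S"
      have "\<eta> \<notin> G.ends_in (below (Suc k) Y)" if "Y \<in> \<F>" for Y
      proof -
        have "?S \<inter> below (Suc k) Y = {}" using that by blast
        thus ?thesis using G.ends_in_disjoint[OF finS finite_cut_below[OF sub(1)[OF that]]] \<eta> by blast
      qed
      moreover have "\<eta> \<in> G.ends_in (below k U)" using \<eta> G.ends_in_mono[of ?S "below k U"] by blast
      ultimately show "\<eta> \<in> G.ends_in (below k U) \<and> (\<forall>Y\<in>\<F>. \<eta> \<notin> G.ends_in (below (Suc k) Y))" by blast
    next
      assume \<eta>: "\<eta> \<in> G.ends_in (below k U) \<and> (\<forall>Y\<in>\<F>. \<eta> \<notin> G.ends_in (below (Suc k) Y))"
      have "\<eta> \<notin> G.ends_in (\<Union>(below (Suc k) ` \<F>))"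
        using G.ends_in_Union[of "below (Suc k) ` \<F>" \<eta>] \<F>(1) \<eta> finite_cut_below sub(1) by blast
      hence "\<eta> \<in> G.ends_in (- \<Union>(below (Suc k) ` \<F>))"
        using G.ends_in_Compl[OF fin] \<eta> unfolding G.ends_in_def by blast
      moreover have "finite (edge_cut edges (- \<Union>(below (Suc k) ` \<F>)))" unfolding edge_cut_Compl by (rule fin)
      note G.ends_in_Int[OF finite_cut_below[OF limit(1)] this]
      ultimately have "\<eta> \<in> G.ends_in (below k U \<inter> - \<Union>(below (Suc k) ` \<F>))" using \<eta> by (metis IntI)
      thus "\<eta> \<in> G.ends_in ?S" by (simp add: Diff_eq)
    qed
    have "x \<in> U" "\<And>Y. Y \<in> \<F> \<Longrightarrow> x \<notin> Y" using limit(3) \<F>(2) unfolding limit_piece_def by blast+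
    hence "end_of x \<in> G.ends_in ?S" unfolding eS using end_of_in_piece[OF x] limit(1) sub(1) by blast
    moreover have "G.ends_in ?S \<subseteq> end_of ` W"
    proof
      fix \<eta> assume \<eta>: "\<eta> \<in> G.ends_in ?S"
      then obtain y where y: "y \<in> topspace X" "\<eta> = end_of y" using pre by blast
      hence "y \<in> U - \<Union>\<F>" using \<eta> unfolding eS using end_of_in_piece[OF y(1)] limit(1) sub(1) by blast
      thus "\<eta> \<in> end_of ` W" using \<F>(3) y by blast
    qed
    ultimately show ?thesis using finS by blast
  qed
qed

theorem homeomorphic_edge_end_space: "X homeomorphic_space edge_end_space verts edges"
proof -
  have "homeomorphic_map X (edge_end_space verts edges) end_of"
  proof (rule bijective_open_imp_homeomorphic_map)
    show "continuous_map X (edge_end_space verts edges) end_of"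
      unfolding continuous_map_def G.topspace_edge_end_space
    proof (intro conjI allI impI)
      show "end_of \<in> topspace X \<rightarrow> edge_ends verts edges" using end_of(1) by blast
      fix W assume W: "openin (edge_end_space verts edges) W"
      show "openin X {x \<in> topspace X. end_of x \<in> W}"
      proof (subst openin_subopen, intro ballI)
        fix x assume x: "x \<in> {x \<in> topspace X. end_of x \<in> W}"
        obtain S where S: "finite (edge_cut edges S)" "end_of x \<in> G.ends_in S" "G.ends_in S \<subseteq> W"
          using W x unfolding G.openin_edge_end_space by blast
        have "x \<in> topspace X" using x by simp
        then obtain V where V: "openin X V" "x \<in> V" "end_of ` V \<subseteq> G.ends_in S"
          using end_of_neighbourhood[OF _ S(1,2)] by meson
        have "V \<subseteq> {x \<in> topspace X. end_of x \<in> W}" using V S(3) openin_subset[OF V(1)] by blast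
        thus "\<exists>T. openin X T \<and> x \<in> T \<and> T \<subseteq> {x \<in> topspace X. end_of x \<in> W}" using V by blast
      qed
    qed
    show "open_map X (edge_end_space verts edges) end_of"
      unfolding open_map_def
    proof (intro allI impI)
      fix W assume W: "openin X W"
      hence "W \<subseteq> topspace X" by (rule openin_subset)
      hence "end_of ` W \<subseteq> edge_ends verts edges" using end_of(1) by blast
      thus "openin (edge_end_space verts edges) (end_of ` W)"
        unfolding G.openin_edge_end_space using open_neighbourhood_end_of[OF W] by blast
    qed
    show "end_of ` topspace X = topspace (edge_end_space verts edges)"
      using bij_end_of by (simp add: bij_betw_def G.topspace_edge_end_space)
    show "inj_on end_of (topspace X)" using bij_end_of by (simp add: bij_betw_def)
  qed
  thus ?thesis by (rule homeomorphic_map_imp_homeomorphic_space)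
qed

end

theorem piece_tree_imp_graph:
  fixes X :: "'a topology"
  assumes "piece_tree X \<U>"
  shows "\<exists>(V :: ('a \<times> nat) set) E. is_graph V E \<and> X homeomorphic_space edge_end_space V E"
proof -
  interpret tree_of_pieces X \<U> by unfold_locales (rule assms)
  show ?thesis using is_graph_pieces homeomorphic_edge_end_space by blast
qed

section \<open>Successors, limits and countable suprema of innings\<close>

section \<open>Innings\<close>

definition next_inning :: "'a inning \<Rightarrow> 'a inning" where
  "next_inning \<alpha> = (LEAST \<gamma>. \<alpha> < \<gamma>)"

definition first_inning :: "'a inning" where
  "first_inning = (LEAST \<alpha>. True)"

lemma first_inning_le [simp]: "first_inning \<le> \<alpha>"
  unfolding first_inning_def by (simp add: Least_le)

lemma not_less_first_inning [simp]: "\<not> \<alpha> < first_inning"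
  by (simp add: not_less)

lemma lessThan_first_inning [simp]: "{..<first_inning} = {}"
  by auto

lemma infinite_Field_cardSuc: "infinite (Field (cardSuc (card_of (UNIV :: ('a \<times> nat) set))))"
  using cardSuc_finite[OF card_of_Card_order, of "UNIV :: ('a \<times> nat) set"]
  by (simp add: Field_card_of finite_prod)

lemma ex_greater_inning: "\<exists>\<gamma>. (\<alpha> :: 'a inning) < \<gamma>"
proof -
  let ?r = "cardSuc (card_of (UNIV :: ('a \<times> nat) set))"
  obtain b where "b \<in> Field ?r" "Rep_inning \<alpha> \<noteq> b" "(Rep_inning \<alpha>, b) \<in> ?r"
    using infinite_Card_order_limit[OF cardSuc_Card_order infinite_Field_cardSuc, OF card_of_Card_order Rep_inning]
    by blast
  hence "\<alpha> < Abs_inning b"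
    unfolding less_inning_def less_eq_inning_def by (metis Abs_inning_inverse)
  thus ?thesis ..
qed

lemma less_next_inning [simp]: "\<alpha> < next_inning \<alpha>"
  unfolding next_inning_def by (rule LeastI_ex[OF ex_greater_inning])

lemma less_next_inning_iff: "\<beta> < next_inning \<alpha> \<longleftrightarrow> \<beta> \<le> \<alpha>"
  by (metis Least_le less_next_inning next_inning_def not_le order_le_less_trans)

lemma next_inning_le_iff: "next_inning \<alpha> \<le> \<beta> \<longleftrightarrow> \<alpha> < \<beta>"
  by (metis less_next_inning_iff not_le)

lemma next_inning_inject [simp]: "next_inning \<alpha> = next_inning \<beta> \<longleftrightarrow> \<alpha> = \<beta>"
  by (metis antisym less_next_inning less_next_inning_iff)

lemma lessThan_next_inning: "{..<next_inning \<alpha>} = insert \<alpha> {..<\<alpha>}"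
  by (auto simp: less_next_inning_iff)

lemma succ_inning_of_iff: "succ_inning_of \<gamma> \<alpha> \<longleftrightarrow> \<gamma> = next_inning \<alpha>"
  unfolding succ_inning_of_def
  by (metis less_next_inning less_next_inning_iff linorder_neqE not_le)

lemma limit_inning_iff: "limit_inning \<alpha> \<longleftrightarrow> \<alpha> \<noteq> first_inning \<and> (\<forall>\<beta>. \<alpha> \<noteq> next_inning \<beta>)"
  unfolding limit_inning_def succ_inning_of_iff
  by (metis first_inning_le not_less_first_inning order_le_less)

lemma inning_cases:
  obtains (first) "\<alpha> = first_inning" | (succ) \<beta> where "\<alpha> = next_inning \<beta>" | (limit) "limit_inning \<alpha>"
  using limit_inning_iff by blast

lemma limit_inning_next: "limit_inning \<alpha> \<Longrightarrow> \<beta> < \<alpha> \<Longrightarrow> next_inning \<beta> < \<alpha>"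
  by (metis limit_inning_iff next_inning_le_iff order_le_less)

lemma infinite_below_limit_inning:
  assumes "limit_inning \<nu>" "\<mu> < \<nu>"
  shows "infinite {\<beta>. \<mu> \<le> \<beta> \<and> \<beta> < \<nu>}"
proof
  assume fin: "finite {\<beta>. \<mu> \<le> \<beta> \<and> \<beta> < \<nu>}" (is "finite ?S")
  define M where "M = Max ?S"
  have "?S \<noteq> {}" using assms by auto
  hence "M \<in> ?S" using fin unfolding M_def by (rule Max_in[rotated])
  hence M: "\<mu> \<le> M" "M < \<nu>" by auto
  have "\<mu> \<le> next_inning M" using M(1) less_next_inning[of M] by (meson less_imp_le order_trans)
  hence "next_inning M \<in> ?S" using limit_inning_next[OF assms(1) M(2)] by simp
  hence "next_inning M \<le> M" using fin unfolding M_def by simp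
  thus False using less_next_inning[of M] by (simp add: not_le[symmetric])
qed

text \<open>Otherwise the innings would be a countable union of initial segments, each of size at
  most the infinite cardinal \<kappa> below its successor, and there would be at most \<kappa> of
  them. The bound is what gives a countable chain of positions an inning for its limit.\<close>

lemma countable_innings_bounded:
  fixes f :: "nat \<Rightarrow> 'a inning"
  shows "\<exists>\<alpha>. \<forall>k. f k \<le> \<alpha>"
proof (rule ccontr)
  assume "\<not> ?thesis"
  hence "\<exists>k. \<alpha> < f k" for \<alpha> by (metis not_le)
  hence un: "(UNIV :: 'a inning set) = (\<Union>k. {..<f k})" by auto
  let ?B = "UNIV :: ('a \<times> nat) set"
  let ?r = "cardSuc (card_of ?B)"
  have co: "Card_order ?r" by (rule cardSuc_Card_order[OF card_of_Card_order])
  have small: "(card_of {..<\<alpha>}, card_of ?B) \<in> ordLeq" for \<alpha> :: "'a inning"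
  proof -
    have "(card_of {..<\<alpha>}, card_of (underS ?r (Rep_inning \<alpha>))) \<in> ordLeq"
    proof (rule card_of_ordLeqI[of Rep_inning])
      show "inj_on Rep_inning {..<\<alpha>}" by (simp add: inj_on_def Rep_inning_inject)
      show "Rep_inning \<beta> \<in> underS ?r (Rep_inning \<alpha>)" if "\<beta> \<in> {..<\<alpha>}" for \<beta>
        using that by (auto simp: underS_def less_inning_def less_eq_inning_def Rep_inning_inject)
    qed
    moreover have "(card_of (underS ?r (Rep_inning \<alpha>)), ?r) \<in> ordLess"
      by (rule card_of_underS[OF co Rep_inning])
    hence "(card_of (underS ?r (Rep_inning \<alpha>)), card_of ?B) \<in> ordLeq"
      using cardSuc_ordLeq_ordLess[OF card_of_Card_order card_of_Card_order] by blast
    ultimately show ?thesis by (rule ordLeq_transitive)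
  qed
  have inf: "infinite ?B" by (simp add: finite_prod)
  have "(card_of (UNIV :: nat set), card_of ?B) \<in> ordLeq"
    by (rule card_of_ordLeqI[of "\<lambda>n. (undefined, n)"]) (auto simp: inj_on_def)
  hence "(card_of (\<Union>k. {..<f k}), card_of ?B) \<in> ordLeq"
    using card_of_UNION_ordLeq_infinite[OF inf, of "UNIV :: nat set" "\<lambda>k. {..<f k}"] small by blast
  hence 1: "(card_of (UNIV :: 'a inning set), card_of ?B) \<in> ordLeq" using un by simp
  have 2: "(card_of (Field ?r), card_of (UNIV :: 'a inning set)) \<in> ordLeq"
    by (rule card_of_ordLeqI[of Abs_inning]) (auto simp: inj_on_def Abs_inning_inject)
  have 3: "(?r, card_of (Field ?r)) \<in> ordLeq"
    using card_of_Field_ordIso[OF co] ordIso_iff_ordLeq by blast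
  have "(?r, card_of ?B) \<in> ordLeq" by (rule ordLeq_transitive[OF ordLeq_transitive[OF 3 2] 1])
  thus False using cardSuc_greater[OF card_of_Card_order] not_ordLess_ordLeq by blast
qed

section \<open>Comparison with \<omega>\<cdot>\<omega> by strictly increasing maps\<close>

section \<open>Order types below \<omega>\<cdot>\<omega>\<close>

definition lex_less :: "nat \<times> nat \<Rightarrow> nat \<times> nat \<Rightarrow> bool" where
  "lex_less p q \<longleftrightarrow> fst p < fst q \<or> (fst p = fst q \<and> snd p < snd q)"

lemma lex_less_omega_omega: "lex_less p q \<longleftrightarrow> (p, q) \<in> omega_omega \<and> p \<noteq> q"
  unfolding lex_less_def omega_omega_def by (cases p, cases q) auto

lemma wf_lex_less: "wf {(p, q). lex_less p q}"
proof -
  have "{(p, q). lex_less p q} = less_than <*lex*> less_than"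
    unfolding lex_less_def by (auto simp: lex_prod_def)
  thus ?thesis by (simp add: wf_lex_prod)
qed

lemma Field_omega_omega: "Field omega_omega = UNIV"
  unfolding omega_omega_def Field_def by auto

lemma Well_order_omega_omega: "Well_order omega_omega"
proof -
  have "omega_omega - Id = {(p, q). lex_less p q}" using lex_less_omega_omega by auto
  hence "wf (omega_omega - Id)" using wf_lex_less by simp
  thus ?thesis
    unfolding well_order_on_def linear_order_on_def partial_order_on_def preorder_on_def Field_omega_omega
    by (auto simp: omega_omega_def refl_on_def trans_def antisym_def total_on_def)
qed

lemma no_strict_mono_below:
  assumes mono: "\<And>p q. lex_less p q \<Longrightarrow> lex_less (g p) (g q)" and below: "lex_less (g a) a"
  shows False
proof -
  have "\<not> lex_less (g p) p" for p
    using wf_lex_less by (induction p rule: wf_induct_rule) (use mono in blast)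
  thus False using below by blast
qed

text \<open>The map \<open>h\<close> need not be onto an initial segment. If the order were not
  shorter, \<omega>\<cdot>\<omega> would embed into it, and composing with \<open>h\<close> would
  give a strictly increasing self-map of \<omega>\<cdot>\<omega> that sends \<open>a\<close> below
  \<open>a\<close>.\<close>

lemma ordLess_omega_omegaI:
  assumes r: "Well_order r"
    and h: "\<And>x y. (x, y) \<in> r \<Longrightarrow> x \<noteq> y \<Longrightarrow> lex_less (h x) (h y)"
    and bound: "\<And>x. x \<in> Field r \<Longrightarrow> lex_less (h x) a"
  shows "(r, omega_omega) \<in> ordLess"
proof (rule ccontr)
  assume "\<not> ?thesis"
  hence "(omega_omega, r) \<in> ordLeq" using not_ordLess_iff_ordLeq[OF Well_order_omega_omega r] by blast
  then obtain e where e: "embed omega_omega r e" unfolding ordLeq_def by blast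
  have cmp: "compat omega_omega r e" and inj: "inj_on e (Field omega_omega)"
    using embed_compat[OF e] embed_inj_on[OF Well_order_omega_omega e] by blast+
  have "lex_less (h (e p)) (h (e q))" if "lex_less p q" for p q
  proof (rule h)
    show "(e p, e q) \<in> r" using cmp that unfolding compat_def lex_less_omega_omega by blast
    show "e p \<noteq> e q" using inj that unfolding lex_less_omega_omega Field_omega_omega inj_on_def by blast
  qed
  moreover have "e a \<in> Field r" using embed_Field[OF e] Field_omega_omega by blast
  hence "lex_less (h (e a)) a" by (rule bound)
  ultimately show False using no_strict_mono_below[of "\<lambda>p. h (e p)" a] by blast
qed

text \<open>A strict embedding has as its image the proper initial segment below some
  \<open>a\<close>. Only strict monotonicity and this bound are kept.\<close>

lemma ordLess_omega_omegaD:
  assumes "(r, omega_omega) \<in> ordLess"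
  obtains h a where "\<And>x y. (x, y) \<in> r \<Longrightarrow> x \<noteq> y \<Longrightarrow> lex_less (h x) (h y)"
    and "\<And>x. x \<in> Field r \<Longrightarrow> lex_less (h x) a"
proof -
  obtain h where r: "Well_order r" and e: "embedS r omega_omega h"
    using assms unfolding ordLess_def by auto
  have emb: "embed r omega_omega h" using e unfolding embedS_def by blast
  have cmp: "compat r omega_omega h" and inj: "inj_on h (Field r)"
    using embed_compat[OF emb] embed_inj_on[OF r emb] by blast+
  have ss: "h ` Field r \<subset> Field omega_omega"
    using e embedS_iff[OF r emb] by blast
  have "wo_rel omega_omega" using Well_order_omega_omega by (simp add: wo_rel_def)
  moreover have "wo_rel.ofilter omega_omega (h ` Field r)"
    using embed_Field_ofilter[OF r Well_order_omega_omega emb] .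
  ultimately have "(\<exists>a\<in>Field omega_omega. h ` Field r = underS omega_omega a) \<or> h ` Field r = Field omega_omega"
    by (simp add: wo_rel.ofilter_underS_Field)
  then obtain a where a: "h ` Field r = underS omega_omega a" using ss by (elim disjE bexE) auto
  show ?thesis
  proof
    show "lex_less (h x) (h y)" if "(x, y) \<in> r" "x \<noteq> y" for x y
    proof -
      have "x \<in> Field r" "y \<in> Field r" using that(1) by (auto simp: Field_def)
      thus ?thesis using cmp inj_onD[OF inj, of x y] that unfolding lex_less_omega_omega compat_def by blast
    qed
    show "lex_less (h x) a" if "x \<in> Field r" for x
    proof -
      have "h x \<in> underS omega_omega a" using a that by blast
      thus ?thesis unfolding underS_def lex_less_omega_omega by blast
    qed
  qed
qed

section \<open>Positions, their current sets and the tree they form\<close>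

section \<open>Positions of the game\<close>

text \<open>The factor \<open>topspace X\<close> gives the right value at the empty sequence, where
  the intersection over no moves is \<open>UNIV\<close>.\<close>

definition current :: "'a topology \<Rightarrow> 'a bob_seq \<Rightarrow> 'a set" where
  "current X s = topspace X \<inter> \<Inter>(ran s)"

lemma strategy_domD:
  assumes "s \<in> strategy_dom X \<sigma>"
  shows "dom s = {..<seq_length s}"
    and "\<beta> < seq_length s \<Longrightarrow> legal_move X (s |` {..<\<beta>}) (\<sigma> (s |` {..<\<beta>}))"
    and "\<beta> < seq_length s \<Longrightarrow> the (s \<beta>) \<in> parts (\<sigma> (s |` {..<\<beta>}))"
proof -
  obtain \<alpha> where \<alpha>: "dom s = {..<\<alpha>}"
    and *: "\<forall>\<beta><\<alpha>. legal_move X (s |` {..<\<beta>}) (\<sigma> (s |` {..<\<beta>})) \<and> the (s \<beta>) \<in> parts (\<sigma> (s |` {..<\<beta>}))"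
    using assms unfolding strategy_dom_def by blast
  have len: "seq_length s = \<alpha>" using \<alpha> by (rule seq_length_eq)
  show "dom s = {..<seq_length s}" using \<alpha> len by simp
  show "\<beta> < seq_length s \<Longrightarrow> legal_move X (s |` {..<\<beta>}) (\<sigma> (s |` {..<\<beta>}))"
    "\<beta> < seq_length s \<Longrightarrow> the (s \<beta>) \<in> parts (\<sigma> (s |` {..<\<beta>}))" using * len by auto
qed

lemma strategy_dom_at: "s \<in> strategy_dom X \<sigma> \<Longrightarrow> \<beta> < seq_length s \<Longrightarrow> s \<beta> = Some (the (s \<beta>))"
  using strategy_domD(1)[of s X \<sigma>] by (metis domIff lessThan_iff option.collapse)

lemma strategy_dom_ran:
  assumes s: "s \<in> strategy_dom X \<sigma>"
  shows "ran s = {the (s \<beta>) | \<beta>. \<beta> < seq_length s}"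
proof (intro equalityI subsetI)
  fix U assume "U \<in> ran s"
  then obtain \<beta> where "s \<beta> = Some U" unfolding ran_def by blast
  moreover then have "\<beta> < seq_length s" using strategy_domD(1)[OF s] by blast
  ultimately show "U \<in> {the (s \<beta>) | \<beta>. \<beta> < seq_length s}" by (metis (mono_tags, lifting) mem_Collect_eq option.sel)
next
  fix U assume "U \<in> {the (s \<beta>) | \<beta>. \<beta> < seq_length s}"
  then obtain \<beta> where "\<beta> < seq_length s" "U = the (s \<beta>)" by blast
  thus "U \<in> ran s" using strategy_dom_at[OF s] by (metis ranI)
qed

lemma strategy_domI:
  assumes "dom s = {..<\<alpha>}"
    and "\<And>\<beta>. \<beta> < \<alpha> \<Longrightarrow> legal_move X (s |` {..<\<beta>}) (\<sigma> (s |` {..<\<beta>}))"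
    and "\<And>\<beta>. \<beta> < \<alpha> \<Longrightarrow> the (s \<beta>) \<in> parts (\<sigma> (s |` {..<\<beta>}))"
  shows "s \<in> strategy_dom X \<sigma>"
  unfolding strategy_dom_def using assms by blast

lemma empty_in_strategy_dom: "Map.empty \<in> strategy_dom X \<sigma>"
  by (rule strategy_domI[of _ first_inning]) auto

lemma seq_length_empty [simp]: "seq_length Map.empty = first_inning"
  by (rule seq_length_eq) simp

lemma seq_length_restrict:
  assumes "s \<in> strategy_dom X \<sigma>" "\<beta> \<le> seq_length s"
  shows "dom (s |` {..<\<beta>}) = {..<\<beta>}" "seq_length (s |` {..<\<beta>}) = \<beta>"
proof -
  show "dom (s |` {..<\<beta>}) = {..<\<beta>}" using strategy_domD(1)[OF assms(1)] assms(2) by auto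
  thus "seq_length (s |` {..<\<beta>}) = \<beta>" by (rule seq_length_eq)
qed

lemma restrict_restrict_less: "\<gamma> \<le> \<beta> \<Longrightarrow> (s |` {..<\<beta>}) |` {..<\<gamma>} = s |` {..<(\<gamma> :: 'a inning)}"
  by (simp add: Int_absorb1 lessThan_subset_iff Int_commute)

lemma restrict_in_strategy_dom:
  assumes s: "s \<in> strategy_dom X \<sigma>" and \<beta>: "\<beta> \<le> seq_length s"
  shows "s |` {..<\<beta>} \<in> strategy_dom X \<sigma>"
proof (rule strategy_domI)
  show "dom (s |` {..<\<beta>}) = {..<\<beta>}" using seq_length_restrict assms by blast
  fix \<gamma> assume \<gamma>: "\<gamma> < \<beta>"
  hence "(s |` {..<\<beta>}) |` {..<\<gamma>} = s |` {..<\<gamma>}" by (intro restrict_restrict_less) simp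
  moreover have "\<gamma> < seq_length s" "(s |` {..<\<beta>}) \<gamma> = s \<gamma>" using \<gamma> \<beta> by auto
  ultimately show "legal_move X ((s |` {..<\<beta>}) |` {..<\<gamma>}) (\<sigma> ((s |` {..<\<beta>}) |` {..<\<gamma>}))"
    "the ((s |` {..<\<beta>}) \<gamma>) \<in> parts (\<sigma> ((s |` {..<\<beta>}) |` {..<\<gamma>}))"
    using strategy_domD(2,3)[OF s] by simp_all
qed

lemma restrict_full: "s \<in> strategy_dom X \<sigma> \<Longrightarrow> s |` {..<seq_length s} = s"
  by (metis strategy_domD(1) restrict_map_def domIff ext)

lemma legal_move_cases:
  assumes "legal_move X s m"
  obtains (first) P where "m = Partition P" "s = Map.empty" "open_partition_on X (topspace X) P"
  | (succ) P \<beta> where "m = Partition P" "seq_length s = next_inning \<beta>" "open_partition_on X (the (s \<beta>)) P"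
  | (limit) P x where "m = Partition_Point P x" "limit_inning (seq_length s)" "legal_limit_move X s P x"
  using assms unfolding legal_move_def succ_inning_of_iff by (auto split: alice_move.splits)

lemma legal_parts:
  assumes m: "legal_move X s m" and V: "V \<in> parts m"
  shows "openin X V \<and> V \<noteq> {}"
  using m V by (cases rule: legal_move_cases)
    (auto simp: open_partition_on_def partition_on_def legal_limit_move_def)

lemma bob_moves:
  assumes s: "s \<in> strategy_dom X \<sigma>" and \<beta>: "\<beta> < seq_length s"
  shows "openin X (the (s \<beta>))" "the (s \<beta>) \<noteq> {}"
  using legal_parts strategy_domD(2,3)[OF s \<beta>] by blast+

lemma bob_moves_decreasing:
  assumes s: "s \<in> strategy_dom X \<sigma>" and \<beta>: "\<gamma> \<le> \<beta>" "\<beta> < seq_length s"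
  shows "the (s \<beta>) \<subseteq> the (s \<gamma>)"
  using \<beta>
proof (induction \<beta> rule: less_induct)
  case (less \<beta>)
  show ?case
  proof (cases "\<gamma> = \<beta>")
    case False
    hence \<gamma>: "\<gamma> < \<beta>" using less.prems by simp
    let ?t = "s |` {..<\<beta>}"
    have len: "seq_length ?t = \<beta>" using seq_length_restrict[OF s] less.prems by simp
    have V: "the (s \<beta>) \<in> parts (\<sigma> ?t)" using strategy_domD(3)[OF s] less.prems by blast
    from strategy_domD(2)[OF s less.prems(2)] show ?thesis
    proof (cases rule: legal_move_cases)
      case (first P)
      then have "\<beta> = first_inning" using len by simp
      then show ?thesis using \<gamma> by simp
    next
      case (succ P \<delta>)
      then have \<delta>: "\<beta> = next_inning \<delta>" using len by simp
      hence "\<delta> < \<beta>" "\<gamma> \<le> \<delta>" using \<gamma> by (simp_all add: less_next_inning_iff)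
      have "?t \<delta> = s \<delta>" using \<open>\<delta> < \<beta>\<close> by simp
      hence "the (s \<beta>) \<subseteq> the (s \<delta>)"
        using succ V unfolding open_partition_on_def partition_on_def by auto
      moreover have "the (s \<delta>) \<subseteq> the (s \<gamma>)"
        using less.IH[OF \<open>\<delta> < \<beta>\<close> \<open>\<gamma> \<le> \<delta>\<close>] \<open>\<delta> < \<beta>\<close> less.prems(2) by simp
      ultimately show ?thesis by blast
    next
      case (limit P x)
      have "?t \<gamma> = s \<gamma>" using \<gamma> by simp
      hence "the (s \<gamma>) \<in> ran ?t"
        using strategy_dom_at[OF s, of \<gamma>] \<gamma> less.prems(2) by (metis ranI less_trans)
      moreover have "the (s \<beta>) \<subseteq> \<Inter>(ran ?t)"
        using limit V unfolding legal_limit_move_def by auto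
      ultimately show ?thesis by blast
    qed
  qed simp
qed

lemma current_empty [simp]: "current X Map.empty = topspace X"
  unfolding current_def by simp

lemma current_succ:
  assumes s: "s \<in> strategy_dom X \<sigma>" and len: "seq_length s = next_inning \<beta>"
  shows "current X s = the (s \<beta>)"
proof -
  have \<beta>: "\<beta> < seq_length s" using len by simp
  have "the (s \<beta>) \<subseteq> topspace X" using bob_moves(1)[OF s \<beta>] openin_subset by blast
  moreover have "the (s \<beta>) \<subseteq> U" if "U \<in> ran s" for U
    using that bob_moves_decreasing[OF s _ \<beta>] unfolding strategy_dom_ran[OF s] len
    by (auto simp: less_next_inning_iff)
  moreover have "the (s \<beta>) \<in> ran s" using \<beta> unfolding strategy_dom_ran[OF s] by blast
  ultimately show ?thesis unfolding current_def by blast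
qed

lemma current_subset: "s \<in> strategy_dom X \<sigma> \<Longrightarrow> \<beta> < seq_length s \<Longrightarrow> current X s \<subseteq> the (s \<beta>)"
  using strategy_dom_ran[of s X \<sigma>] unfolding current_def by blast

lemma seq_length_first_iff: "s \<in> strategy_dom X \<sigma> \<Longrightarrow> seq_length s = first_inning \<longleftrightarrow> s = Map.empty"
  using strategy_domD(1)[of s X \<sigma>] by auto

lemma legal_nonlimit:
  assumes s: "s \<in> strategy_dom X \<sigma>" and l: "legal_move X s m" and nl: "\<not> limit_inning (seq_length s)"
  obtains P where "m = Partition P" "partition_on (current X s) P" "\<And>V. V \<in> P \<Longrightarrow> openin X V"
  using l
proof (cases rule: legal_move_cases)
  case (first P)
  then show ?thesis using that unfolding open_partition_on_def by simp
next
  case (succ P \<beta>)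
  then show ?thesis using that current_succ[OF s succ(2)] unfolding open_partition_on_def by simp
qed (use nl in simp)

lemma legal_nonlimitI:
  assumes s: "s \<in> strategy_dom X \<sigma>" and nl: "\<not> limit_inning (seq_length s)"
    and P: "partition_on (current X s) P" "\<And>V. V \<in> P \<Longrightarrow> openin X V"
  shows "legal_move X s (Partition P)"
proof (cases "seq_length s" rule: inning_cases)
  case first
  then show ?thesis using P seq_length_first_iff[OF s] unfolding legal_move_def open_partition_on_def by simp
next
  case (succ \<beta>)
  then show ?thesis
    using P current_succ[OF s succ] unfolding legal_move_def open_partition_on_def succ_inning_of_iff by simp
qed (use nl in simp)

lemma legal_subset_current:
  assumes s: "s \<in> strategy_dom X \<sigma>" and m: "legal_move X s m" and V: "V \<in> parts m"
  shows "V \<subseteq> current X s"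
proof (cases "limit_inning (seq_length s)")
  case True
  from m show ?thesis
  proof (cases rule: legal_move_cases)
    case (limit P x)
    have "V \<subseteq> \<Inter>(ran s)" using limit V unfolding legal_limit_move_def by auto
    moreover have "V \<subseteq> topspace X" using legal_parts[OF m V] openin_subset by blast
    ultimately show ?thesis unfolding current_def by blast
  qed (use True in \<open>auto simp: limit_inning_iff\<close>)
next
  case False
  obtain P where "m = Partition P" "partition_on (current X s) P" using legal_nonlimit[OF s m False] by blast
  then show ?thesis using V unfolding partition_on_def by auto
qed

lemma extend_position:
  assumes s: "s \<in> strategy_dom X \<sigma>" and m: "legal_move X s (\<sigma> s)" and V: "V \<in> parts (\<sigma> s)"
  shows "s(seq_length s \<mapsto> V) \<in> strategy_dom X \<sigma>"
    and "seq_length (s(seq_length s \<mapsto> V)) = next_inning (seq_length s)"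
    and "s(seq_length s \<mapsto> V) |` {..<seq_length s} = s"
    and "current X (s(seq_length s \<mapsto> V)) = V"
proof -
  let ?l = "seq_length s" let ?t = "s(?l \<mapsto> V)"
  have d: "dom s = {..<?l}" using strategy_domD(1)[OF s] .
  have dt: "dom ?t = {..<next_inning ?l}" using d by (auto simp: lessThan_next_inning)
  have r: "?t |` {..<\<beta>} = s |` {..<\<beta>}" if "\<beta> \<le> ?l" for \<beta>
    using that by (auto simp: restrict_map_def fun_eq_iff)
  show rl: "?t |` {..<?l} = s" using r[of ?l] restrict_full[OF s] by simp
  show t: "?t \<in> strategy_dom X \<sigma>"
  proof (rule strategy_domI[OF dt])
    fix \<beta> assume "\<beta> < next_inning ?l"
    hence \<beta>: "\<beta> \<le> ?l" by (simp add: less_next_inning_iff)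
    show "legal_move X (?t |` {..<\<beta>}) (\<sigma> (?t |` {..<\<beta>}))"
    proof (cases "\<beta> = ?l")
      case True
      then show ?thesis using rl m by simp
    next
      case False
      then show ?thesis using r[OF \<beta>] strategy_domD(2)[OF s, of \<beta>] \<beta> by simp
    qed
    show "the (?t \<beta>) \<in> parts (\<sigma> (?t |` {..<\<beta>}))"
    proof (cases "\<beta> = ?l")
      case True
      then show ?thesis using rl V by simp
    next
      case False
      then show ?thesis using r[OF \<beta>] strategy_domD(3)[OF s, of \<beta>] \<beta> by simp
    qed
  qed
  show l: "seq_length ?t = next_inning ?l" using dt by (rule seq_length_eq)
  show "current X ?t = V" using current_succ[OF t l] by simp
qed

lemma map_le_restrict:
  assumes t: "t \<in> strategy_dom X \<sigma>" and s: "s \<in> strategy_dom X \<sigma>" and le: "t \<subseteq>\<^sub>m s"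
  shows "t = s |` {..<seq_length t}" "seq_length t \<le> seq_length s"
proof -
  show "t = s |` {..<seq_length t}"
  proof
    fix \<beta> show "t \<beta> = (s |` {..<seq_length t}) \<beta>"
      using le strategy_domD(1)[OF t] unfolding map_le_def restrict_map_def
      by (cases "\<beta> \<in> dom t") auto
  qed
  have "dom t \<subseteq> dom s" using le by (rule map_le_implies_dom_le)
  thus "seq_length t \<le> seq_length s"
    using strategy_domD(1)[OF t] strategy_domD(1)[OF s] by (simp add: lessThan_subset_iff)
qed

lemma map_le_length_less:
  assumes "t \<in> strategy_dom X \<sigma>" "s \<in> strategy_dom X \<sigma>" "t \<subseteq>\<^sub>m s" "t \<noteq> s"
  shows "seq_length t < seq_length s"
  using map_le_restrict[OF assms(1-3)] restrict_full[OF assms(2)] assms(4) by (metis order_le_less)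

lemma restrict_map_le: "s |` A \<subseteq>\<^sub>m s"
  by (auto simp: map_le_def)

lemma succ_dom_iff:
  "s \<in> succ_dom X \<sigma> \<longleftrightarrow> s \<in> strategy_dom X \<sigma> \<and> \<not> limit_inning (seq_length s)"
proof
  assume "s \<in> succ_dom X \<sigma>"
  thus "s \<in> strategy_dom X \<sigma> \<and> \<not> limit_inning (seq_length s)"
    unfolding succ_dom_def succ_inning_of_iff
    using empty_in_strategy_dom by (auto simp: limit_inning_iff)
next
  assume s: "s \<in> strategy_dom X \<sigma> \<and> \<not> limit_inning (seq_length s)"
  thus "s \<in> succ_dom X \<sigma>"
    unfolding succ_dom_def succ_inning_of_iff limit_inning_iff using seq_length_first_iff by blast
qed

lemma not_limit_next [simp]: "\<not> limit_inning (next_inning \<beta>)"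
  by (simp add: limit_inning_iff)

text \<open>Between a node and any longer one lies a sequence with exactly one more move; its length
  is a successor, so it belongs to the tree even when limit positions do not. Together with
  \<open>extension_immediate_succ\<close>, a node branches exactly when Alice offers at least two
  parts there.\<close>

lemma immediate_succ_imp_extension:
  assumes t: "t \<in> succ_dom X \<sigma>" and s: "s \<in> immediate_succs (succ_dom X \<sigma>) (\<subseteq>\<^sub>m) t"
  shows "\<exists>V\<in>parts (\<sigma> t). s = t(seq_length t \<mapsto> V)"
proof -
  let ?T = "succ_dom X \<sigma>"
  have sT: "s \<in> ?T" and le: "t \<subseteq>\<^sub>m s" "t \<noteq> s"
    and no: "\<not> (\<exists>u\<in>?T. t \<in> strict_preds ?T (\<subseteq>\<^sub>m) u \<and> u \<in> strict_preds ?T (\<subseteq>\<^sub>m) s)"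
    using s unfolding immediate_succs_def strict_preds_def by auto
  have td: "t \<in> strategy_dom X \<sigma>" and sd: "s \<in> strategy_dom X \<sigma>" using t sT by (auto simp: succ_dom_iff)
  have lt: "seq_length t < seq_length s" using map_le_length_less[OF td sd le] .
  have teq: "t = s |` {..<seq_length t}" using map_le_restrict[OF td sd le(1)] by blast
  let ?u = "s |` {..<next_inning (seq_length t)}"
  have nle: "next_inning (seq_length t) \<le> seq_length s" using lt by (simp add: next_inning_le_iff)
  have u: "?u \<in> strategy_dom X \<sigma>" "seq_length ?u = next_inning (seq_length t)"
    using restrict_in_strategy_dom[OF sd nle] seq_length_restrict[OF sd nle] by auto
  have uT: "?u \<in> ?T" using u by (simp add: succ_dom_iff)
  have tu: "t \<subseteq>\<^sub>m ?u"
    unfolding map_le_def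
  proof
    fix \<beta> assume "\<beta> \<in> dom t"
    hence "\<beta> < seq_length t" using strategy_domD(1)[OF td] by blast
    moreover hence "\<beta> < next_inning (seq_length t)" by (simp add: less_next_inning_iff)
    ultimately show "t \<beta> = ?u \<beta>" by (subst teq) simp
  qed
  have "t \<noteq> ?u"
  proof
    assume "t = ?u"
    hence "seq_length t = next_inning (seq_length t)" using u(2) by metis
    thus False using less_next_inning[of "seq_length t"] by simp
  qed
  hence "?u = s" using no uT tu restrict_map_le[of s] t unfolding strict_preds_def by blast
  have ls: "seq_length s = next_inning (seq_length t)" using \<open>?u = s\<close> u(2) by simp
  have "s = t(seq_length t \<mapsto> the (s (seq_length t)))"
  proof
    fix \<beta>
    consider "\<beta> < seq_length t" | "\<beta> = seq_length t" | "seq_length t < \<beta>" by (rule linorder_less_linear[THEN disjE]) auto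
    thus "s \<beta> = (t(seq_length t \<mapsto> the (s (seq_length t)))) \<beta>"
    proof cases
      case 1
      then show ?thesis by (subst teq) simp
    next
      case 2
      then show ?thesis using strategy_dom_at[OF sd lt] by simp
    next
      case 3
      then have "\<beta> \<notin> dom s" "\<beta> \<notin> dom t"
        using strategy_domD(1)[OF sd] strategy_domD(1)[OF td] ls by (auto simp: less_next_inning_iff)
      then show ?thesis using 3 by (auto simp: domIff)
    qed
  qed
  moreover have "the (s (seq_length t)) \<in> parts (\<sigma> t)" using strategy_domD(3)[OF sd lt] teq by simp
  ultimately show ?thesis by blast
qed

lemma extension_immediate_succ:
  assumes t: "t \<in> succ_dom X \<sigma>" and m: "legal_move X t (\<sigma> t)" and V: "V \<in> parts (\<sigma> t)"
  shows "t(seq_length t \<mapsto> V) \<in> immediate_succs (succ_dom X \<sigma>) (\<subseteq>\<^sub>m) t"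
proof -
  let ?T = "succ_dom X \<sigma>" let ?s = "t(seq_length t \<mapsto> V)"
  have td: "t \<in> strategy_dom X \<sigma>" using t by (simp add: succ_dom_iff)
  note e = extend_position[OF td m V]
  have sT: "?s \<in> ?T" using e by (simp add: succ_dom_iff)
  have le: "t \<subseteq>\<^sub>m ?s" using restrict_map_le[of ?s "{..<seq_length t}"] e(3) by simp
  have "t \<noteq> ?s"
  proof
    assume "t = ?s"
    hence "seq_length t = next_inning (seq_length t)" using e(2) by metis
    thus False using less_next_inning[of "seq_length t"] by simp
  qed
  moreover have False if u: "u \<in> ?T" "t \<subseteq>\<^sub>m u" "t \<noteq> u" "u \<subseteq>\<^sub>m ?s" "u \<noteq> ?s" for u
  proof -
    have ud: "u \<in> strategy_dom X \<sigma>" using u(1) by (simp add: succ_dom_iff)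
    have "seq_length t < seq_length u" "seq_length u < next_inning (seq_length t)"
      using map_le_length_less[OF td ud u(2,3)] map_le_length_less[OF ud e(1) u(4,5)] e(2) by auto
    thus False by (simp add: less_next_inning_iff)
  qed
  ultimately show ?thesis using sT t le unfolding immediate_succs_def strict_preds_def by blast
qed

section \<open>Playing along a tree of pieces\<close>

section \<open>From trees of pieces to strategies\<close>

lemma position_order:
  assumes t: "t \<in> succ_dom X \<sigma>"
  shows "Well_order (order_on (strict_preds (succ_dom X \<sigma>) (\<subseteq>\<^sub>m) t) (\<subseteq>\<^sub>m))"
    and "Field (order_on (strict_preds (succ_dom X \<sigma>) (\<subseteq>\<^sub>m) t) (\<subseteq>\<^sub>m)) = strict_preds (succ_dom X \<sigma>) (\<subseteq>\<^sub>m) t"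
proof -
  let ?T = "succ_dom X \<sigma>" let ?S = "{s \<in> ?T. s \<subseteq>\<^sub>m t}" let ?P = "strict_preds ?T (\<subseteq>\<^sub>m) t"
  have wo: "well_order_on ?S (order_on ?S (\<subseteq>\<^sub>m))"
    using succ_dom_is_tree[of X \<sigma>] t unfolding is_tree_def by blast
  have sub: "?P \<subseteq> ?S" unfolding strict_preds_def by blast
  have ord: "order_on ?P (\<subseteq>\<^sub>m) = Restr (order_on ?S (\<subseteq>\<^sub>m)) ?P"
    using sub unfolding order_on_def by blast
  have FS: "Field (order_on ?S (\<subseteq>\<^sub>m)) = ?S" by (auto simp: Field_def order_on_def)
  show "Field (order_on ?P (\<subseteq>\<^sub>m)) = ?P" by (auto simp: Field_def order_on_def)
  show "Well_order (order_on ?P (\<subseteq>\<^sub>m))"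
    unfolding ord by (rule Well_order_Restr) (use wo FS in simp)
qed

context tree_of_pieces
begin

definition all_pieces :: "'a set set" where
  "all_pieces = (\<Union>k. \<U> k)"

text \<open>
  A set may be a piece of several consecutive levels. Its subpieces are taken at the last of these
  levels; if there is no last one, then the set is a singleton.
\<close>

definition proper_subpieces :: "'a set \<Rightarrow> 'a set set" where
  "proper_subpieces W = {Y. \<exists>k. W \<in> \<U> k \<and> W \<notin> \<U> (Suc k) \<and> Y \<in> subpieces \<U> k W}"

text \<open>The piece of level \<open>i\<close> above \<open>W\<close> is squeezed between the two
  occurrences of \<open>W\<close>.\<close>

lemma piece_levels_convex:
  assumes "W \<in> \<U> k" "W \<in> \<U> j" "k \<le> i" "i \<le> j"
  shows "W \<in> \<U> i"
proof -
  obtain Y where Y: "Y \<in> \<U> i" "W \<subseteq> Y" using ancestor[OF assms(2,4)] by blast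
  obtain x where "x \<in> W" using piece_open assms(1) by blast
  hence "Y \<subseteq> W" using nested[OF assms(1) Y(1) assms(3), of x] Y(2) by blast
  thus ?thesis using Y by (metis subset_antisym)
qed

lemma last_level_unique:
  assumes "W \<in> \<U> k" "W \<notin> \<U> (Suc k)" "W \<in> \<U> j"
  shows "j \<le> k"
  using piece_levels_convex[OF assms(1,3), of "Suc k"] assms(2) by (cases "j \<le> k") auto

lemma proper_subpieces_last:
  assumes "W \<in> \<U> k" "W \<notin> \<U> (Suc k)"
  shows "proper_subpieces W = subpieces \<U> k W"
proof -
  have "j = k" if "W \<in> \<U> j" "W \<notin> \<U> (Suc j)" for j
    using last_level_unique[OF assms that(1)] last_level_unique[OF that assms(1)] by simp
  thus ?thesis using assms unfolding proper_subpieces_def by blast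
qed

lemma proper_subpiecesD:
  assumes "Y \<in> proper_subpieces W"
  shows "Y \<in> all_pieces" "Y \<subset> W" "Y \<noteq> {}" "openin X Y"
  using assms piece_open unfolding proper_subpieces_def subpieces_def all_pieces_def by blast+

lemma disjoint_proper_subpieces: "disjoint (proper_subpieces W)"
proof (cases "\<exists>k. W \<in> \<U> k \<and> W \<notin> \<U> (Suc k)")
  case True
  then obtain k where "W \<in> \<U> k" "W \<notin> \<U> (Suc k)" by blast
  hence "proper_subpieces W \<subseteq> \<U> (Suc k)" unfolding proper_subpieces_last[of W k] subpieces_def
    using proper_subpieces_last[of W k] by (auto simp: subpieces_def)
  thus ?thesis using level_disjoint[of "Suc k"] by (rule pairwise_subset[rotated])
next
  case False
  hence "proper_subpieces W = {}" unfolding proper_subpieces_def by blast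
  thus ?thesis by simp
qed

lemma proper_subpieces_singleton [simp]: "proper_subpieces {x} = {}"
  using proper_subpiecesD(2,3)[of _ "{x}"] by blast

lemma piece_openin: "W \<in> all_pieces \<Longrightarrow> openin X W"
  and piece_nonempty: "W \<in> all_pieces \<Longrightarrow> W \<noteq> {}"
  using piece_open unfolding all_pieces_def by blast+

text \<open>A piece with no last level is the tail of a branch on which it is constant, so it
  shrinks to a point only by being an open singleton; this is a limit piece without
  subpieces.\<close>

lemma proper_subpieces_cases:
  assumes W: "W \<in> all_pieces"
  shows "\<Union>(proper_subpieces W) = W \<or> (\<exists>x. limit_piece X W (proper_subpieces W) x)"
proof -
  obtain j where j: "W \<in> \<U> j" using W unfolding all_pieces_def by blast
  show ?thesis
  proof (cases "\<exists>k. W \<in> \<U> k \<and> W \<notin> \<U> (Suc k)")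
    case True
    then show ?thesis using piece_cases proper_subpieces_last by metis
  next
    case False
    have all: "W \<in> \<U> i" if "j \<le> i" for i
      using that by (induction i rule: dec_induct) (use j False in blast)+
    \<comment> \<open>The levels before \<open>j\<close> are filled with ancestors of
      \<open>W\<close> to obtain a branch that starts at the root.\<close>
    define f where "f i = (if j \<le> i then W else (SOME Y. Y \<in> \<U> i \<and> W \<subseteq> Y))" for i
    have f: "f i \<in> \<U> i \<and> W \<subseteq> f i" for i
    proof (cases "j \<le> i")
      case False
      have "\<exists>Y. Y \<in> \<U> i \<and> W \<subseteq> Y" using ancestor[OF j, of i] False by auto
      hence "(SOME Y. Y \<in> \<U> i \<and> W \<subseteq> Y) \<in> \<U> i \<and> W \<subseteq> (SOME Y. Y \<in> \<U> i \<and> W \<subseteq> Y)" by (rule someI_ex)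
      thus ?thesis using False unfolding f_def by simp
    qed (use all f_def in simp)
    obtain w where w: "w \<in> W" using piece_nonempty W by blast
    have "f (Suc i) \<subseteq> f i" for i using nested[of "f i" i "f (Suc i)" "Suc i" w] f w by auto
    then obtain x where x: "\<Inter>(range f) = {x}" using branch_point[of f] f by blast
    have "W \<subseteq> \<Inter>(range f)" using f by blast
    moreover have "\<Inter>(range f) \<subseteq> W" unfolding f_def by (auto dest: spec[of _ j])
    ultimately have Wx: "W = {x}" using x by (metis subset_antisym)
    have "openin X {x}" using piece_openin[OF W] Wx by simp
    hence "limit_piece X {x} {} x"
      unfolding limit_piece_def local_basis_at_def by auto
    thus ?thesis using Wx by auto
  qed
qed

text \<open>The local basis of a limit move takes finite unions of pieces away from every earlier
  move, not only from the intersection; closedness keeps these differences open. Inside its parent,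
  the complement of a piece is the union of its siblings or a member of the local basis of the limit
  point.\<close>

lemma piece_closed: "W \<in> \<U> k \<Longrightarrow> closedin X W"
proof (induction k arbitrary: W)
  case 0
  then show ?case using level0 by simp
next
  case (Suc k)
  obtain U where U: "U \<in> \<U> k" "W \<subseteq> U" using parent Suc.prems by blast
  have W: "W \<in> subpieces \<U> k U" using U Suc.prems unfolding subpieces_def by blast
  have "openin X (U - W)"
    using piece_cases[OF U(1)]
  proof
    assume un: "\<Union>(subpieces \<U> k U) = U"
    have "U - W = \<Union>(subpieces \<U> k U - {W})"
    proof -
      have "Y \<inter> W = {}" if "Y \<in> subpieces \<U> k U" "Y \<noteq> W" for Y
        using disjointD[OF level_disjoint, of Y "Suc k" W] that W unfolding subpieces_def by blast
      thus ?thesis using un by blast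
    qed
    moreover have "openin X (\<Union>(subpieces \<U> k U - {W}))"
      using piece_open unfolding subpieces_def by (intro openin_Union) blast
    ultimately show ?thesis by simp
  next
    assume "\<exists>x. limit_piece X U (subpieces \<U> k U) x"
    then obtain x where x: "limit_piece X U (subpieces \<U> k U) x" by blast
    have "U - \<Union>{W} \<in> {U - \<Union>\<F> | \<F>. finite \<F> \<and> \<F> \<subseteq> subpieces \<U> k U}"
      using W by (intro CollectI exI[of _ "{W}"]) simp
    thus ?thesis using local_basis_atD(1)[OF limit_pieceD(4)[OF x]] by simp
  qed
  moreover have "openin X (topspace X - U)" using Suc.IH[OF U(1)] by (rule openin_diff[OF openin_topspace])
  moreover have "topspace X - W = (topspace X - U) \<union> (U - W)" using U piece_sub_topspace by blast
  ultimately have "openin X (topspace X - W)" by (simp add: openin_Un)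
  thus ?case using piece_sub_topspace[OF Suc.prems] by (simp add: closedin_def)
qed

definition first_level :: "'a set \<Rightarrow> nat" where
  "first_level W = (LEAST k. W \<in> \<U> k)"

lemma first_level_less:
  assumes "Y \<in> all_pieces" "W \<in> all_pieces" "Y \<subset> W"
  shows "first_level W < first_level Y"
proof -
  have W: "W \<in> \<U> (first_level W)" and Y: "Y \<in> \<U> (first_level Y)"
    unfolding first_level_def using assms unfolding all_pieces_def by (auto intro: LeastI)
  obtain x where "x \<in> Y" using piece_nonempty assms(1) by blast
  thus ?thesis using nested[OF Y W, of x] assms(3) by (cases "first_level Y \<le> first_level W") auto
qed

text \<open>At every limit position that is reached, exactly one point is left over, so
  \<open>THE\<close> is well defined there (\<open>legal_at_limit\<close>). An open singleton is not
  the union of its empty set of proper subpieces: Alice waits on it and wins at the next limit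
  inning.\<close>

definition strategy :: "'a bob_seq \<Rightarrow> 'a alice_move" where
  "strategy s = (let W = current X s in
     if limit_inning (seq_length s)
     then Partition_Point (proper_subpieces W) (THE x. x \<in> W - \<Union>(proper_subpieces W))
     else if \<Union>(proper_subpieces W) = W then Partition (proper_subpieces W) else Partition {W})"

lemma parts_strategy:
  assumes "V \<in> parts (strategy s)"
  shows "V \<in> proper_subpieces (current X s) \<or> (V = current X s \<and> \<not> limit_inning (seq_length s))"
  using assms unfolding strategy_def Let_def by (auto split: if_splits)

lemma moves_are_pieces:
  assumes s: "s \<in> strategy_dom X strategy" and \<beta>: "\<beta> < seq_length s"
  shows "the (s \<beta>) \<in> all_pieces"
  using \<beta>
proof (induction \<beta> rule: less_induct)
  case (less \<beta>)
  let ?t = "s |` {..<\<beta>}"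
  have le: "\<beta> \<le> seq_length s" using less.prems by simp
  have t: "?t \<in> strategy_dom X strategy" "seq_length ?t = \<beta>"
    using restrict_in_strategy_dom[OF s le] seq_length_restrict[OF s le] by auto
  have "the (s \<beta>) \<in> parts (strategy ?t)" using strategy_domD(3)[OF s less.prems] .
  hence "the (s \<beta>) \<in> proper_subpieces (current X ?t) \<or> (the (s \<beta>) = current X ?t \<and> \<not> limit_inning \<beta>)"
    using parts_strategy[of "the (s \<beta>)" ?t] t(2) by simp
  then consider "the (s \<beta>) \<in> proper_subpieces (current X ?t)"
    | "the (s \<beta>) = current X ?t" "\<not> limit_inning \<beta>" by blast
  thus ?case
  proof cases
    case 1
    then show ?thesis by (rule proper_subpiecesD)
  next
    case 2
    show ?thesis
    proof (cases \<beta> rule: inning_cases)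
      case first
      then have "?t = Map.empty" using t seq_length_first_iff by metis
      then show ?thesis using 2 level0 unfolding all_pieces_def by auto
    next
      case (succ \<delta>)
      then have "current X ?t = the (s \<delta>)" using current_succ[OF t(1), of \<delta>] t(2) by simp
      moreover have "\<delta> < \<beta>" using succ by simp
      ultimately show ?thesis using less.IH[of \<delta>] less.prems 2(1) by simp
    qed (use 2 in simp)
  qed
qed

lemma current_piece:
  assumes s: "s \<in> strategy_dom X strategy" and nl: "\<not> limit_inning (seq_length s)"
  shows "current X s \<in> all_pieces"
proof (cases "seq_length s" rule: inning_cases)
  case first
  then have "s = Map.empty" using seq_length_first_iff[OF s] by blast
  then show ?thesis using level0 unfolding all_pieces_def by auto
next
  case (succ \<beta>)
  then show ?thesis using current_succ[OF s succ] moves_are_pieces[OF s, of \<beta>] by simp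
qed (use nl in simp)

lemma move_after_stationary:
  assumes s: "s \<in> strategy_dom X strategy" and \<beta>: "next_inning \<beta> < seq_length s"
    and eq: "the (s (next_inning \<beta>)) = the (s \<beta>)"
  shows "\<Union>(proper_subpieces (the (s \<beta>))) \<noteq> the (s \<beta>)"
proof
  let ?t = "s |` {..<next_inning \<beta>}" let ?W = "the (s \<beta>)"
  assume un: "\<Union>(proper_subpieces ?W) = ?W"
  have le: "next_inning \<beta> \<le> seq_length s" using \<beta> by simp
  have t: "?t \<in> strategy_dom X strategy" "seq_length ?t = next_inning \<beta>"
    using restrict_in_strategy_dom[OF s le] seq_length_restrict[OF s le] by auto
  have cur: "current X ?t = ?W" using current_succ[OF t] by simp
  have "strategy ?t = Partition (proper_subpieces ?W)"
    unfolding strategy_def Let_def cur t(2) using un by simp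
  hence "?W \<in> proper_subpieces ?W" using strategy_domD(3)[OF s \<beta>] eq by simp
  thus False using proper_subpiecesD(2) by blast
qed

text \<open>If the moves are eventually constant, Alice has been waiting on a piece with a limit
  point, and its subpieces and this point form the move. Otherwise the moves shrink below every
  level, hence follow a branch to a single point, and the move has no parts.\<close>

lemma legal_at_limit:
  assumes s: "s \<in> strategy_dom X strategy" and lim: "limit_inning (seq_length s)"
  shows "legal_move X s (strategy s)"
proof -
  let ?l = "seq_length s"
  have first_less: "first_inning < ?l" using lim limit_inning_iff by (metis first_inning_le order_le_less)
  have ran: "ran s = {the (s \<beta>) | \<beta>. \<beta> < ?l}" by (rule strategy_dom_ran[OF s])
  have rne: "ran s \<noteq> {}" using first_less unfolding ran by blast
  have ran_pieces: "U \<in> all_pieces" if "U \<in> ran s" for U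
    using that moves_are_pieces[OF s] unfolding ran by blast
  have inter_ran: "current X s = \<Inter>(ran s)"
    using rne piece_openin[OF ran_pieces] openin_subset unfolding current_def by blast
  have dec: "the (s \<gamma>) \<subseteq> the (s \<beta>)" if "\<beta> \<le> \<gamma>" "\<gamma> < ?l" for \<beta> \<gamma> using bob_moves_decreasing[OF s that] .
  have goal: "legal_move X s (strategy s)" if x: "\<Inter>(ran s) - \<Union>(proper_subpieces (\<Inter>(ran s))) = {x}"
      and lb: "local_basis_at X x {U - \<Union>\<F> | U \<F>. U \<in> ran s \<and> finite \<F> \<and> \<F> \<subseteq> proper_subpieces (\<Inter>(ran s))}" for x
  proof -
    let ?P = "proper_subpieces (\<Inter>(ran s))"
    have "strategy s = Partition_Point ?P x"
      using lim unfolding strategy_def Let_def inter_ran x by simp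
    moreover have "\<Union>?P \<subseteq> \<Inter>(ran s)" using proper_subpiecesD(2) by blast
    hence "\<Inter>(ran s) = \<Union>?P \<union> (\<Inter>(ran s) - \<Union>?P)" by blast
    hence "\<Inter>(ran s) = \<Union>?P \<union> {x}" by (simp only: x)
    moreover have xI: "x \<in> \<Inter>(ran s) - \<Union>?P" unfolding x by simp
    moreover obtain U where "U \<in> ran s" using rne by blast
    hence "x \<in> topspace X" using xI openin_subset[OF piece_openin[OF ran_pieces]] by blast
    moreover have "{} \<notin> ?P" "\<forall>V\<in>?P. openin X V" using proper_subpiecesD(3,4) by blast+
    ultimately have "legal_limit_move X s ?P x"
      using lb disjoint_proper_subpieces unfolding legal_limit_move_def by (intro conjI) simp_all
    thus ?thesis using lim \<open>strategy s = Partition_Point ?P x\<close> unfolding legal_move_def by simp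
  qed
  show ?thesis
  proof (cases "\<exists>\<beta>0<?l. \<forall>\<gamma>. \<beta>0 \<le> \<gamma> \<and> \<gamma> < ?l \<longrightarrow> the (s \<gamma>) = the (s \<beta>0)")
    case True
    then obtain \<beta>0 where \<beta>0: "\<beta>0 < ?l" "\<And>\<gamma>. \<beta>0 \<le> \<gamma> \<Longrightarrow> \<gamma> < ?l \<Longrightarrow> the (s \<gamma>) = the (s \<beta>0)" by blast
    define W where "W = the (s \<beta>0)"
    have nx: "next_inning \<beta>0 < ?l" using limit_inning_next[OF lim \<beta>0(1)] .
    have "the (s (next_inning \<beta>0)) = the (s \<beta>0)" using \<beta>0(2)[OF less_imp_le nx] by simp
    hence nsplit: "\<Union>(proper_subpieces W) \<noteq> W" unfolding W_def by (rule move_after_stationary[OF s nx])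
    have Wran: "W \<in> ran s" unfolding ran W_def using \<beta>0(1) by blast
    have sub: "W \<subseteq> U" if "U \<in> ran s" for U
    proof -
      obtain \<beta> where \<beta>: "\<beta> < ?l" "U = the (s \<beta>)" using \<open>U \<in> ran s\<close> unfolding ran by blast
      show ?thesis
      proof (cases "\<beta> \<le> \<beta>0")
        case True
        then show ?thesis using dec[OF True \<beta>0(1)] \<beta> unfolding W_def by simp
      next
        case False
        then show ?thesis using \<beta>0(2)[of \<beta>] \<beta> unfolding W_def by simp
      qed
    qed
    have int: "\<Inter>(ran s) = W" using Wran sub by blast
    obtain x where x: "limit_piece X W (proper_subpieces W) x"
      using proper_subpieces_cases[OF ran_pieces[OF Wran]] nsplit by blast
    have "W - \<Union>(proper_subpieces W) = {x}" using limit_pieceD(1-3)[OF x] by blast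
    moreover have "local_basis_at X x {U - \<Union>\<F> | U \<F>. U \<in> ran s \<and> finite \<F> \<and> \<F> \<subseteq> proper_subpieces W}"
      unfolding local_basis_at_def
    proof (intro conjI ballI allI impI)
      fix V assume "V \<in> {U - \<Union>\<F> | U \<F>. U \<in> ran s \<and> finite \<F> \<and> \<F> \<subseteq> proper_subpieces W}"
      then obtain U \<F> where V: "U \<in> ran s" "finite \<F>" "\<F> \<subseteq> proper_subpieces W" "V = U - \<Union>\<F>" by blast
      have "closedin X (\<Union>\<F>)"
        using V(2,3) proper_subpiecesD(1) piece_closed unfolding all_pieces_def
        by (intro closedin_Union) blast+
      thus "openin X V" unfolding V(4) by (rule openin_diff[OF piece_openin[OF ran_pieces[OF V(1)]]])
      show "x \<in> V" using limit_pieceD(1,2)[OF x] sub[OF V(1)] V by blast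
    next
      fix V assume "openin X V \<and> x \<in> V"
      then obtain \<F> where "finite \<F>" "\<F> \<subseteq> proper_subpieces W" "W - \<Union>\<F> \<subseteq> V"
        using local_basis_atD(3)[OF limit_pieceD(4)[OF x], of V] by blast
      thus "\<exists>V'\<in>{U - \<Union>\<F> | U \<F>. U \<in> ran s \<and> finite \<F> \<and> \<F> \<subseteq> proper_subpieces W}. V' \<subseteq> V"
        using Wran by (intro bexI[of _ "W - \<Union>\<F>"]) blast+
    qed
    ultimately show ?thesis using goal[unfolded int] by blast
  next
    case False
    \<comment> \<open>With no constant tail, each move is followed by a strictly smaller one. Every
      such decrease allows passing to the next level, which drives the induction on \<open>k\<close>
      below.\<close>
    have strict: "\<exists>\<gamma>. \<beta> \<le> \<gamma> \<and> \<gamma> < ?l \<and> the (s \<gamma>) \<subset> the (s \<beta>)" if "\<beta> < ?l" for \<beta>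
      using False that dec by (metis psubsetI)
    have "\<exists>\<beta><?l. \<exists>U\<in>\<U> k. the (s \<beta>) \<subseteq> U" for k
    proof (induction k)
      case 0
      have "the (s first_inning) \<subseteq> topspace X"
        using piece_openin[OF moves_are_pieces[OF s first_less]] openin_subset by blast
      then show ?case using first_less level0 by blast
    next
      case (Suc k)
      then obtain \<beta> U where \<beta>: "\<beta> < ?l" "U \<in> \<U> k" "the (s \<beta>) \<subseteq> U" by blast
      obtain \<gamma> where \<gamma>: "\<gamma> < ?l" "the (s \<gamma>) \<subset> the (s \<beta>)" using strict[OF \<beta>(1)] by blast
      obtain j where j: "the (s \<gamma>) \<in> \<U> j" using moves_are_pieces[OF s \<gamma>(1)] unfolding all_pieces_def by blast
      obtain z where z: "z \<in> the (s \<gamma>)" using bob_moves(2)[OF s \<gamma>(1)] by blast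
      \<comment> \<open>A piece of level at most \<open>k\<close> that meets \<open>U\<close>
        contains \<open>U\<close>, but this one is strictly smaller than a subset of
        \<open>U\<close>.\<close>
      have "\<not> j \<le> k"
        using nested[OF j \<beta>(2), of z] z \<gamma>(2) \<beta>(3) by blast
      then obtain Y where "Y \<in> \<U> (Suc k)" "the (s \<gamma>) \<subseteq> Y" using ancestor[OF j, of "Suc k"] by auto
      then show ?case using \<gamma>(1) by blast
    qed
    then obtain b f where f: "\<And>k. b k < ?l \<and> f k \<in> \<U> k \<and> the (s (b k)) \<subseteq> f k" by metis
    have meet: "the (s (max \<beta> \<gamma>)) \<subseteq> the (s \<beta>) \<inter> the (s \<gamma>)" "the (s (max \<beta> \<gamma>)) \<noteq> {}"
      if "\<beta> < ?l" "\<gamma> < ?l" for \<beta> \<gamma>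
      using dec[of \<beta> "max \<beta> \<gamma>"] dec[of \<gamma> "max \<beta> \<gamma>"] bob_moves(2)[OF s, of "max \<beta> \<gamma>"] that by auto
    have fdec: "f (Suc k) \<subseteq> f k" for k
    proof -
      obtain z where "z \<in> the (s (b k))" "z \<in> the (s (b (Suc k)))"
        using meet[of "b k" "b (Suc k)"] f by blast
      thus ?thesis using nested[of "f k" k "f (Suc k)" "Suc k" z] f by auto
    qed
    obtain x where x: "\<Inter>(range f) = {x}" "local_basis_at X x (range f)" using branch_point[of f] f fdec by blast
    have ran_f: "U \<in> range f" if "U \<in> ran s" for U
    proof -
      obtain \<beta> where \<beta>: "\<beta> < ?l" "U = the (s \<beta>)" using \<open>U \<in> ran s\<close> unfolding ran by blast
      obtain j where j: "U \<in> \<U> j" using ran_pieces[OF \<open>U \<in> ran s\<close>] unfolding all_pieces_def by blast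
      obtain z where "z \<in> the (s \<beta>)" "z \<in> the (s (b j))" using meet[of \<beta> "b j"] f \<beta>(1) by blast
      hence "U = f j" using piece_unique[OF j, of "f j" z] f \<beta>(2) by blast
      thus ?thesis by blast
    qed
    have "\<Inter>(ran s) \<subseteq> f k" for k using f[of k] unfolding ran by blast
    hence int: "\<Inter>(ran s) = {x}" using ran_f x(1) by blast
    have "local_basis_at X x (ran s)"
      unfolding local_basis_at_def
    proof (intro conjI ballI allI impI)
      fix V assume "V \<in> ran s"
      thus "openin X V" "x \<in> V" using ran_f local_basis_atD(1,2)[OF x(2)] by blast+
    next
      fix V assume "openin X V \<and> x \<in> V"
      then obtain k where "f k \<subseteq> V" using local_basis_atD(3)[OF x(2), of V] by blast
      hence "the (s (b k)) \<subseteq> V" "the (s (b k)) \<in> ran s" using f[of k] unfolding ran by blast+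
      thus "\<exists>V'\<in>ran s. V' \<subseteq> V" by blast
    qed
    moreover have "{U - \<Union>\<F> | U \<F>. U \<in> ran s \<and> finite \<F> \<and> \<F> \<subseteq> {}} = ran s" by auto
    ultimately show ?thesis using goal[unfolded int, of x] by simp
  qed
qed

lemma legal_strategy:
  assumes s: "s \<in> strategy_dom X strategy"
  shows "legal_move X s (strategy s)"
proof (cases "limit_inning (seq_length s)")
  case False
  let ?W = "current X s"
  have W: "?W \<in> all_pieces" using current_piece[OF s False] .
  show ?thesis
  proof (cases "\<Union>(proper_subpieces ?W) = ?W")
    case True
    have "{} \<notin> proper_subpieces ?W" using proper_subpiecesD(3) by blast
    hence "partition_on ?W (proper_subpieces ?W)"
      using True disjoint_proper_subpieces unfolding partition_on_def by simp
    then show ?thesis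
      using legal_nonlimitI[OF s False] proper_subpiecesD(4) True False unfolding strategy_def by simp
  next
    case nsplit: False
    have "partition_on ?W {?W}" using piece_nonempty[OF W] unfolding partition_on_def by simp
    hence "legal_move X s (Partition {?W})"
      by (rule legal_nonlimitI[OF s False]) (use piece_openin[OF W] in simp)
    then show ?thesis using nsplit False unfolding strategy_def by simp
  qed
qed (rule legal_at_limit[OF s])

lemma winning_strategy_pieces: "winning_strategy X strategy"
  unfolding winning_strategy_def alice_strategy_def bob_wins_at_def
  using legal_strategy by blast

text \<open>A limit move consists of proper subpieces, so a set is never kept across a limit inning.
  The first inning preceded by infinitely many occurrences of the same set would be such a limit
  inning.\<close>

lemma finite_repetitions:
  assumes s: "s \<in> strategy_dom X strategy" and \<beta>: "\<beta> < seq_length s"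
  shows "finite {\<gamma>. \<gamma> < \<beta> \<and> the (s \<gamma>) = the (s \<beta>)}"
proof (rule ccontr)
  let ?W = "the (s \<beta>)"
  let ?inf = "\<lambda>l. infinite {\<gamma>. \<gamma> < l \<and> the (s \<gamma>) = ?W}"
  assume inf: "?inf \<beta>"
  define l where "l = (LEAST l. ?inf l)"
  have l: "?inf l" unfolding l_def using inf by (rule LeastI[of ?inf])
  have lmin: "\<not> ?inf \<delta>" if "\<delta> < l" for \<delta> using not_less_Least[of \<delta> ?inf] that unfolding l_def by blast
  have le: "l \<le> \<beta>" unfolding l_def using inf by (rule Least_le[of ?inf])
  have lim: "limit_inning l"
  proof (cases l rule: inning_cases)
    case first
    then have "{\<gamma>. \<gamma> < l \<and> the (s \<gamma>) = ?W} = {}" by simp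
    then show ?thesis using l finite.emptyI by metis
  next
    case (succ \<delta>)
    then have "{\<gamma>. \<gamma> < l \<and> the (s \<gamma>) = ?W} \<subseteq> insert \<delta> {\<gamma>. \<gamma> < \<delta> \<and> the (s \<gamma>) = ?W}"
      by (auto simp: less_next_inning_iff)
    moreover have "finite {\<gamma>. \<gamma> < \<delta> \<and> the (s \<gamma>) = ?W}" using lmin[of \<delta>] succ by simp
    ultimately show ?thesis using l finite_subset by blast
  qed
  let ?t = "s |` {..<l}"
  have ll: "l < seq_length s" using le \<beta> by simp
  have t: "?t \<in> strategy_dom X strategy" "seq_length ?t = l"
    using restrict_in_strategy_dom[OF s, of l] seq_length_restrict[OF s, of l] ll by auto
  obtain \<gamma> where \<gamma>: "\<gamma> < l" "the (s \<gamma>) = ?W" using l not_finite_existsD[of "\<lambda>\<gamma>. \<gamma> < l \<and> the (s \<gamma>) = ?W"] by blast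
  have "current X ?t \<subseteq> ?W" using current_subset[OF t(1), of \<gamma>] t(2) \<gamma> by simp
  moreover have "the (s l) \<in> parts (strategy ?t)" using strategy_domD(3)[OF s ll] .
  hence "the (s l) \<in> proper_subpieces (current X ?t)" using parts_strategy[of "the (s l)" ?t] lim t(2) by simp
  hence "the (s l) \<subset> current X ?t" by (rule proper_subpiecesD)
  moreover have "?W \<subseteq> the (s l)" using bob_moves_decreasing[OF s le \<beta>] .
  ultimately show False by blast
qed

text \<open>The map into \<omega>\<cdot>\<omega>: the level of the last piece, then the time it has
  been kept. \<open>Suc\<close> leaves room for the empty sequence at the bottom, since a first move
  may be the whole space, of level 0 and without repetition.\<close>

definition position_rank :: "'a bob_seq \<Rightarrow> nat \<times> nat" where
  "position_rank t = (if t = Map.empty then (0, 0) else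
     (let \<beta> = (THE \<beta>. seq_length t = next_inning \<beta>) in
       (first_level (the (t \<beta>)), Suc (card {\<gamma>. \<gamma> < \<beta> \<and> the (t \<gamma>) = the (t \<beta>)}))))"

lemma position_rank_succ:
  assumes "seq_length t = next_inning \<beta>"
  shows "position_rank t = (first_level (the (t \<beta>)), Suc (card {\<gamma>. \<gamma> < \<beta> \<and> the (t \<gamma>) = the (t \<beta>)}))"
proof -
  have "t \<noteq> Map.empty"
  proof
    assume "t = Map.empty"
    hence "next_inning \<beta> = first_inning" using assms by (metis seq_length_empty)
    thus False using less_next_inning[of \<beta>] by simp
  qed
  moreover have "(THE \<beta>. seq_length t = next_inning \<beta>) = \<beta>" using assms by simp
  ultimately show ?thesis unfolding position_rank_def Let_def by simp
qed

lemma position_rank_less: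
  assumes t: "t \<in> succ_dom X strategy" and q: "q \<in> succ_dom X strategy"
    and tq: "t \<subseteq>\<^sub>m q" "t \<noteq> q"
  shows "lex_less (position_rank t) (position_rank q)"
proof -
  have td: "t \<in> strategy_dom X strategy" and qd: "q \<in> strategy_dom X strategy"
    and nl: "\<not> limit_inning (seq_length t)" "\<not> limit_inning (seq_length q)"
    using t q by (auto simp: succ_dom_iff)
  have lt: "seq_length t < seq_length q" using map_le_length_less[OF td qd tq] .
  have "seq_length q \<noteq> first_inning" using lt by auto
  then obtain \<beta>q where \<beta>q: "seq_length q = next_inning \<beta>q" using nl(2) limit_inning_iff by blast
  note rq = position_rank_succ[OF \<beta>q]
  show ?thesis
  proof (cases "seq_length t" rule: inning_cases)
    case first
    then have "t = Map.empty" using seq_length_first_iff[OF td] by blast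
    then have "position_rank t = (0, 0)" by (simp add: position_rank_def)
    then show ?thesis unfolding rq by (auto simp: lex_less_def)
  next
    case (succ \<beta>t)
    have lb: "\<beta>t < \<beta>q" using lt unfolding succ \<beta>q by (simp add: next_inning_le_iff less_next_inning_iff)
    have teq: "t = q |` {..<seq_length t}" using map_le_restrict[OF td qd tq(1)] by blast
    have same: "t \<gamma> = q \<gamma>" if "\<gamma> \<le> \<beta>t" for \<gamma>
      using that by (subst teq) (simp add: succ less_next_inning_iff)
    have "{\<gamma>. \<gamma> < \<beta>t \<and> the (t \<gamma>) = the (t \<beta>t)} = {\<gamma>. \<gamma> < \<beta>t \<and> the (q \<gamma>) = the (q \<beta>t)}"
      using same by auto
    hence rt: "position_rank t = (first_level (the (q \<beta>t)), Suc (card {\<gamma>. \<gamma> < \<beta>t \<and> the (q \<gamma>) = the (q \<beta>t)}))"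
      using position_rank_succ[OF succ] same[of \<beta>t] by simp
    have bq: "\<beta>q < seq_length q" "\<beta>t < seq_length q" using \<beta>q lb by (auto simp: less_next_inning_iff)
    show ?thesis
    proof (cases "the (q \<beta>t) = the (q \<beta>q)")
      case True
      have "card {\<gamma>. \<gamma> < \<beta>t \<and> the (q \<gamma>) = the (q \<beta>t)} < card {\<gamma>. \<gamma> < \<beta>q \<and> the (q \<gamma>) = the (q \<beta>q)}"
      proof (rule psubset_card_mono[OF finite_repetitions[OF qd bq(1)]])
        show "{\<gamma>. \<gamma> < \<beta>t \<and> the (q \<gamma>) = the (q \<beta>t)} \<subset> {\<gamma>. \<gamma> < \<beta>q \<and> the (q \<gamma>) = the (q \<beta>q)}"
          using True lb by auto
      qed
      then show ?thesis unfolding rt rq using True by (simp add: lex_less_def)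
    next
      case False
      then have "the (q \<beta>q) \<subset> the (q \<beta>t)" using bob_moves_decreasing[OF qd less_imp_le[OF lb] bq(1)] by blast
      then have "first_level (the (q \<beta>t)) < first_level (the (q \<beta>q))"
        by (intro first_level_less moves_are_pieces[OF qd] bq)
      then show ?thesis unfolding rt rq by (simp add: lex_less_def)
    qed
  qed (use nl in simp)
qed

lemma height_pieces: "height_bounded_by (succ_dom X strategy) (\<subseteq>\<^sub>m) omega_omega"
  unfolding height_bounded_by_def
proof
  fix t assume t: "t \<in> succ_dom X strategy"
  show "(order_on (strict_preds (succ_dom X strategy) (\<subseteq>\<^sub>m) t) (\<subseteq>\<^sub>m), omega_omega) \<in> ordLess"
  proof (rule ordLess_omega_omegaI[OF position_order(1)[OF t], of position_rank])
    show "lex_less (position_rank x) (position_rank y)"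
      if "(x, y) \<in> order_on (strict_preds (succ_dom X strategy) (\<subseteq>\<^sub>m) t) (\<subseteq>\<^sub>m)" "x \<noteq> y" for x y
      using that position_rank_less unfolding order_on_def strict_preds_def by blast
    show "lex_less (position_rank x) (position_rank t)"
      if "x \<in> Field (order_on (strict_preds (succ_dom X strategy) (\<subseteq>\<^sub>m) t) (\<subseteq>\<^sub>m))" for x
    proof -
      have "x \<in> strict_preds (succ_dom X strategy) (\<subseteq>\<^sub>m) t" using that position_order(2)[OF t] by simp
      hence "x \<in> succ_dom X strategy" "x \<subseteq>\<^sub>m t" "x \<noteq> t" unfolding strict_preds_def by auto
      thus ?thesis using position_rank_less[OF _ t] by blast
    qed
  qed
qed

lemma branching_pieces:
  assumes t: "t \<in> branching_nodes (succ_dom X strategy) (\<subseteq>\<^sub>m)"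
  shows "\<Union>(proper_subpieces (current X t)) = current X t"
proof (rule ccontr)
  assume nsplit: "\<not> ?thesis"
  have tT: "t \<in> succ_dom X strategy" using t unfolding branching_nodes_def by blast
  obtain s s' where s: "s \<in> immediate_succs (succ_dom X strategy) (\<subseteq>\<^sub>m) t"
    "s' \<in> immediate_succs (succ_dom X strategy) (\<subseteq>\<^sub>m) t" "s \<noteq> s'"
    using t unfolding branching_nodes_def by blast
  have "parts (strategy t) = {current X t}"
    using nsplit tT unfolding strategy_def Let_def by (simp add: succ_dom_iff)
  thus False using immediate_succ_imp_extension[OF tT s(1)] immediate_succ_imp_extension[OF tT s(2)] s(3) by auto
qed

text \<open>At a branching node of the ray the piece is really split, so the first levels strictly
  increase along these nodes. A node \<open>q\<close> beyond the ray bounds them. A maximal ray has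
  no such \<open>q\<close> and may branch infinitely often.\<close>

lemma finite_branching_pieces:
  assumes R: "nonmaximal_tree_ray (succ_dom X strategy) (\<subseteq>\<^sub>m) R"
  shows "finite (R \<inter> branching_nodes (succ_dom X strategy) (\<subseteq>\<^sub>m))"
proof -
  let ?T = "succ_dom X strategy" let ?B = "R \<inter> branching_nodes ?T (\<subseteq>\<^sub>m)"
  obtain R' where R1: "tree_ray ?T (\<subseteq>\<^sub>m) R" and R': "tree_ray ?T (\<subseteq>\<^sub>m) R'" "R \<subset> R'"
    using R unfolding nonmaximal_tree_ray_def by blast
  obtain q where q: "q \<in> R'" "q \<notin> R" using R'(2) by blast
  have qT: "q \<in> ?T" using q R'(1) unfolding tree_ray_def by blast
  have RT: "R \<subseteq> ?T" using R1 unfolding tree_ray_def by blast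
  have down: "u \<in> R" if "t \<in> R" "u \<in> ?T" "u \<subseteq>\<^sub>m t" for t u using R1 that unfolding tree_ray_def by blast
  have chain: "t \<subseteq>\<^sub>m u \<or> u \<subseteq>\<^sub>m t" if "t \<in> R'" "u \<in> R'" for t u using R'(1) that unfolding tree_ray_def by blast
  have below_q: "t \<subseteq>\<^sub>m q" "t \<noteq> q" if "t \<in> R" for t
    using chain[of t q] down[OF that qT] that q R'(2) by blast+
  have qd: "q \<in> strategy_dom X strategy" using qT by (simp add: succ_dom_iff)
  have split: "the (q (seq_length t)) \<subset> current X t" "seq_length t < seq_length q" if t: "t \<in> ?B" for t
  proof -
    have tT: "t \<in> ?T" using t RT by blast
    hence td: "t \<in> strategy_dom X strategy" "\<not> limit_inning (seq_length t)" by (auto simp: succ_dom_iff)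
    have le: "t \<subseteq>\<^sub>m q" "t \<noteq> q" using below_q t by blast+
    show lt: "seq_length t < seq_length q" using map_le_length_less[OF td(1) qd le] .
    have "q |` {..<seq_length t} = t" using map_le_restrict(1)[OF td(1) qd le(1)] by simp
    hence "the (q (seq_length t)) \<in> parts (strategy t)" using strategy_domD(3)[OF qd lt] by simp
    moreover have "strategy t = Partition (proper_subpieces (current X t))"
      using branching_pieces[of t] t td(2) unfolding strategy_def Let_def by simp
    ultimately show "the (q (seq_length t)) \<subset> current X t" using proper_subpiecesD(2) by simp
  qed
  have piece: "current X t \<in> all_pieces" if "t \<in> ?B" for t
    using current_piece RT that by (auto simp: succ_dom_iff)
  have less: "first_level (current X t) < first_level (current X u)"
    if t: "t \<in> ?B" and u: "u \<in> ?T" "u \<subseteq>\<^sub>m q" "t \<subseteq>\<^sub>m u" "t \<noteq> u" for t u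
  proof -
    have td: "t \<in> strategy_dom X strategy" and ud: "u \<in> strategy_dom X strategy"
      using t u RT by (auto simp: succ_dom_iff)
    have lt: "seq_length t < seq_length u" using map_le_length_less[OF td ud u(3,4)] .
    have "u (seq_length t) = q (seq_length t)"
      using map_le_restrict(1)[OF ud qd u(2)] lt by (metis lessThan_iff restrict_in)
    hence "current X u \<subseteq> the (q (seq_length t))" using current_subset[OF ud lt] by simp
    hence "current X u \<subset> current X t" using split(1)[OF t] by blast
    moreover have "current X u \<in> all_pieces" using current_piece u(1) by (auto simp: succ_dom_iff)
    ultimately show ?thesis using first_level_less piece[OF t] by blast
  qed
  have "inj_on (\<lambda>t. first_level (current X t)) ?B"
  proof (rule inj_onI, rule ccontr)
    fix t u assume tu: "t \<in> ?B" "u \<in> ?B" "first_level (current X t) = first_level (current X u)" "t \<noteq> u"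
    have "t \<subseteq>\<^sub>m u \<or> u \<subseteq>\<^sub>m t" using chain tu R'(2) by blast
    thus False using less[OF tu(1), of u] less[OF tu(2), of t] tu below_q RT by auto
  qed
  moreover have "(\<lambda>t. first_level (current X t)) ` ?B \<subseteq> {..<first_level (current X q)}"
    using less[of _ q] qT below_q by auto
  ultimately show ?thesis using inj_on_finite[OF _ _ finite_lessThan] by blast
qed

end

theorem piece_tree_imp_strategy:
  assumes "piece_tree X \<U>"
  shows "\<exists>\<sigma>. winning_strategy X \<sigma> \<and> height_bounded_by (succ_dom X \<sigma>) (\<subseteq>\<^sub>m) omega_omega \<and>
    (\<forall>R. nonmaximal_tree_ray (succ_dom X \<sigma>) (\<subseteq>\<^sub>m) R \<longrightarrow>
      finite (R \<inter> branching_nodes (succ_dom X \<sigma>) (\<subseteq>\<^sub>m)))"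
proof -
  interpret tree_of_pieces X \<U> by unfold_locales (rule assms)
  show ?thesis using winning_strategy_pieces height_pieces finite_branching_pieces by blast
qed

section \<open>Constant stretches of a winning strategy\<close>

section \<open>From strategies to trees of pieces\<close>

lemma map_le_chain:
  assumes "u \<in> strategy_dom X \<sigma>" "v \<in> strategy_dom X \<sigma>" "u \<subseteq>\<^sub>m w" "v \<subseteq>\<^sub>m w"
  shows "u \<subseteq>\<^sub>m v \<or> v \<subseteq>\<^sub>m u"
  using seq_extensions_comparable[OF strategy_domD(1)[OF assms(1)] strategy_domD(1)[OF assms(2)] assms(3,4)]
    seq_extensions_comparable[OF strategy_domD(1)[OF assms(2)] strategy_domD(1)[OF assms(1)] assms(4,3)]
  by (metis linear)

lemma legal_parts_disjoint: "legal_move X s m \<Longrightarrow> disjoint (parts m)"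
  by (cases rule: legal_move_cases)
    (auto simp: open_partition_on_def partition_on_def legal_limit_move_def)

locale bounded_winning_strategy =
  fixes X :: "'a topology" and \<sigma> :: "'a bob_seq \<Rightarrow> 'a alice_move"
  assumes nonempty: "topspace X \<noteq> {}"
    and winning: "winning_strategy X \<sigma>"
    and height: "height_bounded_by (succ_dom X \<sigma>) (\<subseteq>\<^sub>m) omega_omega"
    and finite_branching: "nonmaximal_tree_ray (succ_dom X \<sigma>) (\<subseteq>\<^sub>m) R \<Longrightarrow>
      finite (R \<inter> branching_nodes (succ_dom X \<sigma>) (\<subseteq>\<^sub>m))"
begin

abbreviation D :: "'a bob_seq set" where "D \<equiv> strategy_dom X \<sigma>"
abbreviation T :: "'a bob_seq set" where "T \<equiv> succ_dom X \<sigma>"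

lemma T_D: "t \<in> T \<Longrightarrow> t \<in> D" and T_nonlimit: "t \<in> T \<Longrightarrow> \<not> limit_inning (seq_length t)"
  by (simp_all add: succ_dom_iff)

lemma empty_in_T: "Map.empty \<in> T"
  unfolding succ_dom_def by simp

lemma current_open_nonempty:
  assumes t: "t \<in> T"
  shows "openin X (current X t)" "current X t \<noteq> {}"
proof -
  have "openin X (current X t) \<and> current X t \<noteq> {}"
  proof (cases "seq_length t" rule: inning_cases)
    case first
    then have "t = Map.empty" using seq_length_first_iff[OF T_D[OF t]] by blast
    then show ?thesis using nonempty by simp
  next
    case (succ \<beta>)
    then show ?thesis using current_succ[OF T_D[OF t] succ] bob_moves[OF T_D[OF t], of \<beta>] by simp
  qed (use T_nonlimit[OF t] in simp)
  thus "openin X (current X t)" "current X t \<noteq> {}" by auto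
qed

text \<open>At a limit inning Alice has a legal move because Bob would win otherwise; at all other
  innings the partition into one part is always available.\<close>

lemma legal:
  assumes s: "s \<in> D"
  shows "legal_move X s (\<sigma> s)"
proof -
  have strat: "legal_move X s (\<sigma> s)" if "legal_move X s m" for m
    using winning s that unfolding winning_strategy_def alice_strategy_def by blast
  show ?thesis
  proof (cases "limit_inning (seq_length s)")
    case True
    then show ?thesis
      using winning s strat unfolding winning_strategy_def bob_wins_at_def alice_wins_at_def by blast
  next
    case False
    hence "s \<in> T" using s by (simp add: succ_dom_iff)
    hence "partition_on (current X s) {current X s}" "openin X (current X s)"
      using current_open_nonempty[of s] unfolding partition_on_def by auto
    hence "legal_move X s (Partition {current X s})" by (intro legal_nonlimitI[OF s False]) simp_all
    thus ?thesis by (rule strat)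
  qed
qed

lemma parts_cover:
  assumes t: "t \<in> T"
  shows "\<Union>(parts (\<sigma> t)) = current X t"
proof -
  obtain P where "\<sigma> t = Partition P" "partition_on (current X t) P"
    using legal_nonlimit[OF T_D[OF t] legal[OF T_D[OF t]] T_nonlimit[OF t]] by blast
  thus ?thesis unfolding partition_on_def by simp
qed

lemma extension_in_T:
  assumes "s \<in> D" "V \<in> parts (\<sigma> s)"
  shows "s(seq_length s \<mapsto> V) \<in> T"
  using extend_position[OF assms(1) legal[OF assms(1)] assms(2)] by (simp add: succ_dom_iff)

text \<open>
  Let the run survive a limit inning. All but finitely many nodes before it do not branch, by (b),
  and by (a) the limit inning has a last limit inning before it.
\<close>

lemma eventually_stationary:
  assumes s: "s \<in> D" and lim: "limit_inning (seq_length s)" and ne: "parts (\<sigma> s) \<noteq> {}"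
  shows "\<exists>\<mu><seq_length s. \<forall>t\<in>T. t \<subseteq>\<^sub>m s \<and> \<mu> < seq_length t \<longrightarrow>
    (\<forall>\<beta>. seq_length t \<le> \<beta> \<and> \<beta> < seq_length s \<longrightarrow> the (s \<beta>) = current X t)"
proof -
  let ?l = "seq_length s"
  have first_less: "first_inning < ?l" using lim limit_inning_iff by (metis first_inning_le order_le_less)
  obtain V where V: "V \<in> parts (\<sigma> s)" using ne by blast
  \<comment> \<open>One move beyond the limit inning. This node witnesses that the ray
    \<open>R\<close> before the limit can be prolonged, and (a) is applied to its
    predecessors.\<close>
  define q where "q = s(?l \<mapsto> V)"
  have q: "q \<in> T" "seq_length q = next_inning ?l" "q |` {..<?l} = s"
    unfolding q_def using extension_in_T[OF s V] extend_position(2,3)[OF s legal[OF s] V] by auto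
  have sq: "s \<subseteq>\<^sub>m q" using restrict_map_le[of q "{..<?l}"] q(3) by simp
  define R where "R = {t \<in> T. t \<subseteq>\<^sub>m s}"
  have len_less: "seq_length t < ?l" if "t \<in> R" for t
    using map_le_restrict(2)[OF _ s, of t] that lim T_nonlimit[of t] unfolding R_def
    by (metis (no_types, lifting) T_D mem_Collect_eq order_le_less)
  have up: "s |` {..<next_inning \<beta>} \<in> R" "seq_length (s |` {..<next_inning \<beta>}) = next_inning \<beta>" if "\<beta> < ?l" for \<beta>
    using restrict_in_strategy_dom[OF s, of "next_inning \<beta>"] seq_length_restrict[OF s, of "next_inning \<beta>"]
      limit_inning_next[OF lim that] restrict_map_le unfolding R_def by (auto simp: succ_dom_iff)
  have rayR: "tree_ray T (\<subseteq>\<^sub>m) R"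
    unfolding tree_ray_def
  proof (intro conjI ballI impI)
    show "R \<subseteq> T" unfolding R_def by blast
    show "R \<noteq> {}" using up(1)[OF first_less] by blast
    show "u \<in> R" if "t \<in> R" "u \<in> T" "u \<subseteq>\<^sub>m t" for t u
      using that map_le_trans unfolding R_def by blast
    show "t \<subseteq>\<^sub>m u \<or> u \<subseteq>\<^sub>m t" if "t \<in> R" "u \<in> R" for t u
      using map_le_chain[of t X \<sigma> u s] that T_D unfolding R_def by blast
    show "\<not> (\<exists>m\<in>R. \<forall>t\<in>R. m \<subseteq>\<^sub>m t \<longrightarrow> t = m)"
    proof
      assume "\<exists>m\<in>R. \<forall>t\<in>R. m \<subseteq>\<^sub>m t \<longrightarrow> t = m"
      then obtain m where m: "m \<in> R" "\<And>t. t \<in> R \<Longrightarrow> m \<subseteq>\<^sub>m t \<Longrightarrow> t = m" by blast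
      let ?u = "s |` {..<next_inning (seq_length m)}"
      have u: "?u \<in> R" "seq_length ?u = next_inning (seq_length m)" using up[OF len_less[OF m(1)]] by blast+
      have "m \<subseteq>\<^sub>m ?u \<or> ?u \<subseteq>\<^sub>m m"
        using map_le_chain[of m X \<sigma> ?u s] m(1) u(1) T_D unfolding R_def by blast
      moreover have "\<not> ?u \<subseteq>\<^sub>m m"
      proof
        assume "?u \<subseteq>\<^sub>m m"
        hence "next_inning (seq_length m) \<le> seq_length m"
          using map_le_restrict(2)[of ?u X \<sigma> m] u m(1) T_D unfolding R_def by auto
        thus False using less_next_inning[of "seq_length m"] by (simp add: not_le[symmetric])
      qed
      ultimately have "?u = m" using m(2) u(1) by blast
      hence "next_inning (seq_length m) = seq_length m" using u(2) by simp
      thus False using less_next_inning[of "seq_length m"] by simp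
    qed
  qed
  have nonmax: "nonmaximal_tree_ray T (\<subseteq>\<^sub>m) R"
    unfolding nonmaximal_tree_ray_def
  proof (intro conjI exI)
    \<comment> \<open>A single node beyond \<open>R\<close> does not yet make a longer ray, as rays
      have no maximal node. The play is therefore continued from \<open>q\<close> by infinitely many
      arbitrary moves.\<close>
    define step where "step u = u(seq_length u \<mapsto> (SOME V. V \<in> parts (\<sigma> u)))" for u
    have step: "step u \<in> T" "u \<subseteq>\<^sub>m step u" "seq_length (step u) = next_inning (seq_length u)" if u: "u \<in> T" for u
    proof -
      have "parts (\<sigma> u) \<noteq> {}" using parts_cover[OF u] current_open_nonempty(2)[OF u] by auto
      hence V: "(SOME V. V \<in> parts (\<sigma> u)) \<in> parts (\<sigma> u)" by (simp add: some_in_eq)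
      show "step u \<in> T" unfolding step_def by (rule extension_in_T[OF T_D[OF u] V])
      show "seq_length (step u) = next_inning (seq_length u)"
        unfolding step_def by (rule extend_position(2)[OF T_D[OF u] legal[OF T_D[OF u]] V])
      show "u \<subseteq>\<^sub>m step u"
        using restrict_map_le[of "step u" "{..<seq_length u}"]
          extend_position(3)[OF T_D[OF u] legal[OF T_D[OF u]] V] unfolding step_def by simp
    qed
    define Q where "Q n = (step ^^ n) q" for n
    have QT: "Q n \<in> T" for n unfolding Q_def by (induction n) (use q step in auto)
    have QS: "Q n \<subseteq>\<^sub>m Q (Suc n)" "seq_length (Q (Suc n)) = next_inning (seq_length (Q n))" for n
      using step[OF QT[of n]] unfolding Q_def by simp_all
    have Qmono: "Q n \<subseteq>\<^sub>m Q m" if "n \<le> m" for n m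
      using that by (induction m rule: dec_induct) (use QS(1) map_le_trans map_le_refl in blast)+
    let ?R = "{u \<in> T. \<exists>n. u \<subseteq>\<^sub>m Q n}"
    show "tree_ray T (\<subseteq>\<^sub>m) R" by (rule rayR)
    show "tree_ray T (\<subseteq>\<^sub>m) ?R"
      unfolding tree_ray_def
    proof (intro conjI ballI impI)
      show "?R \<subseteq> T" by blast
      show "?R \<noteq> {}" using QT[of 0] map_le_refl by blast
      show "u \<in> ?R" if "t \<in> ?R" "u \<in> T" "u \<subseteq>\<^sub>m t" for t u using that map_le_trans by blast
      show "t \<subseteq>\<^sub>m u \<or> u \<subseteq>\<^sub>m t" if tu: "t \<in> ?R" "u \<in> ?R" for t u
      proof -
        obtain n m where "t \<subseteq>\<^sub>m Q n" "u \<subseteq>\<^sub>m Q m" using tu by blast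
        hence "t \<subseteq>\<^sub>m Q (max n m)" "u \<subseteq>\<^sub>m Q (max n m)"
          using Qmono[of n "max n m"] Qmono[of m "max n m"] map_le_trans by (meson max.cobounded1 max.cobounded2)+
        thus ?thesis using map_le_chain[of t X \<sigma> u] tu T_D by blast
      qed
      show "\<not> (\<exists>m\<in>?R. \<forall>t\<in>?R. m \<subseteq>\<^sub>m t \<longrightarrow> t = m)"
      proof
        assume "\<exists>m\<in>?R. \<forall>t\<in>?R. m \<subseteq>\<^sub>m t \<longrightarrow> t = m"
        then obtain m n where m: "m \<in> T" "m \<subseteq>\<^sub>m Q n" "\<And>t. t \<in> ?R \<Longrightarrow> m \<subseteq>\<^sub>m t \<Longrightarrow> t = m" by blast
        have "Q (Suc n) \<in> ?R" using QT map_le_refl by blast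
        moreover have "m \<subseteq>\<^sub>m Q (Suc n)" using m(2) QS(1) map_le_trans by blast
        ultimately have "Q (Suc n) = m" by (rule m(3))
        hence "next_inning (seq_length (Q n)) \<le> seq_length (Q n)"
          using map_le_restrict(2)[OF T_D[OF m(1)] T_D[OF QT] m(2)] QS(2)[of n] by simp
        thus False using less_next_inning[of "seq_length (Q n)"] by (simp add: not_le[symmetric])
      qed
    qed
    show "R \<subset> ?R"
    proof
      have Q0: "Q 0 = q" unfolding Q_def by simp
      show "R \<subseteq> ?R"
      proof
        fix t assume "t \<in> R"
        hence "t \<in> T" "t \<subseteq>\<^sub>m Q 0" using sq map_le_trans unfolding R_def Q0 by blast+
        thus "t \<in> ?R" by blast
      qed
      have "q \<subseteq>\<^sub>m Q 0" unfolding Q0 by (rule map_le_refl)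
      hence "q \<in> ?R" using q(1) by blast
      moreover have "q \<notin> R" using len_less[of q] q(2) less_next_inning[of ?l] by (metis less_asym)
      ultimately show "R \<noteq> ?R" by blast
    qed
  qed
  let ?B = "R \<inter> branching_nodes T (\<subseteq>\<^sub>m)"
  have finB: "finite ?B" by (rule finite_branching[OF nonmax])
  \<comment> \<open>The length of the last branching node before the limit;
    \<open>first_inning\<close> is inserted for the case that there is none.\<close>
  define \<mu>2 where "\<mu>2 = Max (insert first_inning (seq_length ` ?B))"
  have \<mu>2: "\<mu>2 < ?l" "\<And>t. t \<in> ?B \<Longrightarrow> seq_length t \<le> \<mu>2"
  proof -
    have "\<mu>2 \<in> insert first_inning (seq_length ` ?B)" unfolding \<mu>2_def using finB by (intro Max_in) auto
    thus "\<mu>2 < ?l" using first_less len_less by blast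
    show "seq_length t \<le> \<mu>2" if "t \<in> ?B" for t unfolding \<mu>2_def using finB that by (intro Max_ge) auto
  qed
  have "(order_on (strict_preds T (\<subseteq>\<^sub>m) q) (\<subseteq>\<^sub>m), omega_omega) \<in> ordLess"
    using height q(1) unfolding height_bounded_by_def by blast
  then obtain h a where h: "\<And>x y. (x, y) \<in> order_on (strict_preds T (\<subseteq>\<^sub>m) q) (\<subseteq>\<^sub>m) \<Longrightarrow> x \<noteq> y \<Longrightarrow> lex_less (h x) (h y)"
    and ha: "\<And>x. x \<in> Field (order_on (strict_preds T (\<subseteq>\<^sub>m) q) (\<subseteq>\<^sub>m)) \<Longrightarrow> lex_less (h x) a"
    by (rule ordLess_omega_omegaD) (rule that)
  \<comment> \<open>The coordinates in \<omega>\<cdot>\<omega> of the position just after inning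
    \<beta>. The first coordinate is bounded by that of \<open>a\<close>, so it is constant from
    some inning \<open>\<mu>1\<close> on.\<close>
  define g where "g \<beta> = h (s |` {..<next_inning \<beta>})" for \<beta>
  have pred: "s |` {..<next_inning \<beta>} \<in> strict_preds T (\<subseteq>\<^sub>m) q" if "\<beta> < ?l" for \<beta>
  proof -
    have "s |` {..<next_inning \<beta>} \<noteq> q"
      using up(2)[OF that] q(2) limit_inning_next[OF lim that] less_next_inning[of ?l] by (metis less_asym)
    thus ?thesis using up(1)[OF that] sq map_le_trans unfolding R_def strict_preds_def by blast
  qed
  have g_less: "lex_less (g \<beta>) (g \<gamma>)" if bg: "\<beta> < \<gamma>" "\<gamma> < ?l" for \<beta> \<gamma>
  proof -
    have bl: "\<beta> < ?l" using bg by simp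
    have le: "next_inning \<beta> \<le> next_inning \<gamma>" using bg by (simp add: next_inning_le_iff less_next_inning_iff)
    have "(s |` {..<next_inning \<gamma>}) |` {..<next_inning \<beta>} = s |` {..<next_inning \<beta>}"
      by (rule restrict_restrict_less[OF le])
    moreover have "(s |` {..<next_inning \<gamma>}) |` {..<next_inning \<beta>} \<subseteq>\<^sub>m s |` {..<next_inning \<gamma>}"
      by (rule restrict_map_le)
    ultimately have "s |` {..<next_inning \<beta>} \<subseteq>\<^sub>m s |` {..<next_inning \<gamma>}" by (simp only:)
    hence "(s |` {..<next_inning \<beta>}, s |` {..<next_inning \<gamma>}) \<in> order_on (strict_preds T (\<subseteq>\<^sub>m) q) (\<subseteq>\<^sub>m)"
      using pred[OF bl] pred[OF bg(2)] unfolding order_on_def by simp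
    moreover have "s |` {..<next_inning \<beta>} \<noteq> s |` {..<next_inning \<gamma>}"
    proof
      assume "s |` {..<next_inning \<beta>} = s |` {..<next_inning \<gamma>}"
      from arg_cong[OF this, of seq_length] have "next_inning \<beta> = next_inning \<gamma>"
        unfolding up(2)[OF bl] up(2)[OF bg(2)] .
      thus False using bg(1) by simp
    qed
    ultimately show ?thesis unfolding g_def by (rule h)
  qed
  have g_bound: "fst (g \<beta>) \<le> fst a" if "\<beta> < ?l" for \<beta>
  proof -
    have "lex_less (g \<beta>) a"
      unfolding g_def by (rule ha) (use pred[OF that] in \<open>auto simp: Field_def order_on_def\<close>)
    thus ?thesis unfolding lex_less_def by auto
  qed
  have "\<exists>\<mu>. \<mu> < ?l \<and> (\<forall>\<beta>. \<beta> < ?l \<longrightarrow> fst (g \<beta>) \<le> fst (g \<mu>))"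
    by (rule ex_has_greatest_nat[where k = first_inning and b = "Suc (fst a)"])
      (use first_less g_bound in \<open>auto simp: less_Suc_eq_le\<close>)
  then obtain \<mu>1 where \<mu>1: "\<mu>1 < ?l" "\<And>\<beta>. \<beta> < ?l \<Longrightarrow> fst (g \<beta>) \<le> fst (g \<mu>1)" by blast
  have const: "fst (g \<beta>) = fst (g \<mu>1)" if "\<mu>1 \<le> \<beta>" "\<beta> < ?l" for \<beta>
    using \<mu>1(2)[OF that(2)] g_less[of \<mu>1 \<beta>] that unfolding lex_less_def by (cases "\<beta> = \<mu>1") auto
  \<comment> \<open>Beyond \<open>\<mu>1\<close> only the second coordinate can grow. A limit inning
    \<nu> there would be preceded by infinitely many innings with distinct values below
    \<open>snd (g \<nu>)\<close>.\<close>
  have no_limit: "\<not> limit_inning \<nu>" if \<nu>: "\<mu>1 < \<nu>" "\<nu> < ?l" for \<nu>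
  proof
    assume l\<nu>: "limit_inning \<nu>"
    let ?S = "{\<beta>. \<mu>1 \<le> \<beta> \<and> \<beta> < \<nu>}"
    have less: "snd (g \<beta>) < snd (g \<gamma>)" if "\<mu>1 \<le> \<beta>" "\<beta> < \<gamma>" "\<gamma> \<le> \<nu>" for \<beta> \<gamma>
      using g_less[of \<beta> \<gamma>] const[of \<beta>] const[of \<gamma>] that \<nu>(2) unfolding lex_less_def by auto
    have "inj_on (\<lambda>\<beta>. snd (g \<beta>)) ?S"
    proof (rule inj_onI, rule ccontr)
      fix \<beta> \<gamma> assume bg: "\<beta> \<in> ?S" "\<gamma> \<in> ?S" "snd (g \<beta>) = snd (g \<gamma>)" "\<beta> \<noteq> \<gamma>"
      hence "\<mu>1 \<le> \<beta>" "\<beta> \<le> \<nu>" "\<mu>1 \<le> \<gamma>" "\<gamma> \<le> \<nu>" by auto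
      thus False using less[of \<beta> \<gamma>] less[of \<gamma> \<beta>] bg(3,4) by (metis linorder_neqE less_irrefl)
    qed
    moreover have "(\<lambda>\<beta>. snd (g \<beta>)) ` ?S \<subseteq> {..<snd (g \<nu>)}" using less[of _ \<nu>] by auto
    ultimately have "finite ?S" by (rule inj_on_finite) simp
    thus False using infinite_below_limit_inning[OF l\<nu> \<nu>(1)] by blast
  qed
  define \<mu> where "\<mu> = max \<mu>1 \<mu>2"
  have "the (s \<beta>) = current X t"
    if t: "t \<in> T" "t \<subseteq>\<^sub>m s" "\<mu> < seq_length t" and "seq_length t \<le> \<beta>" "\<beta> < ?l" for t \<beta>
    using \<open>seq_length t \<le> \<beta>\<close> \<open>\<beta> < ?l\<close>
  proof (induction \<beta> rule: less_induct)
    case (less \<beta>)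
    have \<beta>: "\<mu>1 < \<beta>" "\<mu>2 < \<beta>" using t(3) less.prems(1) unfolding \<mu>_def by auto
    have "\<beta> \<noteq> first_inning" using \<beta>(1) by auto
    then obtain \<delta> where \<delta>: "\<beta> = next_inning \<delta>"
      using no_limit[OF \<beta>(1) less.prems(2)] limit_inning_iff by blast
    have \<delta>l: "\<delta> < \<beta>" unfolding \<delta> by simp
    have \<delta>l2: "\<delta> < ?l" by (rule less_trans[OF \<delta>l less.prems(2)])
    let ?u = "s |` {..<\<beta>}"
    have u: "?u \<in> R" "seq_length ?u = \<beta>" using up[OF \<delta>l2] \<delta> by simp_all
    have uT: "?u \<in> T" using u(1) unfolding R_def by blast
    \<comment> \<open>After the last branching node Alice's partition has a single part, which is
      the current set itself, so Bob's move repeats the previous one.\<close>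
    have "?u \<notin> branching_nodes T (\<subseteq>\<^sub>m)" using \<mu>2(2)[of ?u] u \<beta>(2) by auto
    hence nb: "v = w" if "v \<in> immediate_succs T (\<subseteq>\<^sub>m) ?u" "w \<in> immediate_succs T (\<subseteq>\<^sub>m) ?u" for v w
      using uT that unfolding branching_nodes_def by blast
    have single: "V = W" if VW: "V \<in> parts (\<sigma> ?u)" "W \<in> parts (\<sigma> ?u)" for V W
    proof -
      note l = legal[OF T_D[OF uT]]
      have "?u(seq_length ?u \<mapsto> V) = ?u(seq_length ?u \<mapsto> W)"
        by (intro nb extension_immediate_succ[OF uT l] VW)
      thus ?thesis by (metis fun_upd_same option.inject)
    qed
    have mem: "the (s \<beta>) \<in> parts (\<sigma> ?u)" using strategy_domD(3)[OF s less.prems(2)] .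
    have "parts (\<sigma> ?u) = {the (s \<beta>)}" using mem single by blast
    hence cu: "current X ?u = the (s \<beta>)" using parts_cover[OF uT] by simp
    show ?case
    proof (cases "seq_length t = \<beta>")
      case True
      then have "?u = t" using map_le_restrict(1)[OF T_D[OF t(1)] s t(2)] by simp
      then show ?thesis using cu by simp
    next
      case False
      then have "seq_length t \<le> \<delta>" using less.prems(1) \<delta> by (metis less_next_inning_iff order_le_less)
      then have "the (s \<delta>) = current X t" using less.IH[OF \<delta>l] \<delta>l2 by blast
      moreover have "current X ?u = the (?u \<delta>)" using current_succ[OF T_D[OF uT], of \<delta>] u(2) \<delta> by simp
      ultimately show ?thesis using cu \<delta>l by simp
    qed
  qed
  moreover have "\<mu> < ?l" using \<mu>1(1) \<mu>2(1) unfolding \<mu>_def by simp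
  ultimately show ?thesis by blast
qed

section \<open>The pieces of a strategy: jumping over constant stretches\<close>

text \<open>Here \<open>s\<close> is a limit position at the end of a stretch of constant moves
  after \<open>t\<close>. Positions at which the run ends are excluded by
  \<open>parts (\<sigma> s) \<noteq> {}\<close>: they are not jumped to, but are where the infinite
  branches of nodes lead (\<open>branch_point_of_nodes\<close>).\<close>

definition stationary_to :: "'a bob_seq \<Rightarrow> 'a bob_seq \<Rightarrow> bool" where
  "stationary_to t s \<longleftrightarrow> s \<in> D \<and> limit_inning (seq_length s) \<and> t \<subseteq>\<^sub>m s \<and> parts (\<sigma> s) \<noteq> {} \<and>
     (\<forall>\<beta>. seq_length t \<le> \<beta> \<and> \<beta> < seq_length s \<longrightarrow> the (s \<beta>) = current X t)"

lemma stationary_length: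
  assumes t: "t \<in> T" and ts: "stationary_to t s"
  shows "seq_length t < seq_length s"
  using map_le_restrict(2)[OF T_D[OF t], of s] ts T_nonlimit[OF t] unfolding stationary_to_def
  by (metis order_le_less)

lemma stationary_ran:
  assumes t: "t \<in> T" and ts: "stationary_to t s"
  shows "current X t \<in> ran s" "\<Inter>(ran s) = current X t" "current X s = current X t"
proof -
  have s: "s \<in> D" and le: "t \<subseteq>\<^sub>m s" and const: "\<And>\<beta>. seq_length t \<le> \<beta> \<Longrightarrow> \<beta> < seq_length s \<Longrightarrow> the (s \<beta>) = current X t"
    using ts unfolding stationary_to_def by auto
  have lt: "seq_length t < seq_length s" using stationary_length[OF assms] .
  have ran: "ran s = {the (s \<beta>) | \<beta>. \<beta> < seq_length s}" using strategy_dom_ran[OF s] .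
  have "the (s (seq_length t)) = current X t" using const lt by simp
  thus 1: "current X t \<in> ran s" unfolding ran using lt by blast
  have "current X t \<subseteq> the (s \<beta>)" if \<beta>: "\<beta> < seq_length s" for \<beta>
  proof (cases "\<beta> < seq_length t")
    case True
    have "t \<beta> = s \<beta>" using map_le_restrict(1)[OF T_D[OF t] s le] True by (metis lessThan_iff restrict_in)
    then show ?thesis using current_subset[OF T_D[OF t] True] by simp
  next
    case False
    then show ?thesis using const \<beta> by simp
  qed
  thus 2: "\<Inter>(ran s) = current X t" using 1 unfolding ran by blast
  have "current X t \<subseteq> topspace X" unfolding current_def by blast
  thus "current X s = current X t" using 2 unfolding current_def[of X s] by blast
qed

lemma limit_move:
  assumes s: "s \<in> D" and lim: "limit_inning (seq_length s)"
  obtains x where "legal_limit_move X s (parts (\<sigma> s)) x"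
  using legal[OF s]
proof (cases rule: legal_move_cases)
  case (limit P x)
  then show ?thesis using that[of x] by simp
qed (use lim in \<open>auto simp: limit_inning_iff\<close>)

text \<open>Of two such positions the shorter would be an initial part of the longer. But a limit
  move removes a point, so the moves cannot remain constant beyond the shorter one.\<close>

lemma stationary_unique:
  assumes t: "t \<in> T" and s: "stationary_to t s" and s': "stationary_to t s'"
    and le: "seq_length s \<le> seq_length s'"
  shows "s = s'"
proof -
  have D: "s \<in> D" "s' \<in> D" and tle: "t \<subseteq>\<^sub>m s" "t \<subseteq>\<^sub>m s'"
    and const: "\<And>\<beta>. seq_length t \<le> \<beta> \<Longrightarrow> \<beta> < seq_length s \<Longrightarrow> the (s \<beta>) = current X t"
      "\<And>\<beta>. seq_length t \<le> \<beta> \<Longrightarrow> \<beta> < seq_length s' \<Longrightarrow> the (s' \<beta>) = current X t"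
    using s s' unfolding stationary_to_def by auto
  have agree: "s \<beta> = s' \<beta>" if \<beta>: "\<beta> < seq_length s" for \<beta>
  proof (cases "\<beta> < seq_length t")
    case True
    then have "\<beta> \<in> dom t" using strategy_domD(1)[OF T_D[OF t]] by blast
    then show ?thesis using tle unfolding map_le_def by metis
  next
    case False
    have "the (s \<beta>) = the (s' \<beta>)" using const(1)[of \<beta>] const(2)[of \<beta>] False \<beta> le by simp
    then show ?thesis using strategy_dom_at[OF D(1) \<beta>] strategy_dom_at[OF D(2), of \<beta>] \<beta> le by simp
  qed
  have seq: "s = s' |` {..<seq_length s}"
  proof
    fix \<beta> show "s \<beta> = (s' |` {..<seq_length s}) \<beta>"
      using agree[of \<beta>] strategy_domD(1)[OF D(1)] by (cases "\<beta> < seq_length s") (auto simp: domIff)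
  qed
  have "seq_length s = seq_length s'"
  proof (rule ccontr)
    assume "\<not> ?thesis"
    hence lt: "seq_length s < seq_length s'" using le by simp
    have "the (s' (seq_length s)) \<in> parts (\<sigma> s)" using strategy_domD(3)[OF D(2) lt] seq by simp
    moreover have "the (s' (seq_length s)) = current X t"
      using const(2) stationary_length[OF t s] lt by simp
    moreover obtain x where "legal_limit_move X s (parts (\<sigma> s)) x"
      using limit_move[OF D(1)] s unfolding stationary_to_def by blast
    hence "x \<in> \<Inter>(ran s)" "x \<notin> \<Union>(parts (\<sigma> s))" unfolding legal_limit_move_def by auto
    ultimately show False using stationary_ran(2)[OF t s] by blast
  qed
  thus ?thesis using seq restrict_full[OF D(2)] by simp
qed

text \<open>The jump replaces \<open>t\<close> by the limit position at the end of its constant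
  stretch. The current set stays the same, so Alice's limit move there splits the set of
  \<open>t\<close>.\<close>

definition base :: "'a bob_seq \<Rightarrow> 'a bob_seq" where
  "base t = (if \<exists>s. stationary_to t s then SOME s. stationary_to t s else t)"

definition children :: "'a bob_seq \<Rightarrow> 'a bob_seq set" where
  "children t = {(base t)(seq_length (base t) \<mapsto> V) | V. V \<in> parts (\<sigma> (base t))}"

lemma base_stationary:
  assumes t: "t \<in> T" and s: "stationary_to t s"
  shows "base t = s"
proof -
  have "stationary_to t (base t)" unfolding base_def using s someI[of "stationary_to t"] by metis
  thus ?thesis using stationary_unique[OF t s] stationary_unique[OF t _ s] by (metis linear)
qed

lemma base_cases:
  obtains (stay) "base t = t" | (jump) "stationary_to t (base t)"
  unfolding base_def using someI_ex[of "stationary_to t"] by (cases "\<exists>s. stationary_to t s") simp_all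

lemma base:
  assumes t: "t \<in> T"
  shows "base t \<in> D" "t \<subseteq>\<^sub>m base t" "current X (base t) = current X t"
proof -
  have "base t \<in> D \<and> t \<subseteq>\<^sub>m base t \<and> current X (base t) = current X t"
  proof (cases t rule: base_cases)
    case stay
    then show ?thesis using T_D[OF t] map_le_refl by simp
  next
    case jump
    then show ?thesis using stationary_ran(3)[OF t jump] unfolding stationary_to_def by simp
  qed
  thus "base t \<in> D" "t \<subseteq>\<^sub>m base t" "current X (base t) = current X t" by auto
qed

lemma child:
  assumes t: "t \<in> T" and c: "c \<in> children t"
  shows "c \<in> T" "t \<subseteq>\<^sub>m c" "seq_length c = next_inning (seq_length (base t))"
    "seq_length t < seq_length c" "current X c \<in> parts (\<sigma> (base t))" "current X c \<subseteq> current X t"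
proof -
  note b = base[OF t]
  obtain V where V: "V \<in> parts (\<sigma> (base t))" "c = (base t)(seq_length (base t) \<mapsto> V)"
    using c unfolding children_def by blast
  note e = extend_position[OF b(1) legal[OF b(1)] V(1)]
  show "c \<in> T" using extension_in_T[OF b(1) V(1)] V(2) by simp
  have "base t \<subseteq>\<^sub>m c" using restrict_map_le[of c "{..<seq_length (base t)}"] e(3) V(2) by simp
  thus "t \<subseteq>\<^sub>m c" using b(2) map_le_trans by blast
  show l: "seq_length c = next_inning (seq_length (base t))" using e(2) V(2) by simp
  show "seq_length t < seq_length c"
    using map_le_restrict(2)[OF T_D[OF t] b(1,2)] by (simp add: l less_next_inning_iff)
  have cV: "current X c = V" using e(4) V(2) by simp
  show "current X c \<in> parts (\<sigma> (base t))" using cV V(1) by simp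
  show "current X c \<subseteq> current X t" using legal_subset_current[OF b(1) legal[OF b(1)] V(1)] cV b(3) by simp
qed

lemma children_determined:
  assumes t: "t \<in> T" and c: "c \<in> children t" "c' \<in> children t" "z \<in> current X c" "z \<in> current X c'"
  shows "c = c'"
proof -
  note b = base[OF t]
  obtain V W where VW: "V \<in> parts (\<sigma> (base t))" "c = (base t)(seq_length (base t) \<mapsto> V)"
    "W \<in> parts (\<sigma> (base t))" "c' = (base t)(seq_length (base t) \<mapsto> W)"
    using c(1,2) unfolding children_def by blast
  have "current X c = V" "current X c' = W"
    using extend_position(4)[OF b(1) legal[OF b(1)]] VW by simp_all
  hence "V = W" using c(3,4) VW legal_parts_disjoint[OF legal[OF b(1)]] disjointD by blast
  thus ?thesis using VW by simp
qed

lemma current_children: "t \<in> T \<Longrightarrow> current X ` children t = parts (\<sigma> (base t))"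
proof
  assume t: "t \<in> T"
  show "current X ` children t \<subseteq> parts (\<sigma> (base t))" using child(5)[OF t] by blast
  show "parts (\<sigma> (base t)) \<subseteq> current X ` children t"
  proof
    fix V assume V: "V \<in> parts (\<sigma> (base t))"
    hence "current X ((base t)(seq_length (base t) \<mapsto> V)) = V"
      using extend_position(4)[OF base(1)[OF t] legal[OF base(1)[OF t]]] by blast
    thus "V \<in> current X ` children t" using V unfolding children_def by blast
  qed
qed

primrec nodes :: "nat \<Rightarrow> 'a bob_seq set" where
  "nodes 0 = {Map.empty}"
| "nodes (Suc k) = \<Union>(children ` nodes k)"

lemma nodes_T: "t \<in> nodes k \<Longrightarrow> t \<in> T"
  by (induction k arbitrary: t) (use empty_in_T child(1) in auto)

text \<open>A node can be recovered from its level and one point of its set. This lifts decreasing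
  sequences of pieces to chains of positions.\<close>

lemma nodes_determined:
  "t \<in> nodes k \<Longrightarrow> t' \<in> nodes k \<Longrightarrow> z \<in> current X t \<Longrightarrow> z \<in> current X t' \<Longrightarrow> t = t'"
proof (induction k arbitrary: t t')
  case (Suc k)
  obtain u u' where u: "u \<in> nodes k" "t \<in> children u" "u' \<in> nodes k" "t' \<in> children u'"
    using Suc.prems(1,2) by auto
  have "z \<in> current X u" "z \<in> current X u'"
    using child(6)[OF nodes_T[OF u(1)] u(2)] child(6)[OF nodes_T[OF u(3)] u(4)] Suc.prems(3,4) by blast+
  hence "u = u'" using Suc.IH u by blast
  thus ?case using children_determined[OF nodes_T[OF u(1)] u(2)] u(4) Suc.prems(3,4) by blast
qed simp

definition pieces :: "nat \<Rightarrow> 'a set set" where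
  "pieces k = current X ` nodes k"

text \<open>A piece of the next level inside \<open>current X t\<close> comes from a child of
  \<open>t\<close>, since it is nonempty and the sets of distinct nodes of level \<open>k\<close>
  are disjoint.\<close>

lemma subpieces_pieces:
  assumes t: "t \<in> nodes k"
  shows "subpieces pieces k (current X t) = parts (\<sigma> (base t))"
proof
  note tT = nodes_T[OF t]
  show "parts (\<sigma> (base t)) \<subseteq> subpieces pieces k (current X t)"
  proof
    fix V assume "V \<in> parts (\<sigma> (base t))"
    then obtain c where c: "c \<in> children t" "V = current X c" using current_children[OF tT] by blast
    have "c \<in> nodes (Suc k)" using c(1) t by auto
    thus "V \<in> subpieces pieces k (current X t)"
      using child(6)[OF tT c(1)] c(2) unfolding subpieces_def pieces_def by blast
  qed
  show "subpieces pieces k (current X t) \<subseteq> parts (\<sigma> (base t))"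
  proof
    fix V assume "V \<in> subpieces pieces k (current X t)"
    then obtain c where c: "c \<in> nodes (Suc k)" "V = current X c" "V \<subseteq> current X t"
      unfolding subpieces_def pieces_def by blast
    then obtain u where u: "u \<in> nodes k" "c \<in> children u" by auto
    obtain z where z: "z \<in> V" using current_open_nonempty(2)[OF nodes_T[OF c(1)]] c(2) by blast
    have "z \<in> current X u" using child(6)[OF nodes_T[OF u(1)] u(2)] z c(2) by blast
    hence "u = t" using nodes_determined[OF u(1) t] z c(3) by blast
    thus "V \<in> parts (\<sigma> (base t))" using child(5)[OF tT] u(2) c(2) by blast
  qed
qed

text \<open>After a jump the local basis of the limit move uses all earlier moves of Bob. The set of
  \<open>t\<close> is one of them and the smallest, so its own differences form a local basis
  already.\<close>

lemma pieces_cases: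
  assumes t: "t \<in> nodes k"
  shows "\<Union>(parts (\<sigma> (base t))) = current X t \<or> (\<exists>x. limit_piece X (current X t) (parts (\<sigma> (base t))) x)"
proof (cases t rule: base_cases)
  case stay
  then show ?thesis using parts_cover[OF nodes_T[OF t]] by simp
next
  case jump
  let ?s = "base t" let ?P = "parts (\<sigma> ?s)" let ?W = "current X t"
  note ran = stationary_ran[OF nodes_T[OF t] jump]
  obtain x where x: "legal_limit_move X ?s ?P x"
    using limit_move[of ?s] jump unfolding stationary_to_def by blast
  have lb: "local_basis_at X x {U - \<Union>\<F> | U \<F>. U \<in> ran ?s \<and> finite \<F> \<and> \<F> \<subseteq> ?P}"
    and un: "?W = \<Union>?P \<union> {x}" and nx: "x \<notin> \<Union>?P"
    using x ran(2) unfolding legal_limit_move_def by simp_all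
  have "local_basis_at X x {?W - \<Union>\<F> | \<F>. finite \<F> \<and> \<F> \<subseteq> ?P}"
    unfolding local_basis_at_def
  proof (intro conjI ballI allI impI)
    fix V assume "V \<in> {?W - \<Union>\<F> | \<F>. finite \<F> \<and> \<F> \<subseteq> ?P}"
    hence "V \<in> {U - \<Union>\<F> | U \<F>. U \<in> ran ?s \<and> finite \<F> \<and> \<F> \<subseteq> ?P}" using ran(1) by blast
    thus "openin X V" "x \<in> V" using local_basis_atD(1,2)[OF lb] by blast+
  next
    fix V assume "openin X V \<and> x \<in> V"
    then obtain U \<F> where "U \<in> ran ?s" "finite \<F>" "\<F> \<subseteq> ?P" "U - \<Union>\<F> \<subseteq> V"
      using local_basis_atD(3)[OF lb, of V] by blast
    moreover hence "?W \<subseteq> U" using ran(2) by blast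
    ultimately show "\<exists>V'\<in>{?W - \<Union>\<F> | \<F>. finite \<F> \<and> \<F> \<subseteq> ?P}. V' \<subseteq> V"
      by (intro bexI[of _ "?W - \<Union>\<F>"]) blast+
  qed
  hence "limit_piece X ?W ?P x" unfolding limit_piece_def using un nx by simp
  thus ?thesis by blast
qed

text \<open>The union of the chain is a limit position. The run cannot survive it, so Alice wins
  there and her last move certifies the single point and its local basis.\<close>

lemma branch_point_of_nodes:
  assumes t: "\<And>k. t k \<in> nodes k" "\<And>k. t (Suc k) \<in> children (t k)"
  shows "\<exists>x. \<Inter>(range (\<lambda>k. current X (t k))) = {x} \<and> local_basis_at X x (range (\<lambda>k. current X (t k)))"
proof -
  note tT = nodes_T[OF t(1)] and tD = T_D[OF nodes_T[OF t(1)]]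
  have le1: "t k \<subseteq>\<^sub>m t (Suc k)" and len1: "seq_length (t k) < seq_length (t (Suc k))" for k
    using child(2,4)[OF tT t(2)] by blast+
  have mono: "t k \<subseteq>\<^sub>m t j" if "k \<le> j" for k j
    using that by (induction j rule: dec_induct) (use le1 map_le_trans map_le_refl in blast)+
  \<comment> \<open>The supremum of the lengths; the lengths increase strictly, so it is not
    attained and is a limit inning.\<close>
  define l where "l = (LEAST \<alpha>. \<forall>k. seq_length (t k) \<le> \<alpha>)"
  have l: "seq_length (t k) \<le> l" for k
    unfolding l_def using LeastI_ex[OF countable_innings_bounded[of "\<lambda>k. seq_length (t k)"]] by blast
  have l_less: "seq_length (t k) < l" for k using len1[of k] l[of "Suc k"] by simp
  have below_l: "\<exists>k. \<beta> < seq_length (t k)" if "\<beta> < l" for \<beta>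
    using not_less_Least[of \<beta> "\<lambda>\<alpha>. \<forall>k. seq_length (t k) \<le> \<alpha>"] that unfolding l_def by (auto simp: not_le)
  have agree: "t k \<beta> = t j \<beta>" if "\<beta> < seq_length (t k)" "\<beta> < seq_length (t j)" for k j \<beta>
  proof -
    have "\<beta> \<in> dom (t k)" "\<beta> \<in> dom (t j)"
      using that strategy_domD(1)[OF tD, of k] strategy_domD(1)[OF tD, of j] by blast+
    thus ?thesis using mono[of k j] mono[of j k] unfolding map_le_def by (metis linear)
  qed
  define s where "s \<beta> = (if \<beta> < l then t (SOME k. \<beta> < seq_length (t k)) \<beta> else None)" for \<beta>
  have s_t: "s \<beta> = t k \<beta>" if "\<beta> < seq_length (t k)" for \<beta> k
  proof -
    have "\<beta> < seq_length (t (SOME k. \<beta> < seq_length (t k)))" using that by (rule someI)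
    hence "t (SOME k. \<beta> < seq_length (t k)) \<beta> = t k \<beta>" using that by (rule agree)
    thus ?thesis using less_trans[OF that l_less] unfolding s_def by simp
  qed
  have restr: "s |` {..<\<beta>} = t k |` {..<\<beta>}" if "\<beta> \<le> seq_length (t k)" for \<beta> k
    using s_t that by (auto simp: restrict_map_def fun_eq_iff)
  have dom_s: "dom s = {..<l}"
  proof -
    have "s \<beta> \<noteq> None" if \<beta>: "\<beta> < l" for \<beta>
    proof -
      obtain k where "\<beta> < seq_length (t k)" using below_l[OF \<beta>] by blast
      thus ?thesis using s_t strategy_dom_at[OF tD] by (metis option.distinct(1))
    qed
    moreover have "s \<beta> = None" if "\<not> \<beta> < l" for \<beta> using that unfolding s_def by simp
    ultimately have "\<beta> \<in> dom s \<longleftrightarrow> \<beta> \<in> {..<l}" for \<beta> by (cases "\<beta> < l") (simp_all add: domIff)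
    thus ?thesis by (rule set_eqI)
  qed
  have s: "s \<in> D"
  proof (rule strategy_domI[OF dom_s])
    fix \<beta> assume "\<beta> < l"
    then obtain k where k: "\<beta> < seq_length (t k)" using below_l by blast
    hence "s |` {..<\<beta>} = t k |` {..<\<beta>}" "s \<beta> = t k \<beta>" using restr[of \<beta> k] s_t by simp_all
    thus "legal_move X (s |` {..<\<beta>}) (\<sigma> (s |` {..<\<beta>}))" "the (s \<beta>) \<in> parts (\<sigma> (s |` {..<\<beta>}))"
      using strategy_domD(2,3)[OF tD k] by simp_all
  qed
  have len_s: "seq_length s = l" using dom_s by (rule seq_length_eq)
  have lim: "limit_inning l"
  proof (cases l rule: inning_cases)
    case first
    then show ?thesis using l_less[of 0] by simp
  next
    case (succ \<delta>)
    then obtain k where "\<delta> < seq_length (t k)" using below_l[of \<delta>] by auto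
    then show ?thesis using l_less[of k] succ by (simp add: less_next_inning_iff)
  qed
  have t_le: "t k \<subseteq>\<^sub>m s" for k
    unfolding map_le_def using strategy_domD(1)[OF tD] s_t by auto
  \<comment> \<open>If the run went on, some \<open>t k\<close> would be stationary up to
    \<open>s\<close> and its base would be \<open>s\<close>. The next node would then be longer than
    \<open>s\<close>, although all nodes of the chain are shorter.\<close>
  have no_parts: "parts (\<sigma> s) = {}"
  proof (rule ccontr)
    assume ne: "parts (\<sigma> s) \<noteq> {}"
    obtain \<mu> where \<mu>: "\<mu> < l" "\<And>u \<beta>. u \<in> T \<Longrightarrow> u \<subseteq>\<^sub>m s \<Longrightarrow> \<mu> < seq_length u \<Longrightarrow>
      seq_length u \<le> \<beta> \<Longrightarrow> \<beta> < l \<Longrightarrow> the (s \<beta>) = current X u"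
      using eventually_stationary[OF s] lim ne unfolding len_s by blast
    obtain k where k: "\<mu> < seq_length (t k)" using below_l[OF \<mu>(1)] by blast
    have "stationary_to (t k) s"
      unfolding stationary_to_def using s lim ne t_le \<mu>(2)[OF tT t_le k] len_s by simp
    hence "base (t k) = s" by (rule base_stationary[OF tT])
    hence "seq_length (t (Suc k)) = next_inning l" using child(3)[OF tT t(2), of k] len_s by simp
    thus False using l_less[of "Suc k"] less_next_inning[of l] by (metis less_asym)
  qed
  obtain x where x: "legal_limit_move X s {} x" using limit_move[OF s] lim no_parts len_s by metis
  have "{U - \<Union>\<F> | U \<F>. U \<in> ran s \<and> finite \<F> \<and> \<F> \<subseteq> {}} = ran s" by auto
  hence lb: "local_basis_at X x (ran s)" and int: "\<Inter>(ran s) = {x}" and xX: "x \<in> topspace X"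
    using x unfolding legal_limit_move_def by simp_all
  have ran: "ran s = {the (s \<beta>) | \<beta>. \<beta> < l}" using strategy_dom_ran[OF s] len_s by simp
  have sub: "\<exists>k. current X (t k) \<subseteq> U" if "U \<in> ran s" for U
  proof -
    obtain \<beta> where \<beta>: "\<beta> < l" "U = the (s \<beta>)" using \<open>U \<in> ran s\<close> unfolding ran by blast
    obtain k where k: "\<beta> < seq_length (t k)" using below_l[OF \<beta>(1)] by blast
    have "current X (t k) \<subseteq> U" using current_subset[OF tD k] s_t[OF k] \<beta>(2) by simp
    thus ?thesis ..
  qed
  have x_in: "x \<in> current X (t k)" for k
  proof -
    have "ran (t k) \<subseteq> ran s"
    proof
      fix U assume "U \<in> ran (t k)"
      then obtain \<beta> where \<beta>: "t k \<beta> = Some U" unfolding ran_def by blast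
      moreover hence "\<beta> \<in> dom (t k)" by blast
      hence "s \<beta> = t k \<beta>" using t_le[of k] unfolding map_le_def by simp
      ultimately show "U \<in> ran s" by (simp add: ranI)
    qed
    hence "\<Inter>(ran s) \<subseteq> \<Inter>(ran (t k))" by (rule Inter_anti_mono)
    thus ?thesis using xX int unfolding current_def by simp
  qed
  have "\<Inter>(range (\<lambda>k. current X (t k))) \<subseteq> \<Inter>(ran s)"
  proof (rule Inter_greatest)
    fix U assume "U \<in> ran s"
    then obtain k where "current X (t k) \<subseteq> U" using sub by blast
    thus "\<Inter>(range (\<lambda>k. current X (t k))) \<subseteq> U" by blast
  qed
  moreover have "x \<in> \<Inter>(range (\<lambda>k. current X (t k)))" using x_in by simp
  ultimately have "\<Inter>(range (\<lambda>k. current X (t k))) = {x}" unfolding int by blast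
  moreover have "local_basis_at X x (range (\<lambda>k. current X (t k)))"
    unfolding local_basis_at_def
  proof (intro conjI ballI allI impI)
    fix V assume "V \<in> range (\<lambda>k. current X (t k))"
    then obtain k where k: "V = current X (t k)" by blast
    show "openin X V" unfolding k by (rule current_open_nonempty(1)[OF tT])
    show "x \<in> V" unfolding k by (rule x_in)
  next
    fix V assume "openin X V \<and> x \<in> V"
    then obtain U where "U \<in> ran s" "U \<subseteq> V" using local_basis_atD(3)[OF lb, of V] by blast
    moreover then obtain k where "current X (t k) \<subseteq> U" using sub by blast
    ultimately show "\<exists>V'\<in>range (\<lambda>k. current X (t k)). V' \<subseteq> V"
      by (intro bexI[of _ "current X (t k)"] rangeI) (rule subset_trans)
  qed
  ultimately show ?thesis by (intro exI[of _ x] conjI)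
qed

theorem piece_tree_pieces: "piece_tree X pieces"
proof -
  have "pieces 0 = {topspace X}" unfolding pieces_def by simp
  moreover have "disjoint (pieces k)" for k
    unfolding pieces_def
  proof (rule disjointI)
    fix A B assume AB: "A \<in> current X ` nodes k" "B \<in> current X ` nodes k" "A \<noteq> B"
    then obtain u v where "u \<in> nodes k" "v \<in> nodes k" "A = current X u" "B = current X v" "u \<noteq> v" by blast
    thus "A \<inter> B = {}" using nodes_determined by blast
  qed
  moreover have "U \<noteq> {} \<and> openin X U" if "U \<in> pieces k" for k U
    using that current_open_nonempty nodes_T unfolding pieces_def by auto
  moreover have "\<exists>U\<in>pieces k. W \<subseteq> U" if W: "W \<in> pieces (Suc k)" for k W
  proof -
    obtain u c where u: "u \<in> nodes k" "c \<in> children u" "W = current X c" using W unfolding pieces_def by auto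
    thus ?thesis using child(6)[OF nodes_T[OF u(1)] u(2)] unfolding pieces_def by blast
  qed
  moreover have "\<Union>(subpieces pieces k U) = U \<or> (\<exists>x. limit_piece X U (subpieces pieces k U) x)"
    if U: "U \<in> pieces k" for k U
  proof -
    obtain u where u: "u \<in> nodes k" "U = current X u" using U unfolding pieces_def by blast
    show ?thesis using pieces_cases[OF u(1)] unfolding u(2) subpieces_pieces[OF u(1)] .
  qed
  moreover have "\<exists>x. \<Inter>(range f) = {x} \<and> local_basis_at X x (range f)"
    if f: "\<forall>k. f k \<in> pieces k \<and> f (Suc k) \<subseteq> f k" for f
  proof -
    have "\<exists>u. u \<in> nodes k \<and> f k = current X u" for k using f unfolding pieces_def by blast
    then obtain t where t: "\<And>k. t k \<in> nodes k" "\<And>k. f k = current X (t k)" by metis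
    have "t (Suc k) \<in> children (t k)" for k
    proof -
      obtain u where u: "u \<in> nodes k" "t (Suc k) \<in> children u" using t(1)[of "Suc k"] by auto
      obtain z where z: "z \<in> current X (t (Suc k))" using current_open_nonempty(2)[OF nodes_T[OF t(1)]] by blast
      have "z \<in> current X u" using child(6)[OF nodes_T[OF u(1)] u(2)] z by blast
      moreover have "z \<in> current X (t k)" using z f t(2) by blast
      ultimately have "u = t k" using nodes_determined[OF u(1) t(1)] by blast
      thus ?thesis using u(2) by simp
    qed
    hence "\<exists>x. \<Inter>(range (\<lambda>k. current X (t k))) = {x} \<and> local_basis_at X x (range (\<lambda>k. current X (t k)))"
      by (rule branch_point_of_nodes[OF t(1)])
    moreover have "f = (\<lambda>k. current X (t k))" using t(2) by blast
    ultimately show ?thesis by simp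
  qed
  ultimately show ?thesis unfolding piece_tree_def by simp
qed

end

theorem strategy_imp_piece_tree:
  assumes "topspace X \<noteq> {}" and "winning_strategy X \<sigma>"
    and "height_bounded_by (succ_dom X \<sigma>) (\<subseteq>\<^sub>m) omega_omega"
    and "\<forall>R. nonmaximal_tree_ray (succ_dom X \<sigma>) (\<subseteq>\<^sub>m) R \<longrightarrow>
      finite (R \<inter> branching_nodes (succ_dom X \<sigma>) (\<subseteq>\<^sub>m))"
  shows "\<exists>\<U>. piece_tree X \<U>"
proof -
  interpret bounded_winning_strategy X \<sigma> by unfold_locales (use assms in blast)+
  show ?thesis using piece_tree_pieces by blast
qed

text \<open>Existence of a graph cannot quantify over vertex types, so the equivalence is stated for
  vertices in \<open>'a \<times> nat\<close>. The second conjunct shows that nothing is lost: a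
  graph on any type can be replaced by one on this type, by passing through a tree of
  pieces.\<close>

theorem corollary3p22:
  fixes X :: "'a topology"
  assumes "topspace X \<noteq> {}"
  shows "((\<exists>(V :: ('a \<times> nat) set) E. is_graph V E \<and> X homeomorphic_space edge_end_space V E) \<longleftrightarrow>
          (\<exists>\<sigma>. winning_strategy X \<sigma> \<and>
               height_bounded_by (succ_dom X \<sigma>) (\<subseteq>\<^sub>m) omega_omega \<and>
               (\<forall>R. nonmaximal_tree_ray (succ_dom X \<sigma>) (\<subseteq>\<^sub>m) R \<longrightarrow>
                    finite (R \<inter> branching_nodes (succ_dom X \<sigma>) (\<subseteq>\<^sub>m)))))
       \<and> ((\<exists>(V :: 'v set) E. is_graph V E \<and> X homeomorphic_space edge_end_space V E) \<longrightarrow>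
          (\<exists>(V :: ('a \<times> nat) set) E. is_graph V E \<and> X homeomorphic_space edge_end_space V E))"
proof -
  have to_strategy: "\<exists>\<sigma>. winning_strategy X \<sigma> \<and> height_bounded_by (succ_dom X \<sigma>) (\<subseteq>\<^sub>m) omega_omega \<and>
      (\<forall>R. nonmaximal_tree_ray (succ_dom X \<sigma>) (\<subseteq>\<^sub>m) R \<longrightarrow>
        finite (R \<inter> branching_nodes (succ_dom X \<sigma>) (\<subseteq>\<^sub>m)))"
    if "\<exists>(V :: ('a \<times> nat) set) E. is_graph V E \<and> X homeomorphic_space edge_end_space V E"
    using that graph_imp_piece_tree[OF _ _ assms] piece_tree_imp_strategy by metis
  have to_graph: "\<exists>(V :: ('a \<times> nat) set) E. is_graph V E \<and> X homeomorphic_space edge_end_space V E"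
    if "winning_strategy X \<sigma>" "height_bounded_by (succ_dom X \<sigma>) (\<subseteq>\<^sub>m) omega_omega"
      "\<forall>R. nonmaximal_tree_ray (succ_dom X \<sigma>) (\<subseteq>\<^sub>m) R \<longrightarrow>
        finite (R \<inter> branching_nodes (succ_dom X \<sigma>) (\<subseteq>\<^sub>m))" for \<sigma>
    using strategy_imp_piece_tree[OF assms that] piece_tree_imp_graph by blast
  have transfer: "\<exists>(V :: ('a \<times> nat) set) E. is_graph V E \<and> X homeomorphic_space edge_end_space V E"
    if "\<exists>(V :: 'v set) E. is_graph V E \<and> X homeomorphic_space edge_end_space V E"
    using that graph_imp_piece_tree[OF _ _ assms] piece_tree_imp_graph by metis
  show ?thesis using to_strategy to_graph transfer by (intro conjI iffI impI) (blast, blast, blast)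
qed

end
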